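(* Let $0\le\alpha<1$, $s \geq 0$, and let $\psi\in L^2(\mathbb{R})$, $\psi\ne 0$, be such that $\hat\psi\in C^3(\mathbb{R})$ and, for some constant $C>0$, $|\hat\psi^{(n)}(\xi)| \leq C (1+|\xi|)^{-r}$ for all $\xi\in\mathbb{R}$ and $n=0,1,2,3$, with $$r>\frac{2+2s+7\alpha-4\alpha^2}{2(1-\alpha)^2}+1.$$ Let $\mathcal{U}^\varepsilon$, $0<\varepsilon<\varepsilon_0$, be the admissible covering of $\mathbb{R}^2$ defined in the context. Then there is an appropriate choice of a measurable function $\Gamma:\mathbb{R}^2\times \mathbb{R}^2\rightarrow\mathbb{C}$ with $|\Gamma|\equiv 1$ such that $$\gamma(\varepsilon)=\max\{\gamma_1(\varepsilon),\gamma_2(\varepsilon)\}\rightarrow 0 \quad\text{for } \varepsilon\rightarrow 0,$$ where $$\gamma_1(\varepsilon)= \sup_{(x^\ast,\omega^\ast) \in \mathbb{R}^2}\int_{\mathbb{R}}\int_{\mathbb{R}}\left|osc_{\mathcal{U}^\varepsilon,\Gamma}(x,\omega,x^\ast,\omega^\ast)\right|w_s(\omega,\omega^\ast)\,dx\,d\omega$$ and $$\gamma_2(\varepsilon)=\sup_{(x,\omega) \in \mathbb{R}^2}\int_{\mathbb{R}}\int_{\mathbb{R}}\left|osc_{\mathcal{U}^\varepsilon,\Gamma}(x,\omega,x^\ast,\omega^\ast)\right|w_s(\omega,\omega^\ast)\,dx^\ast\, d\omega^\ast .$$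
   Context: Fourier transform: $\hat f(\xi)=\int_{\mathbb{R}} f(x)e^{-2\pi i \xi x}\,dx$. Operators on $L^2(\mathbb{R})$: $T_xf(t)=f(t-x)$, $M_\omega f(t)=e^{2\pi i\omega t}f(t)$, $D_af(t)=a^{-1/2}f(t/a)$ ($x,\omega\in\mathbb{R}$, $a>0$). Let $\beta(\omega)=(1+|\omega|)^{-\alpha}$ and $\pi(\sigma(x,\omega))=T_xM_\omega D_{\beta(\omega)}$. $A_\sigma$ is defined weakly by $A_\sigma f=\int_{\mathbb{R}}\int_{\mathbb{R}}\langle f,\pi(\sigma(x,\omega))\psi\rangle\,\pi(\sigma(x,\omega))\psi\,dx\,d\omega$. It is known that it is the Fourier multiplier $\widehat{A_\sigma f}=m_\psi\hat f$ with $m_\psi(\xi)=\int_{\mathbb{R}}|\hat\psi(\beta(\omega)(\xi-\omega))|^2\beta(\omega)\,d\omega$. Under the stated hypotheses on $\psi$ the symbol $m_\psi$ is bounded above and bounded below away from zero, so $A_\sigma$ is boundedly invertible. The reproducing kernel is $$\mathcal{R}(x,\omega,x^\ast,\omega^\ast)=\langle A_\sigma^{-1}\pi(\sigma(x,\omega))\psi,\pi(\sigma(x^\ast,\omega^\ast))\psi\rangle.$$ Weight: $w_s(\omega,\omega^\ast)=\max\left\{\frac{1+|\omega^\ast|}{1+|\omega|},\frac{1+|\omega|}{1+|\omega^\ast|}\right\}^{|s|}$. Covering: let $p_\alpha(\omega)=\mathrm{sgn}(\omega)\big((1+(1-\alpha)|\omega|)^{1/(1-\alpha)}-1\big)$ and,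 for $\varepsilon>0$ and $j\in\mathbb{Z}$, $\omega_j=p_\alpha(\varepsilon j)$. Then $\mathcal{U}^\varepsilon=\{U^\varepsilon_{j,k}\}_{j,k\in\mathbb{Z}}$ with $$U_{j,k}^\varepsilon = \big(\varepsilon\beta(\omega_j)(k-1),\varepsilon\beta(\omega_j)(k+1)\big)\times\big(\omega_j-2\varepsilon c\beta(\omega_j)^{-1},\ \omega_j+2\varepsilon c\beta(\omega_j)^{-1}\big).$$ Here $c>0$ and $\varepsilon_0>0$ are fixed constants such that $\mathcal{U}^\varepsilon$ is an admissible covering of $\mathbb{R}^2$ for all $0<\varepsilon<\varepsilon_0$. Here an admissible covering means a countable family of relatively compact sets with non-empty interior which covers $\mathbb{R}^2$ and for which there is a finite $N$ such that each member meets at most $N$ members of the family. For $(x,\omega)\in\mathbb{R}^2$ let $Q_{x,\omega}=\bigcup\{U^\varepsilon_{j,k}: (x,\omega)\in U^\varepsilon_{j,k}\}$. The local oscillations kernel is $$osc_{\mathcal{U}^\varepsilon,\Gamma}(x,\omega,x^\ast,\omega^\ast)=\sup_{(y,\eta)\in Q_{x^\ast,\omega^\ast}}\big|\mathcal{R}(x,\omega,x^\ast,\omega^\ast)-\Gamma(x^\ast,\omega^\ast,y,\eta)\,\mathcal{R}(x,\omega,y,\eta)\big|.$$ *)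

theory Defs
  imports "HOL-Analysis.Analysis"
begin

text \<open>Elements of $L^2(R)$ are represented by square-integrable functions; two of them are the same
  element iff they agree almost everywhere.\<close>

definition L2 :: "(real \<Rightarrow> complex) \<Rightarrow> bool" where
  "L2 f \<longleftrightarrow> f \<in> borel_measurable lborel \<and> integrable lborel (\<lambda>t. (cmod (f t))\<^sup>2)"

definition L2_inner :: "(real \<Rightarrow> complex) \<Rightarrow> (real \<Rightarrow> complex) \<Rightarrow> complex" where
  "L2_inner f g = (LINT t|lborel. f t * cnj (g t))"

text \<open>A function in $L^2$ need not be integrable, so its Fourier transform is the $L^2$-limit of the
  Fourier integrals of its truncations to \<open>[-N, N]\<close>. It is determined only up to null sets, hence
  the relational form.\<close>

definition is_fourier_transform :: "(real \<Rightarrow> complex) \<Rightarrow> (real \<Rightarrow> complex) \<Rightarrow> bool" where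
  "is_fourier_transform f F \<longleftrightarrow> L2 F \<and>
     ((\<lambda>N::real. \<integral>\<^sup>+ \<xi>. ennreal ((cmod (F \<xi> -
          (LINT x:{-N..N}|lborel. f x * exp (- 2 * of_real pi * \<i> * of_real \<xi> * of_real x))))\<^sup>2)
        \<partial>lborel) \<longlongrightarrow> 0) at_top"

definition nth_deriv :: "nat \<Rightarrow> (real \<Rightarrow> complex) \<Rightarrow> real \<Rightarrow> complex" where
  "nth_deriv n F = ((\<lambda>G x. vector_derivative G (at x)) ^^ n) F"

definition C_k :: "nat \<Rightarrow> (real \<Rightarrow> complex) \<Rightarrow> bool" where
  "C_k k F \<longleftrightarrow> (\<forall>n<k. \<forall>x. nth_deriv n F differentiable (at x)) \<and>
     continuous_on UNIV (nth_deriv k F)"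

definition translation :: "real \<Rightarrow> (real \<Rightarrow> complex) \<Rightarrow> real \<Rightarrow> complex" where
  "translation x f = (\<lambda>t. f (t - x))"

definition modulation :: "real \<Rightarrow> (real \<Rightarrow> complex) \<Rightarrow> real \<Rightarrow> complex" where
  "modulation \<omega> f = (\<lambda>t. exp (2 * of_real pi * \<i> * of_real \<omega> * of_real t) * f t)"

definition dilation :: "real \<Rightarrow> (real \<Rightarrow> complex) \<Rightarrow> real \<Rightarrow> complex" where
  "dilation a f = (\<lambda>t. of_real (a powr (- 1 / 2)) * f (t / a))"

definition beta :: "real \<Rightarrow> real \<Rightarrow> real" where
  "beta \<alpha> \<omega> = (1 + \<bar>\<omega>\<bar>) powr (- \<alpha>)"

definition pi_sigma :: "real \<Rightarrow> real \<Rightarrow> real \<Rightarrow> (real \<Rightarrow> complex) \<Rightarrow> real \<Rightarrow> complex" where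
  "pi_sigma \<alpha> x \<omega> f = translation x (modulation \<omega> (dilation (beta \<alpha> \<omega>) f))"

text \<open>\<open>is_A_sigma \<alpha> \<psi> f g\<close> says that \<open>A\<^sub>\<sigma> f = g\<close>, where \<open>A\<^sub>\<sigma>\<close> is given weakly by
  $A_\sigma f = \int\int \langle f, \pi(\sigma(x,\omega))\psi\rangle\,
  \pi(\sigma(x,\omega))\psi\,dx\,d\omega$.
  Integrability is demanded explicitly since the integral of a non-integrable function is 0.\<close>

definition is_A_sigma ::
  "real \<Rightarrow> (real \<Rightarrow> complex) \<Rightarrow> (real \<Rightarrow> complex) \<Rightarrow> (real \<Rightarrow> complex) \<Rightarrow> bool" where
  "is_A_sigma \<alpha> \<psi> f g \<longleftrightarrow> L2 f \<and> L2 g \<and>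
     (\<forall>h. L2 h \<longrightarrow>
        integrable lborel (\<lambda>(x, \<omega>).
          L2_inner f (pi_sigma \<alpha> x \<omega> \<psi>) * L2_inner (pi_sigma \<alpha> x \<omega> \<psi>) h) \<and>
        L2_inner g h = (LINT (x, \<omega>)|lborel.
          L2_inner f (pi_sigma \<alpha> x \<omega> \<psi>) * L2_inner (pi_sigma \<alpha> x \<omega> \<psi>) h))"

text \<open>When \<open>A\<^sub>\<sigma>\<close> is invertible, the chosen preimage is unique up to null sets, so inner products with
  it do not depend on the choice.\<close>

definition A_sigma_inv :: "real \<Rightarrow> (real \<Rightarrow> complex) \<Rightarrow> (real \<Rightarrow> complex) \<Rightarrow> real \<Rightarrow> complex" where
  "A_sigma_inv \<alpha> \<psi> g = (SOME f. is_A_sigma \<alpha> \<psi> f g)"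

definition repr_kernel ::
  "real \<Rightarrow> (real \<Rightarrow> complex) \<Rightarrow> real \<Rightarrow> real \<Rightarrow> real \<Rightarrow> real \<Rightarrow> complex" where
  "repr_kernel \<alpha> \<psi> x \<omega> x' \<omega>' =
     L2_inner (A_sigma_inv \<alpha> \<psi> (pi_sigma \<alpha> x \<omega> \<psi>)) (pi_sigma \<alpha> x' \<omega>' \<psi>)"

definition weight :: "real \<Rightarrow> real \<Rightarrow> real \<Rightarrow> real" where
  "weight s \<omega> \<omega>' = (max ((1 + \<bar>\<omega>'\<bar>) / (1 + \<bar>\<omega>\<bar>)) ((1 + \<bar>\<omega>\<bar>) / (1 + \<bar>\<omega>'\<bar>))) powr \<bar>s\<bar>"

definition p_alpha :: "real \<Rightarrow> real \<Rightarrow> real" where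
  "p_alpha \<alpha> \<omega> = sgn \<omega> * ((1 + (1 - \<alpha>) * \<bar>\<omega>\<bar>) powr (1 / (1 - \<alpha>)) - 1)"

definition omega_j :: "real \<Rightarrow> real \<Rightarrow> int \<Rightarrow> real" where
  "omega_j \<alpha> \<epsilon> j = p_alpha \<alpha> (\<epsilon> * of_int j)"

definition cover_set :: "real \<Rightarrow> real \<Rightarrow> real \<Rightarrow> int \<times> int \<Rightarrow> (real \<times> real) set" where
  "cover_set \<alpha> c \<epsilon> = (\<lambda>(j, k). let \<omega>j = omega_j \<alpha> \<epsilon> j; b = beta \<alpha> \<omega>j in
     {\<epsilon> * b * (of_int k - 1) <..< \<epsilon> * b * (of_int k + 1)} \<times>
     {\<omega>j - 2 * \<epsilon> * c * inverse b <..< \<omega>j + 2 * \<epsilon> * c * inverse b})"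

definition admissible_covering :: "('i::countable \<Rightarrow> (real \<times> real) set) \<Rightarrow> bool" where
  "admissible_covering U \<longleftrightarrow>
     (\<forall>i. compact (closure (U i)) \<and> interior (U i) \<noteq> {}) \<and>
     (\<Union>i. U i) = UNIV \<and>
     (\<exists>N::nat. \<forall>i. finite {i'. U i' \<inter> U i \<noteq> {}} \<and> card {i'. U i' \<inter> U i \<noteq> {}} \<le> N)"

definition Q_set :: "real \<Rightarrow> real \<Rightarrow> real \<Rightarrow> real \<Rightarrow> real \<Rightarrow> (real \<times> real) set" where
  "Q_set \<alpha> c \<epsilon> x \<omega> = \<Union> {cover_set \<alpha> c \<epsilon> i | i. (x, \<omega>) \<in> cover_set \<alpha> c \<epsilon> i}"

text \<open>The oscillation kernel is nonnegative; it is taken in \<open>ennreal\<close> so that the supremum is the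
  true one even before it is known to be finite. For Borel \<open>\<Gamma>\<close> and continuous kernel it is
  universally measurable, so that \<open>\<integral>\<^sup>+\<close> is its usual integral.\<close>

definition osc ::
  "real \<Rightarrow> (real \<Rightarrow> complex) \<Rightarrow> real \<Rightarrow> real \<Rightarrow> ((real \<times> real) \<times> (real \<times> real) \<Rightarrow> complex) \<Rightarrow>
   real \<Rightarrow> real \<Rightarrow> real \<Rightarrow> real \<Rightarrow> ennreal" where
  "osc \<alpha> \<psi> c \<epsilon> \<Gamma> x \<omega> x' \<omega>' =
     (SUP (y, \<eta>) \<in> Q_set \<alpha> c \<epsilon> x' \<omega>'.
        ennreal (cmod (repr_kernel \<alpha> \<psi> x \<omega> x' \<omega>' -
          \<Gamma> ((x', \<omega>'), (y, \<eta>)) * repr_kernel \<alpha> \<psi> x \<omega> y \<eta>)))"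

definition gamma1 ::
  "real \<Rightarrow> real \<Rightarrow> (real \<Rightarrow> complex) \<Rightarrow> real \<Rightarrow> ((real \<times> real) \<times> (real \<times> real) \<Rightarrow> complex) \<Rightarrow>
   real \<Rightarrow> ennreal" where
  "gamma1 \<alpha> s \<psi> c \<Gamma> \<epsilon> =
     (SUP (x', \<omega>') \<in> UNIV. \<integral>\<^sup>+ (x, \<omega>). osc \<alpha> \<psi> c \<epsilon> \<Gamma> x \<omega> x' \<omega>' * ennreal (weight s \<omega> \<omega>') \<partial>lborel)"

definition gamma2 ::
  "real \<Rightarrow> real \<Rightarrow> (real \<Rightarrow> complex) \<Rightarrow> real \<Rightarrow> ((real \<times> real) \<times> (real \<times> real) \<Rightarrow> complex) \<Rightarrow>
   real \<Rightarrow> ennreal" where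
  "gamma2 \<alpha> s \<psi> c \<Gamma> \<epsilon> =
     (SUP (x, \<omega>) \<in> UNIV. \<integral>\<^sup>+ (x', \<omega>'). osc \<alpha> \<psi> c \<epsilon> \<Gamma> x \<omega> x' \<omega>' * ennreal (weight s \<omega> \<omega>') \<partial>lborel)"

end

theory Submission
  imports Defs "HOL-Probability.Probability"
begin

text \<open>On the Fourier side, $\pi(\sigma(x,\omega))\psi$ is
  $e^{-2\pi i x\xi}\beta(\omega)^{1/2}\hat\psi(\beta(\omega)(\xi-\omega))$, and the kernel is the inverse
  Fourier transform, evaluated at $x^\ast-x$, of the product of two such dilated copies of $\hat\psi$
  divided by $m_\psi$. Two integrations by parts give quadratic decay in $x^\ast-x$ at the scale
  $S=(\beta(\omega)\beta(\omega^\ast))^{1/2}$. Every quotient of $1+|\omega|$, $1+|\xi|$ and $1+|\omega^\ast|$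
  is bounded by powers of $1+\beta(\omega)|\xi-\omega|$ and $1+\beta(\omega^\ast)|\xi-\omega^\ast|$, so the
  weight and the mismatch of the scales are absorbed into the decay of $\hat\psi$, and Schur's test applies.

  With $\Gamma=e^{2\pi i(x^\ast-y)\omega^\ast}$ the difference $\mathcal{R}-\Gamma\mathcal{R}$ is a kernel of
  the same form, in which the second copy of $\hat\psi$ is replaced by its difference to a slightly dilated,
  translated and modulated copy. That difference and its first two derivatives are
  $O(\varepsilon)(1+|t|)^{1-r}$; this uses three derivatives of $\hat\psi$ and costs one power of decay.

  The preimage of $\pi(\sigma(x,\omega))\psi$ under $A_\sigma$ is the function with Fourier transform
  $m_\psi^{-1}$ times that of $\pi(\sigma(x,\omega))\psi$. Since its coefficients, the values of the kernel,
  are integrable over the plane, the weak definition of $A_\sigma$ can be verified by Fubini's theorem alone.\<close>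


section \<open>Fourier transforms on the line\<close>

text \<open>Why the phase is there: replacing x' by y multiplies the frequency side by the phase 2
  pi (y - x') \<xi>. Inside one covering set |y - x'| is of order \<epsilon> \<beta>(\<omega>'), so
  the part 2 pi (y - x') (\<xi> - \<omega>') is O(\<epsilon>) times the natural variable t =
  \<beta>(\<omega>') (\<xi> - \<omega>'). The other part, 2 pi (y - x') \<omega>', need not be small
  for large \<omega>'; \<Gamma> removes exactly this part.

  Ledger for the decay r: comparing generators costs 1, comparing scales \<alpha>/(1 - \<alpha>),
  the weight s/(1 - \<alpha>); \<open>q\<close> is left. Schur's test then integrates over \<omega>
  a function whose scale \<beta>(\<omega>) moves with \<omega>. Freezing the scale at \<xi> turns
  \<open>q\<close> into (q - \<alpha>) (1 - \<alpha>), which has to exceed 1.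

  S is the geometric mean because integrating the majorant over x must leave S^2 = \<beta>(\<omega>)
  \<beta>(\<omega>'), one factor for each of the two frequency integrals. The majorant is even in x
  and symmetric in the frequencies, so a single estimate serves both suprema.\<close>

definition fourier :: "(real \<Rightarrow> complex) \<Rightarrow> real \<Rightarrow> complex" where
  "fourier f \<xi> = (LINT x|lborel. cis (- (2 * pi * \<xi> * x)) * f x)"

definition ifourier :: "(real \<Rightarrow> complex) \<Rightarrow> real \<Rightarrow> complex" where
  "ifourier f x = (LINT \<xi>|lborel. cis (2 * pi * x * \<xi>) * f \<xi>)"

lemma cis_measurable [measurable]: "cis \<in> borel_measurable borel"
  by (intro borel_measurable_continuous_onI continuous_intros)

lemma integrable_cis_mult:
  assumes "integrable M f" "h \<in> borel_measurable M"
  shows "integrable M (\<lambda>x. cis (h x) * f x)"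
  by (rule Bochner_Integration.integrable_bound[OF assms(1)])
     (use assms in \<open>auto simp: norm_mult intro!: measurable_compose[OF _ cis_measurable]\<close>)

lemma norm_ifourier_le: "cmod (ifourier f x) \<le> (LINT \<xi>|lborel. cmod (f \<xi>))"
  unfolding ifourier_def using integral_norm_bound[of lborel "\<lambda>\<xi>. cis (2 * pi * x * \<xi>) * f \<xi>"]
  by (simp add: norm_mult)

text \<open>Domination is asked for only in a unit window around \<open>x0\<close>, because for the
  symbol the majorant depends on \<open>x0\<close>. A convergent sequence is shifted by
  \<open>N\<close> until it stays inside the window.\<close>

lemma isCont_parametric_integral:
  fixes f :: "real \<Rightarrow> 'a \<Rightarrow> complex"
  assumes f: "\<And>x. f x \<in> borel_measurable M" and g: "integrable M g"
    and bound: "\<And>x t. \<bar>x - x0\<bar> < 1 \<Longrightarrow> cmod (f x t) \<le> g t" and cont: "\<And>t. isCont (\<lambda>x. f x t) x0"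
  shows "isCont (\<lambda>x. LINT t|M. f x t) x0"
  unfolding continuous_at_sequentially comp_def
proof safe
  fix X :: "nat \<Rightarrow> real" assume X: "X \<longlonglongrightarrow> x0"
  from tendstoD[OF X, of 1] obtain N where N: "\<And>n. n \<ge> N \<Longrightarrow> \<bar>X n - x0\<bar> < 1"
    by (auto simp: eventually_sequentially dist_real_def)
  have "(\<lambda>n. LINT t|M. f (X (n + N)) t) \<longlonglongrightarrow> (LINT t|M. f x0 t)"
  proof (rule integral_dominated_convergence[OF f f g])
    show "AE t in M. (\<lambda>n. f (X (n + N)) t) \<longlonglongrightarrow> f x0 t"
      by (intro AE_I2 LIMSEQ_ignore_initial_segment isCont_tendsto_compose[OF cont X])
    show "AE t in M. norm (f (X (n + N)) t) \<le> g t" for n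
      by (intro AE_I2 bound N) simp
  qed
  then show "(\<lambda>n. LINT t|M. f (X n) t) \<longlonglongrightarrow> (LINT t|M. f x0 t)" by (rule LIMSEQ_offset)
qed

lemma continuous_ifourier:
  assumes "integrable lborel f"
  shows "continuous_on UNIV (ifourier f)"
  unfolding ifourier_def
  by (intro continuous_at_imp_continuous_on ballI isCont_parametric_integral[where g="\<lambda>t. cmod (f t)"])
     (use assms in \<open>auto simp: norm_mult cis_conv_exp intro!: continuous_intros\<close>)

lemma measurable_ifourier:
  assumes "integrable lborel f"
  shows "ifourier f \<in> borel_measurable borel"
  using continuous_ifourier[OF assms] by (rule borel_measurable_continuous_onI)

text \<open>The factor pi makes \<open>gauss 1\<close> its own Fourier transform, with integral 1.
  The parameter is an inverse width: small \<epsilon> gives a flat cut-off whose transform is a peak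
  of width \<epsilon>.\<close>

definition gauss :: "real \<Rightarrow> real \<Rightarrow> real" where
  "gauss \<epsilon> x = exp (- pi * (\<epsilon> * x)\<^sup>2)"

lemma gauss_measurable [measurable]: "gauss \<epsilon> \<in> borel_measurable borel"
  unfolding gauss_def[abs_def] by measurable

lemma gauss_pos: "gauss \<epsilon> x > 0" and gauss_le_1: "gauss \<epsilon> x \<le> 1"
  by (auto simp: gauss_def)

text \<open>The dummy summand \<open>0 +\<close> puts the argument into the affine shape
  \<open>t + c * x\<close> of the substitution rules for \<open>lborel\<close>.\<close>

lemma gauss_eq_normal:
  assumes "\<epsilon> > 0"
  shows "gauss \<epsilon> x = std_normal_density (0 + sqrt (2*pi) * \<epsilon> * x) * sqrt (2 * pi)"
  unfolding std_normal_density_def gauss_def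
  by (simp add: power_mult_distrib mult_ac)

lemma integrable_gauss:
  assumes "\<epsilon> > 0" shows "integrable lborel (gauss \<epsilon>)"
proof -
  have "integrable lborel (\<lambda>x. std_normal_density (0 + sqrt (2*pi) * \<epsilon> * x) * sqrt (2 * pi))"
    by (intro integrable_mult_left lborel_integrable_real_affine) (use assms in auto)
  then show ?thesis using assms by (simp only: gauss_eq_normal[OF assms, abs_def])
qed

text \<open>This is the characteristic function of the standard normal distribution after the
  substitution x -> sqrt (2 pi) \<epsilon> x.\<close>

lemma fourier_gauss:
  assumes "\<epsilon> > 0"
  shows "(LINT x|lborel. cis (2 * pi * x * \<xi>) * of_real (gauss \<epsilon> x)) = of_real (gauss (1/\<epsilon>) \<xi> / \<epsilon>)"
proof -
  define c where "c = sqrt (2*pi) * \<epsilon>"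
  define t where "t = sqrt (2*pi) * \<xi> / \<epsilon>"
  have c: "c > 0" using assms by (simp add: c_def)
  have "of_real (exp (- (t^2) / 2)) = char std_normal_distribution t"
    by (simp add: char_std_normal_distribution)
  also have "\<dots> = (LINT x|lborel. std_normal_density x *\<^sub>R iexp (t * x))"
    unfolding char_def by (subst integral_density) (auto simp: normal_density_nonneg)
  also have "\<dots> = c *\<^sub>R (LINT x|lborel. std_normal_density (0 + c * x) *\<^sub>R iexp (t * (0 + c * x)))"
    using c by (subst lborel_integral_real_affine[of c _ 0]) auto
  also have "(LINT x|lborel. std_normal_density (0 + c * x) *\<^sub>R iexp (t * (0 + c * x))) =
     (LINT x|lborel. (1 / sqrt (2*pi)) *\<^sub>R (cis (2 * pi * x * \<xi>) * of_real (gauss \<epsilon> x)))"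
  proof (rule Bochner_Integration.integral_cong[OF refl])
    fix x
    have "t * c = 2 * pi * \<xi>" using assms by (simp add: t_def c_def)
    then have 1: "t * (c * x) = 2 * pi * x * \<xi>" by (simp only: mult.assoc[symmetric]) simp
    have 2: "gauss \<epsilon> x = std_normal_density (0 + c * x) * sqrt (2 * pi)"
      using gauss_eq_normal[OF assms] by (simp add: c_def)
    show "std_normal_density (0 + c * x) *\<^sub>R iexp (t * (0 + c * x)) = (1 / sqrt (2*pi)) *\<^sub>R (cis (2 * pi * x * \<xi>) * of_real (gauss \<epsilon> x))"
      unfolding 2 by (simp only: add_0 1) (simp add: cis_conv_exp scaleR_conv_of_real mult_ac)
  qed
  also have "\<dots> = (1 / sqrt (2*pi)) *\<^sub>R (LINT x|lborel. cis (2 * pi * x * \<xi>) * of_real (gauss \<epsilon> x))"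
    by (rule integral_scaleR_right)
  finally have "of_real (exp (- (t^2) / 2)) = \<epsilon> *\<^sub>R (LINT x|lborel. cis (2 * pi * x * \<xi>) * of_real (gauss \<epsilon> x))"
    by (simp add: c_def)
  moreover have "exp (- (t^2) / 2) = gauss (1/\<epsilon>) \<xi>"
    by (simp add: gauss_def t_def power_mult_distrib power_divide)
  ultimately show ?thesis using assms by (simp add: scaleR_conv_of_real field_simps)
qed

lemma integral_gauss: "(LINT x|lborel. gauss 1 x) = 1"
proof -
  have "of_real (LINT x|lborel. gauss 1 x) = (1 :: complex)"
    using fourier_gauss[of 1 0] unfolding integral_complex_of_real[symmetric] by (simp add: gauss_def)
  then show ?thesis by (metis of_real_eq_1_iff)
qed

text \<open>The mean is written with a fixed Gaussian and a shrinking displacement, so that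
  dominated convergence applies with the majorant \<open>B * gauss 1\<close>.\<close>

lemma gauss_approx_identity:
  fixes f :: "real \<Rightarrow> complex"
  assumes "continuous_on UNIV f" "\<And>x. cmod (f x) \<le> B"
  shows "(\<lambda>n. LINT z|lborel. f (\<xi> + z / real (Suc n)) * of_real (gauss 1 z)) \<longlonglongrightarrow> f \<xi>"
proof -
  have [measurable]: "f \<in> borel_measurable borel" using assms(1) by (rule borel_measurable_continuous_onI)
  have "(\<lambda>n. LINT z|lborel. f (\<xi> + z / real (Suc n)) * of_real (gauss 1 z)) \<longlonglongrightarrow> (LINT z|lborel. f \<xi> * of_real (gauss 1 z))"
  proof (rule integral_dominated_convergence[where w="\<lambda>z. B * gauss 1 z"])
    show "integrable lborel (\<lambda>z. B * gauss 1 z)" using integrable_gauss[of 1] by simp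
    show "AE z in lborel. (\<lambda>n. f (\<xi> + z / real (Suc n)) * of_real (gauss 1 z)) \<longlonglongrightarrow> f \<xi> * of_real (gauss 1 z)"
    proof (intro AE_I2 tendsto_mult tendsto_const)
      fix z :: real
      have "(\<lambda>n. \<xi> + z / real (Suc n)) \<longlonglongrightarrow> \<xi> + 0"
        by (intro tendsto_add tendsto_const real_tendsto_divide_at_top[OF tendsto_const]
            filterlim_compose[OF filterlim_real_sequentially filterlim_Suc])
      then show "(\<lambda>n. f (\<xi> + z / real (Suc n))) \<longlonglongrightarrow> f \<xi>"
        by (intro continuous_on_tendsto_compose[OF assms(1)]) auto
    qed
    show "AE z in lborel. norm (f (\<xi> + z / real (Suc n)) * of_real (gauss 1 z)) \<le> B * gauss 1 z" for n
      using assms(2) gauss_pos by (intro AE_I2) (auto simp: norm_mult abs_of_pos intro!: mult_right_mono less_imp_le)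
  qed auto
  also have "(LINT z|lborel. f \<xi> * of_real (gauss 1 z)) = f \<xi> * of_real (LINT z|lborel. gauss 1 z)"
    by simp
  finally show ?thesis by (simp add: integral_gauss)
qed

section \<open>The multiplication formula and pointwise Fourier inversion\<close>

lemma integrable_pair_mult:
  fixes f g :: "real \<Rightarrow> complex"
  assumes "integrable lborel f" "integrable lborel g"
  shows "integrable (lborel \<Otimes>\<^sub>M lborel) (\<lambda>(x, y). f x * g y)"
proof -
  have [measurable]: "f \<in> borel_measurable borel" "g \<in> borel_measurable borel"
    using assms[THEN borel_measurable_integrable] by auto
  show ?thesis
    by (rule lborel_pair.Fubini_integrable) (use assms in \<open>auto simp: norm_mult\<close>)
qed

text \<open>Fubini for the kernel cis (2 pi x \<eta>). Inversion, the values of the reproducing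
  kernel and the convolution identity all reduce to this multiplication formula.\<close>

lemma ifourier_swap:
  fixes f :: "real \<Rightarrow> complex"
  assumes f: "integrable lborel f" and h: "integrable lborel h"
  shows "(LINT x|lborel. ifourier f x * h x) = (LINT \<eta>|lborel. f \<eta> * ifourier h \<eta>)"
proof -
  have [measurable]: "f \<in> borel_measurable borel" "h \<in> borel_measurable borel"
    using assms[THEN borel_measurable_integrable] by auto
  have int: "integrable (lborel \<Otimes>\<^sub>M lborel) (\<lambda>(x, \<eta>). cis (2 * pi * x * \<eta>) * (f \<eta> * h x))"
    unfolding split_beta
    by (rule integrable_cis_mult) (use integrable_pair_mult[OF h f] in \<open>auto simp: case_prod_unfold mult.commute\<close>)
  have "(LINT x|lborel. ifourier f x * h x) = (LINT x|lborel. LINT \<eta>|lborel. cis (2 * pi * x * \<eta>) * (f \<eta> * h x))"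
    unfolding ifourier_def by (simp add: mult.assoc[symmetric])
  also have "\<dots> = (LINT \<eta>|lborel. LINT x|lborel. cis (2 * pi * x * \<eta>) * (f \<eta> * h x))"
    by (rule lborel_pair.Fubini_integral[symmetric]) (use int in \<open>simp add: split_beta\<close>)
  also have "\<dots> = (LINT \<eta>|lborel. LINT x|lborel. f \<eta> * (cis (2 * pi * x * \<eta>) * h x))"
    by (simp add: mult_ac)
  finally show ?thesis by (simp add: ifourier_def mult_ac)
qed

lemma ifourier_eq_fourier: "ifourier f x = fourier f (- x)"
  by (simp add: ifourier_def fourier_def)

lemma ifourier_reflect: "ifourier f (- x) = ifourier (\<lambda>\<xi>. f (- \<xi>)) x"
  unfolding ifourier_def by (subst lborel_integral_real_affine[of "-1" _ 0]) auto

lemma fourier_swap: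
  assumes "integrable lborel f" "integrable lborel h"
  shows "(LINT x|lborel. fourier f x * h x) = (LINT \<eta>|lborel. f \<eta> * fourier h \<eta>)"
proof -
  have f: "integrable lborel (\<lambda>x. f (- x))"
    using lborel_integrable_real_affine[OF assms(1), of "-1" 0] by simp
  have "(LINT x|lborel. fourier f x * h x) = (LINT x|lborel. ifourier (\<lambda>x. f (- x)) x * h x)"
    using ifourier_eq_fourier[of f "- x" for x] by (simp add: ifourier_reflect[symmetric])
  also have "\<dots> = (LINT \<eta>|lborel. f (- \<eta>) * ifourier h \<eta>)" by (rule ifourier_swap[OF f assms(2)])
  also have "\<dots> = (LINT \<eta>|lborel. f \<eta> * fourier h \<eta>)"
    by (subst lborel_integral_real_affine[of "-1" _ 0]) (auto simp: ifourier_eq_fourier)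
  finally show ?thesis .
qed

lemma fourier_shifted_gauss:
  assumes "\<epsilon> > 0"
  shows "fourier (\<lambda>x. of_real (gauss \<epsilon> (x - a))) \<xi> = cis (- (2 * pi * \<xi> * a)) * of_real (gauss (1/\<epsilon>) \<xi> / \<epsilon>)"
proof -
  have "fourier (\<lambda>x. of_real (gauss \<epsilon> (x - a))) \<xi> = (LINT x|lborel. cis (- (2 * pi * \<xi> * (a + 1 * x))) * of_real (gauss \<epsilon> (a + 1 * x - a)))"
    unfolding fourier_def by (subst lborel_integral_real_affine[of 1 _ a]) auto
  also have "\<dots> = (LINT x|lborel. cis (- (2 * pi * \<xi> * a)) * (cis (2 * pi * x * (-\<xi>)) * of_real (gauss \<epsilon> x)))"
    by (intro Bochner_Integration.integral_cong refl)
       (simp add: mult.assoc[symmetric] cis_mult, simp add: algebra_simps minus_diff_commute)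
  also have "\<dots> = cis (- (2 * pi * \<xi> * a)) * (LINT x|lborel. (cis (2 * pi * x * (-\<xi>)) * of_real (gauss \<epsilon> x)))"
    by (rule integral_mult_right_zero)
  finally show ?thesis unfolding fourier_gauss[OF assms] by (simp add: gauss_def)
qed

lemma gauss_tendsto_1: "(\<lambda>n. gauss (1 / real (Suc n)) x) \<longlonglongrightarrow> 1"
proof -
  have "(\<lambda>n. 1 / real (Suc n)) \<longlonglongrightarrow> 0"
    by (intro real_tendsto_divide_at_top[OF tendsto_const]
            filterlim_compose[OF filterlim_real_sequentially filterlim_Suc])
  then have "(\<lambda>n. exp (- pi * (1 / real (Suc n) * x)\<^sup>2)) \<longlonglongrightarrow> exp (- pi * (0 * x)\<^sup>2)"
    by (intro tendsto_intros)
  then show ?thesis by (simp add: gauss_def)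
qed

text \<open>Paired with a modulated Gaussian cut-off, \<open>ifourier f\<close> can be evaluated in
  two ways: the multiplication formula turns the integral into a Gaussian mean of \<open>f\<close>
  around \<xi>, which tends to \<open>f \<xi>\<close>; removing the cut-off under the integral gives
  \<open>fourier (ifourier f) \<xi>\<close>.\<close>

theorem fourier_inversion:
  assumes "continuous_on UNIV f" "\<And>x. cmod (f x) \<le> B" "integrable lborel f" "integrable lborel (ifourier f)"
  shows "fourier (ifourier f) \<xi> = f \<xi>"
proof -
  have [measurable]: "f \<in> borel_measurable borel" "ifourier f \<in> borel_measurable borel"
    using assms(3,4)[THEN borel_measurable_integrable] by auto
  let ?h = "\<lambda>n x. cis (- (2 * pi * \<xi> * x)) * of_real (gauss (1 / real (Suc n)) x)"
  have h: "integrable lborel (?h n)" for n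
    by (rule integrable_cis_mult) (use integrable_gauss[of "1 / real (Suc n)"] in auto)
  have ih: "ifourier (?h n) \<eta> = of_real (gauss (real (Suc n)) (\<eta> - \<xi>) * real (Suc n))" for n \<eta>
  proof -
    have "ifourier (?h n) \<eta> = (LINT x|lborel. cis (2 * pi * x * (\<eta> - \<xi>)) * of_real (gauss (1 / real (Suc n)) x))"
      unfolding ifourier_def
      by (intro Bochner_Integration.integral_cong refl)
         (simp add: mult.assoc[symmetric] cis_mult, simp add: algebra_simps)
    then show ?thesis by (simp add: fourier_gauss)
  qed
  have "(LINT x|lborel. ifourier f x * ?h n x) = (LINT z|lborel. f (\<xi> + z / real (Suc n)) * of_real (gauss 1 z))" for n
  proof -
    have "(LINT x|lborel. ifourier f x * ?h n x) = (LINT \<eta>|lborel. f \<eta> * of_real (gauss (real (Suc n)) (\<eta> - \<xi>) * real (Suc n)))"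
      using ifourier_swap[OF assms(3) h] by (simp only: ih)
    also have "\<dots> = \<bar>1 / real (Suc n)\<bar> *\<^sub>R (LINT z|lborel. f (\<xi> + 1 / real (Suc n) * z) * of_real (gauss (real (Suc n)) (\<xi> + 1 / real (Suc n) * z - \<xi>) * real (Suc n)))"
      by (rule lborel_integral_real_affine) simp
    also have "\<dots> = (LINT z|lborel. f (\<xi> + z / real (Suc n)) * of_real (gauss 1 z))"
      unfolding integral_scaleR_right[symmetric]
      by (intro Bochner_Integration.integral_cong refl)
         (simp add: gauss_def scaleR_conv_of_real del: of_nat_Suc)
    finally show ?thesis .
  qed
  then have 1: "(\<lambda>n. LINT x|lborel. ifourier f x * ?h n x) \<longlonglongrightarrow> f \<xi>"
    using gauss_approx_identity[OF assms(1,2)] by simp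
  have 2: "(\<lambda>n. LINT x|lborel. ifourier f x * ?h n x) \<longlonglongrightarrow> fourier (ifourier f) \<xi>"
    unfolding fourier_def
  proof (rule integral_dominated_convergence[where w="\<lambda>x. cmod (ifourier f x)"])
    show "AE x in lborel. (\<lambda>n. ifourier f x * ?h n x) \<longlonglongrightarrow> cis (- (2 * pi * \<xi> * x)) * ifourier f x"
    proof (rule AE_I2)
      fix x
      have "(\<lambda>n. ifourier f x * ?h n x) \<longlonglongrightarrow> ifourier f x * (cis (- (2 * pi * \<xi> * x)) * of_real 1)"
        by (intro tendsto_intros gauss_tendsto_1)
      then show "(\<lambda>n. ifourier f x * ?h n x) \<longlonglongrightarrow> cis (- (2 * pi * \<xi> * x)) * ifourier f x"
        by (simp add: mult.commute)
    qed
    show "AE x in lborel. norm (ifourier f x * ?h n x) \<le> cmod (ifourier f x)" for n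
      using gauss_le_1 gauss_pos by (intro AE_I2) (auto simp: norm_mult abs_of_pos intro!: mult_left_le)
  qed (use assms in auto)
  show ?thesis by (rule LIMSEQ_unique[OF 2 1])
qed

section \<open>Uniqueness and inversion for square-integrable functions\<close>

lemma L2_mult_integrable:
  assumes "L2 f" "L2 g"
  shows "integrable lborel (\<lambda>x. f x * g x)"
proof -
  have [measurable]: "f \<in> borel_measurable lborel" "g \<in> borel_measurable lborel" using assms by (auto simp: L2_def)
  show ?thesis
  proof (rule Bochner_Integration.integrable_bound)
    show "integrable lborel (\<lambda>x. (cmod (f x))\<^sup>2 + (cmod (g x))\<^sup>2)"
      using assms by (auto simp: L2_def)
    show "AE x in lborel. norm (f x * g x) \<le> norm ((cmod (f x))\<^sup>2 + (cmod (g x))\<^sup>2)"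
    proof (rule AE_I2)
      fix x
      have "cmod (f x) * cmod (g x) \<le> (cmod (f x))\<^sup>2 + (cmod (g x))\<^sup>2"
        using sum_squares_bound[of "cmod (f x)" "cmod (g x)"] mult_nonneg_nonneg[OF norm_ge_zero norm_ge_zero, of "f x" "g x"] by (simp only: mult.assoc)
      then show "norm (f x * g x) \<le> norm ((cmod (f x))\<^sup>2 + (cmod (g x))\<^sup>2)" by (simp add: norm_mult)
    qed
  qed auto
qed

lemma L2_of_bounded_integrable:
  assumes "integrable lborel f" "\<And>x. cmod (f x) \<le> B"
  shows "L2 f"
proof -
  have [measurable]: "f \<in> borel_measurable borel" using assms(1)[THEN borel_measurable_integrable] by simp
  have "integrable lborel (\<lambda>x. B * cmod (f x))" using assms by auto
  then have "integrable lborel (\<lambda>t. (cmod (f t))\<^sup>2)"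
  proof (rule Bochner_Integration.integrable_bound)
    have "cmod (f x) * cmod (f x) \<le> B * cmod (f x)" for x
      using assms(2) by (intro mult_right_mono) auto
    then show "AE x in lborel. norm ((cmod (f x))\<^sup>2) \<le> norm (B * cmod (f x))"
      by (intro AE_I2) (auto simp: power2_eq_square intro: order_trans[OF _ abs_ge_self])
  qed auto
  then show ?thesis by (simp add: L2_def)
qed

lemma L2_diff:
  assumes "L2 f" "L2 g"
  shows "L2 (\<lambda>x. f x - g x)"
proof -
  have [measurable]: "f \<in> borel_measurable lborel" "g \<in> borel_measurable lborel" using assms by (auto simp: L2_def)
  have "integrable lborel (\<lambda>x. 2 * (cmod (f x))\<^sup>2 + 2 * (cmod (g x))\<^sup>2)"
    using assms by (auto simp: L2_def)
  then have "integrable lborel (\<lambda>x. (cmod (f x - g x))\<^sup>2)"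
  proof (rule Bochner_Integration.integrable_bound)
    show "AE x in lborel. norm ((cmod (f x - g x))\<^sup>2) \<le> norm (2 * (cmod (f x))\<^sup>2 + 2 * (cmod (g x))\<^sup>2)"
    proof (rule AE_I2)
      fix x
      have "(cmod (f x - g x))\<^sup>2 \<le> (cmod (f x) + cmod (g x))\<^sup>2"
        by (intro power_mono norm_triangle_ineq4) auto
      also have "\<dots> \<le> 2 * (cmod (f x))\<^sup>2 + 2 * (cmod (g x))\<^sup>2"
        using sum_squares_bound[of "cmod (f x)" "cmod (g x)"] by (simp add: power2_sum)
      finally show "norm ((cmod (f x - g x))\<^sup>2) \<le> norm (2 * (cmod (f x))\<^sup>2 + 2 * (cmod (g x))\<^sup>2)"
        by simp
    qed
  qed auto
  then show ?thesis by (simp add: L2_def)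
qed

text \<open>A translated Gaussian is itself a Fourier transform, so \<open>e\<close> annihilates it
  by the multiplication formula. By Fubini \<open>e\<close> annihilates the Gaussian means
  \<open>hn\<close> of \<open>h\<close>, and these converge boundedly to \<open>h\<close>.\<close>

lemma integral_continuous_zero:
  fixes e :: "real \<Rightarrow> complex"
  assumes e: "integrable lborel e" and z: "\<And>\<xi>. fourier e \<xi> = 0"
    and h: "continuous_on UNIV h" "\<And>x. cmod (h x) \<le> B"
  shows "(LINT x|lborel. e x * h x) = 0"
proof -
  have [measurable]: "e \<in> borel_measurable borel" using e[THEN borel_measurable_integrable] by simp
  have [measurable]: "h \<in> borel_measurable borel" using h(1) by (rule borel_measurable_continuous_onI)
  have B: "B \<ge> 0" using h(2)[of 0] norm_ge_zero order_trans by blast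
  define hn where "hn n x = (LINT z|lborel. h (x + z / real (Suc n)) * of_real (gauss 1 z))" for n x
  \<comment> \<open>The same mean in convolution form: this form is for Fubini, the one in the
    definition is for the bound and the limit.\<close>
  have hn_eq: "hn n x = (LINT y|lborel. h y * of_real (real (Suc n) * gauss (real (Suc n)) (x - y)))" for n x
  proof -
    have "(LINT y|lborel. h y * of_real (real (Suc n) * gauss (real (Suc n)) (x - y))) = 
      \<bar>1 / real (Suc n)\<bar> *\<^sub>R (LINT z|lborel. h (x + 1 / real (Suc n) * z) * of_real (real (Suc n) * gauss (real (Suc n)) (x - (x + 1 / real (Suc n) * z))))"
      by (rule lborel_integral_real_affine) simp
    also have "\<dots> = hn n x"
      unfolding integral_scaleR_right[symmetric] hn_def
      by (intro Bochner_Integration.integral_cong refl)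
         (simp add: gauss_def scaleR_conv_of_real del: of_nat_Suc)
    finally show ?thesis by simp
  qed
  have zero: "(LINT x|lborel. e x * hn n x) = 0" for n
  proof -
    define N where "N = real (Suc n)"
    have N: "N > 0" by (simp add: N_def)
    have g: "integrable lborel (\<lambda>y. gauss N (x - y))" for x
      using lborel_integrable_real_affine[OF integrable_gauss[OF N], of "-1" x] by simp
    have gi: "(LINT y|lborel. gauss N (x - y)) = (LINT y|lborel. gauss N y)" for x
      by (subst lborel_integral_real_affine[of "-1" _ x]) auto
    let ?F = "\<lambda>x y. e x * (h y * of_real (N * gauss N (x - y)))"
    have int: "integrable (lborel \<Otimes>\<^sub>M lborel) (\<lambda>(x, y). ?F x y)"
    proof (rule Bochner_Integration.integrable_bound)
      show "integrable (lborel \<Otimes>\<^sub>M lborel) (\<lambda>(x, y). B * N * (cmod (e x) * gauss N (x - y)))"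
      proof (rule lborel_pair.Fubini_integrable)
        show "integrable lborel (\<lambda>x. LINT y|lborel. norm (case (x, y) of (x, y) \<Rightarrow> B * N * (cmod (e x) * gauss N (x - y))))"
          using e B N gauss_pos[of N] by (simp add: abs_mult abs_of_pos gi)
      qed (use g in auto)
      show "AE p in lborel \<Otimes>\<^sub>M lborel. norm (case p of (x, y) \<Rightarrow> ?F x y) \<le> norm (case p of (x, y) \<Rightarrow> B * N * (cmod (e x) * gauss N (x - y)))"
      proof (rule AE_I2, clarify)
        fix x y
        have "cmod (h y) * (cmod (e x) * N * gauss N (x - y)) \<le> B * (cmod (e x) * N * gauss N (x - y))"
          using h(2) N gauss_pos[of N "x - y"] by (intro mult_right_mono) auto
        then show "norm (?F x y) \<le> norm (B * N * (cmod (e x) * gauss N (x - y)))"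
          using N B gauss_pos[of N "x - y"] by (simp add: norm_mult abs_mult abs_of_pos mult_ac)
      qed
    qed auto
    have inner0: "(LINT x|lborel. e x * of_real (N * gauss N (x - y))) = 0" for y
    proof -
      have 1: "of_real (N * gauss N (x - y)) = cis 0 * fourier (\<lambda>\<xi>. of_real (gauss (1/N) (\<xi> - 0)) * cis (2 * pi * y * \<xi>)) x" for x
      proof -
        have "fourier (\<lambda>\<xi>. of_real (gauss (1/N) (\<xi> - 0)) * cis (2 * pi * y * \<xi>)) x = fourier (\<lambda>\<xi>. of_real (gauss (1/N) (\<xi> - 0))) (x - y)"
          unfolding fourier_def
          by (intro Bochner_Integration.integral_cong refl)
             (simp add: mult_ac, simp add: mult.assoc[symmetric] cis_mult, simp add: algebra_simps)
        also have "\<dots> = of_real (N * gauss N (x - y))"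
          using N by (subst fourier_shifted_gauss) auto
        finally show ?thesis by simp
      qed
      have i: "integrable lborel (\<lambda>\<xi>. of_real (gauss (1/N) (\<xi> - 0)) * cis (2 * pi * y * \<xi>))"
        using integrable_cis_mult[of lborel "\<lambda>\<xi>. of_real (gauss (1/N) \<xi>)" "\<lambda>\<xi>. 2 * pi * y * \<xi>"] integrable_gauss[of "1/N"] N
        by (simp add: mult.commute)
      show ?thesis
        unfolding 1 using fourier_swap[OF i e] by (simp add: z mult.commute)
    qed
    have "(LINT x|lborel. e x * hn n x) = (LINT x|lborel. LINT y|lborel. ?F x y)"
      by (simp add: hn_eq N_def)
    also have "\<dots> = (LINT y|lborel. LINT x|lborel. ?F x y)"
      by (rule lborel_pair.Fubini_integral[symmetric, OF int])
    also have "\<dots> = (LINT y|lborel. h y * (LINT x|lborel. e x * of_real (N * gauss N (x - y))))"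
      unfolding integral_mult_right_zero[symmetric] by (simp only: mult.left_commute)
    finally show ?thesis by (simp only: inner0) simp
  qed
  have hn_meas[measurable]: "hn n \<in> borel_measurable borel" for n
    unfolding hn_def by measurable
  have hn_le: "cmod (hn n x) \<le> B" for n x
  proof -
    have "cmod (hn n x) \<le> (LINT z|lborel. B * gauss 1 z)"
      unfolding hn_def
    proof (rule order_trans[OF integral_norm_bound], rule integral_mono)
      show i: "integrable lborel (\<lambda>z. B * gauss 1 z)" using integrable_gauss[of 1] by simp
      show le: "cmod (h (x + z / real (Suc n)) * of_real (gauss 1 z)) \<le> B * gauss 1 z" for z
        using h(2) gauss_pos[of 1 z] by (auto simp: norm_mult abs_of_pos intro!: mult_right_mono)
      show "integrable lborel (\<lambda>z. cmod (h (x + z / real (Suc n)) * of_real (gauss 1 z)))"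
        by (rule Bochner_Integration.integrable_bound[OF i])
           (use le in \<open>auto intro!: AE_I2 intro: order_trans[OF _ abs_ge_self] simp del: of_nat_Suc\<close>)
    qed
    then show ?thesis by (simp add: integral_gauss)
  qed
  have "(\<lambda>n. LINT x|lborel. e x * hn n x) \<longlonglongrightarrow> (LINT x|lborel. e x * h x)"
  proof (rule integral_dominated_convergence[where w="\<lambda>x. B * cmod (e x)"])
    show "AE x in lborel. (\<lambda>n. e x * hn n x) \<longlonglongrightarrow> e x * h x"
      unfolding hn_def by (intro AE_I2 tendsto_intros gauss_approx_identity[OF h])
    show "AE x in lborel. norm (e x * hn n x) \<le> B * cmod (e x)" for n
      using hn_le by (intro AE_I2) (simp add: norm_mult mult.commute[of "cmod (e x)" for x] mult_right_mono)
  qed (use e in auto)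
  then show ?thesis by (simp add: zero LIMSEQ_const_iff)
qed

text \<open>Vanishing against bounded continuous functions passes to closed sets through cut-offs of
  the distance function, and from closed sets, an intersection-stable generator, to all Borel sets.
  A function all of whose set integrals vanish is null.\<close>

lemma fourier_zero_imp_AE_zero:
  fixes e :: "real \<Rightarrow> complex"
  assumes e: "integrable lborel e" and z: "\<And>\<xi>. fourier e \<xi> = 0"
  shows "AE x in lborel. e x = 0"
proof (rule sigma_finite_measure.density_zero[OF sigma_finite_lborel e])
  have [measurable]: "e \<in> borel_measurable borel" using e[THEN borel_measurable_integrable] by simp
  have int: "set_integrable lborel A e" if "A \<in> sets borel" for A
    unfolding set_integrable_def by (rule integrable_mult_indicator) (use that e in auto)
  have closed: "set_lebesgue_integral lborel A e = 0" if A: "closed A" for A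
  proof (cases "A = {}")
    case False
    let ?h = "\<lambda>n x. complex_of_real (max 0 (1 - real n * infdist x A))"
    have "(LINT x|lborel. e x * ?h n x) = 0" for n
    proof (rule integral_continuous_zero[OF e z, where B=1])
      show "continuous_on UNIV (?h n)" by (intro continuous_intros)
    qed (auto simp: infdist_nonneg max_def)
    moreover have "(\<lambda>n. LINT x|lborel. e x * ?h n x) \<longlonglongrightarrow> (LINT x|lborel. indicator A x *\<^sub>R e x)"
    proof (rule integral_dominated_convergence[where w="\<lambda>x. cmod (e x)"])
      show "AE x in lborel. (\<lambda>n. e x * ?h n x) \<longlonglongrightarrow> indicator A x *\<^sub>R e x"
      proof (rule AE_I2)
        fix x :: real
        show "(\<lambda>n. e x * ?h n x) \<longlonglongrightarrow> indicator A x *\<^sub>R e x"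
        proof (cases "x \<in> A")
          case True
          then show ?thesis by simp
        next
          case x: False
          then have pos: "infdist x A > 0"
            using A False by (metis in_closed_iff_infdist_zero infdist_nonneg less_eq_real_def)
          obtain N where N: "1 / infdist x A \<le> real N" using real_arch_simple by blast
          have "e x * ?h n x = 0" if "n \<ge> N" for n
          proof -
            have "1 / infdist x A \<le> real n" using N that by simp
            then have "1 \<le> real n * infdist x A" using pos by (simp add: field_simps)
            then show ?thesis by simp
          qed
          then have "eventually (\<lambda>n. e x * ?h n x = indicator A x *\<^sub>R e x) sequentially"
            using x by (auto simp: eventually_sequentially)
          then show ?thesis by (rule tendsto_eventually)
        qed
      qed
      show "AE x in lborel. norm (e x * ?h n x) \<le> cmod (e x)" for n
        by (intro AE_I2) (auto simp: norm_mult infdist_nonneg max_def intro!: mult_left_le)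
      have "?h n \<in> borel_measurable borel" for n
        by (intro borel_measurable_continuous_onI continuous_intros)
      then show "(\<lambda>x. e x * ?h n x) \<in> borel_measurable lborel" for n by simp
      show "(\<lambda>x. indicator A x *\<^sub>R e x) \<in> borel_measurable lborel"
        using A by (auto intro!: borel_measurable_scaleR borel_measurable_indicator)
    qed (use e in auto)
    ultimately show ?thesis by (simp add: set_lebesgue_integral_def LIMSEQ_const_iff)
  qed (simp add: set_lebesgue_integral_def)
  fix A :: "real set" assume "A \<in> sets lborel"
  then have "Int_stable (Collect closed :: real set set)" "Collect closed \<subseteq> Pow (UNIV :: real set)"
    "A \<in> sigma_sets UNIV (Collect closed)"
    by (auto simp: Int_stable_def borel_eq_closed)
  then show "set_lebesgue_integral lborel A e = 0"
  proof (induct A rule: sigma_sets_induct_disjoint)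
    case (compl B)
    then have [measurable]: "B \<in> sets borel" by (simp add: borel_eq_closed)
    have "set_lebesgue_integral lborel (B \<union> (UNIV - B)) e = set_lebesgue_integral lborel B e + set_lebesgue_integral lborel (UNIV - B) e"
      by (rule set_integral_Un) (auto intro!: int)
    moreover have "B \<union> (UNIV - B) = UNIV" by auto
    ultimately show ?case using compl closed[of UNIV] by simp
  next
    case (union F)
    then have [measurable]: "F i \<in> sets borel" for i by (auto simp: borel_eq_closed)
    have "set_lebesgue_integral lborel (\<Union>i. F i) e = (\<Sum>i. set_lebesgue_integral lborel (F i) e)"
      by (rule lebesgue_integral_countable_add) (use union in \<open>auto simp: disjoint_family_on_def intro!: int\<close>)
    with union show ?case by simp
  qed (use closed in \<open>auto simp: set_lebesgue_integral_def\<close>)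
qed

text \<open>Since \<open>\<psi>\<close> is only known to be in L2, its difference to
  \<open>ifourier F\<close> is multiplied by \<open>gauss 1\<close> before the uniqueness result for
  integrable functions is applied. The transform of that product at \<xi> is a difference of two
  pairings with \<open>fourier (?G \<xi>)\<close>; facts \<open>A\<close> and \<open>B\<close>
  identify both with the integral of \<open>?G \<xi>\<close> times \<open>F\<close>.\<close>

lemma fourier_transform_inversion_AE:
  assumes L: "L2 \<psi>" and F: "is_fourier_transform \<psi> F" and Fi: "integrable lborel F"
    and L1: "L2 (ifourier F)"
  shows "AE t in lborel. \<psi> t = ifourier F t"
proof -
  let ?g = "\<lambda>x. complex_of_real (gauss 1 x)"
  have gi: "integrable lborel ?g" using integrable_gauss[of 1] by simp
  have gL: "L2 ?g" by (rule L2_of_bounded_integrable[OF gi, of 1]) (use gauss_le_1 gauss_pos in \<open>auto simp: abs_of_pos\<close>)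
  have LF: "L2 F" using F by (simp add: is_fourier_transform_def)
  have meas[measurable]: "\<psi> \<in> borel_measurable borel" "F \<in> borel_measurable borel"
    using L LF by (auto simp: L2_def)
  let ?G = "\<lambda>\<xi> \<eta>. complex_of_real (gauss 1 (\<eta> - \<xi>))"
  have Gi: "integrable lborel (?G \<xi>)" for \<xi>
    using lborel_integrable_real_affine[OF gi, of 1 "-\<xi>"] by simp
  have GL: "L2 (?G \<xi>)" for \<xi>
    by (rule L2_of_bounded_integrable[OF Gi, of _ 1]) (use gauss_le_1 gauss_pos in \<open>auto simp: abs_of_pos\<close>)
  have fG: "fourier (?G \<xi>) x = cis (- (2 * pi * x * \<xi>)) * ?g x" for \<xi> x
    using fourier_shifted_gauss[of 1 \<xi> x] by simp
  have h: "integrable lborel (fourier (?G \<xi>))" for \<xi>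
    unfolding fG[abs_def] by (rule integrable_cis_mult[OF gi]) auto
  have hL: "L2 (fourier (?G \<xi>))" for \<xi>
    by (rule L2_of_bounded_integrable[OF h, of _ 1]) (use gauss_le_1 gauss_pos in \<open>auto simp: fG norm_mult abs_of_pos\<close>)
  have A: "(LINT x|lborel. fourier (?G \<xi>) x * ifourier F x) = (LINT \<eta>|lborel. ?G \<xi> \<eta> * F \<eta>)" for \<xi>
  proof -
    have 1: "ifourier (fourier (?G \<xi>)) \<eta> = ?G \<xi> \<eta>" for \<eta>
    proof -
      have "ifourier (fourier (?G \<xi>)) \<eta> = (LINT x|lborel. cis (2 * pi * x * (\<eta> - \<xi>)) * of_real (gauss 1 x))"
        unfolding ifourier_def fG
        by (intro Bochner_Integration.integral_cong refl)
           (simp add: mult.assoc[symmetric] cis_mult, simp add: algebra_simps)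
      then show ?thesis using fourier_gauss[of 1] by simp
    qed
    show ?thesis using ifourier_swap[OF Fi h] by (simp add: 1 mult.commute)
  qed
  have B: "(LINT x|lborel. fourier (?G \<xi>) x * \<psi> x) = (LINT \<eta>|lborel. ?G \<xi> \<eta> * F \<eta>)" for \<xi>
  proof -
    define T where "T N x = indicator {-N..N} x *\<^sub>R \<psi> x" for N x :: real
    have Tm[measurable]: "T N \<in> borel_measurable borel" for N unfolding T_def by measurable
    have Ti: "integrable lborel (T N)" for N
    proof -
      have i: "integrable lborel (\<lambda>x. complex_of_real (indicator {-N..N} x))"
        by (intro integrable_of_real integrable_real_indicator) (auto simp: emeasure_lborel_Icc_eq)
      have "L2 (\<lambda>x. complex_of_real (indicator {-N..N} x))"
        by (rule L2_of_bounded_integrable[OF i, of 1]) (auto simp: indicator_def)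
      from L2_mult_integrable[OF this L] show ?thesis
        unfolding T_def[abs_def] by (simp add: scaleR_conv_of_real)
    qed
    have FT: "(LINT x:{-N..N}|lborel. \<psi> x * exp (- 2 * of_real pi * \<i> * of_real \<xi> * of_real x)) = fourier (T N) \<xi>" for N \<xi>
      unfolding set_lebesgue_integral_def fourier_def T_def
      by (intro Bochner_Integration.integral_cong refl) (simp add: cis_conv_exp mult_ac)
    have lim0: "((\<lambda>N. \<integral>\<^sup>+ \<xi>. ennreal ((cmod (F \<xi> - fourier (T N) \<xi>))\<^sup>2) \<partial>lborel) \<longlongrightarrow> 0) at_top"
      using F unfolding is_fourier_transform_def FT by simp
    have fTm[measurable]: "fourier (T N) \<in> borel_measurable borel" for N
    proof -
      have "(\<lambda>x. ifourier (T N) (- x)) \<in> borel_measurable borel"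
        by (rule measurable_compose[OF _ measurable_ifourier[OF Ti]]) simp
      then show ?thesis by (simp add: ifourier_eq_fourier)
    qed
    \<comment> \<open>The pairings with the truncations are followed to their limit twice: here on
      the space side, by dominated convergence.\<close>
    have "((\<lambda>N. LINT x|lborel. fourier (?G \<xi>) x * T N x) \<longlongrightarrow> (LINT x|lborel. fourier (?G \<xi>) x * \<psi> x)) at_top"
    proof (rule integral_dominated_convergence_at_top)
      show "integrable lborel (\<lambda>x. cmod (fourier (?G \<xi>) x * \<psi> x))"
        using L2_mult_integrable[OF hL L] by (rule integrable_norm)
      show "AE x in lborel. ((\<lambda>N. fourier (?G \<xi>) x * T N x) \<longlongrightarrow> fourier (?G \<xi>) x * \<psi> x) at_top"
      proof (rule AE_I2)
        fix x :: real
        have "eventually (\<lambda>N. fourier (?G \<xi>) x * T N x = fourier (?G \<xi>) x * \<psi> x) at_top"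
          using eventually_ge_at_top[of "\<bar>x\<bar>"] by eventually_elim (auto simp: T_def indicator_def)
        then show "((\<lambda>N. fourier (?G \<xi>) x * T N x) \<longlongrightarrow> fourier (?G \<xi>) x * \<psi> x) at_top"
          by (rule tendsto_eventually)
      qed
      show "\<forall>\<^sub>F N in at_top. AE x in lborel. cmod (fourier (?G \<xi>) x * T N x) \<le> cmod (fourier (?G \<xi>) x * \<psi> x)"
        by (intro always_eventually allI AE_I2) (auto simp: T_def indicator_def)
    qed (use h[of \<xi>, THEN borel_measurable_integrable] in auto)
    then have lim1: "((\<lambda>N. LINT x|lborel. ?G \<xi> x * fourier (T N) x) \<longlongrightarrow> (LINT x|lborel. fourier (?G \<xi>) x * \<psi> x)) at_top"
      by (simp only: fourier_swap[OF Gi Ti])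
    have GT: "integrable lborel (\<lambda>x. ?G \<xi> x * fourier (T N) x)" for N
    proof (rule Bochner_Integration.integrable_bound)
      let ?l = "LINT x|lborel. cmod (T N x)"
      show "integrable lborel (\<lambda>x. ?l * cmod (?G \<xi> x))"
        by (intro integrable_mult_right integrable_norm Gi)
      show "AE x in lborel. norm (?G \<xi> x * fourier (T N) x) \<le> norm (?l * cmod (?G \<xi> x))"
      proof (rule AE_I2)
        fix x
        have "cmod (fourier (T N) x) \<le> ?l"
          using norm_ifourier_le[of "T N" "- x"] by (simp add: ifourier_eq_fourier)
        then have "cmod (?G \<xi> x) * cmod (fourier (T N) x) \<le> cmod (?G \<xi> x) * ?l"
          by (intro mult_left_mono) auto
        also have "\<dots> \<le> norm (?l * cmod (?G \<xi> x))"
          using abs_ge_self by (simp add: mult.commute)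
        finally show "norm (?G \<xi> x * fourier (T N) x) \<le> norm (?l * cmod (?G \<xi> x))"
          by (simp add: norm_mult)
      qed
    qed auto
    have GF: "integrable lborel (\<lambda>x. ?G \<xi> x * F x)" by (rule L2_mult_integrable[OF GL LF])
    let ?K = "\<integral>\<^sup>+ x. ennreal ((cmod (?G \<xi> x))\<^sup>2) \<partial>lborel"
    let ?I = "\<lambda>N. \<integral>\<^sup>+ x. ennreal ((cmod (F x - fourier (T N) x))\<^sup>2) \<partial>lborel"
    let ?c = "\<lambda>N. cmod ((LINT x|lborel. ?G \<xi> x * F x) - (LINT x|lborel. ?G \<xi> x * fourier (T N) x))"
    have K: "?K < top"
      using GL[of \<xi>] unfolding L2_def integrable_iff_bounded by (simp add: less_top)
    \<comment> \<open>On the frequency side the limit follows by Cauchy-Schwarz from the L2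
      convergence that defines \<open>F\<close>.\<close>
    have le: "ennreal ((?c N)\<^sup>2) \<le> ?K * ?I N" for N
    proof -
      have "ennreal (?c N) = ennreal (cmod (LINT x|lborel. ?G \<xi> x * (F x - fourier (T N) x)))"
        using GF GT by (simp add: right_diff_distrib)
      also have "\<dots> \<le> (\<integral>\<^sup>+ x. ennreal (cmod (?G \<xi> x * (F x - fourier (T N) x))) \<partial>lborel)"
        by (rule integral_norm_bound_ennreal) (use GF GT in \<open>simp add: right_diff_distrib\<close>)
      also have "\<dots> = (\<integral>\<^sup>+ x. ennreal (cmod (?G \<xi> x)) * ennreal (cmod (F x - fourier (T N) x)) \<partial>lborel)"
        by (simp add: norm_mult ennreal_mult)
      finally have "(ennreal (?c N))\<^sup>2 \<le> (\<integral>\<^sup>+ x. ennreal (cmod (?G \<xi> x)) * ennreal (cmod (F x - fourier (T N) x)) \<partial>lborel)\<^sup>2"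
        by (rule power_mono) simp
      also have "\<dots> \<le> (\<integral>\<^sup>+ x. (ennreal (cmod (?G \<xi> x)))\<^sup>2 \<partial>lborel) * (\<integral>\<^sup>+ x. (ennreal (cmod (F x - fourier (T N) x)))\<^sup>2 \<partial>lborel)"
        by (rule Cauchy_Schwarz_nn_integral) auto
      finally show ?thesis by (simp add: ennreal_power)
    qed
    have "((\<lambda>N. ?K * ?I N) \<longlongrightarrow> ?K * 0) at_top"
      by (rule ennreal_tendsto_cmult[OF K lim0])
    then have KI: "((\<lambda>N. ?K * ?I N) \<longlongrightarrow> 0) at_top" by (simp only: mult_zero_right)
    have "((\<lambda>N. ennreal ((?c N)\<^sup>2)) \<longlongrightarrow> 0) at_top"
      by (rule tendsto_sandwich[OF always_eventually[OF allI[OF zero_le]] always_eventually[OF allI[OF le]] tendsto_const KI])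
    then have "((\<lambda>N. (?c N)\<^sup>2) \<longlongrightarrow> 0) at_top"
      by (simp flip: ennreal_0)
    then have "((\<lambda>N. (LINT x|lborel. ?G \<xi> x * F x) - (LINT x|lborel. ?G \<xi> x * fourier (T N) x)) \<longlongrightarrow> 0) at_top"
      by (simp add: tendsto_norm_zero_iff)
    from tendsto_diff[OF tendsto_const this, of "LINT x|lborel. ?G \<xi> x * F x"]
    have lim2: "((\<lambda>N. LINT x|lborel. ?G \<xi> x * fourier (T N) x) \<longlongrightarrow> (LINT x|lborel. ?G \<xi> x * F x)) at_top"
      by simp
    show ?thesis by (rule tendsto_unique[OF _ lim1 lim2]) simp
  qed
  let ?d = "\<lambda>x. \<psi> x - ifourier F x"
  have "AE x in lborel. ?g x * ?d x = 0"
  proof (rule fourier_zero_imp_AE_zero)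
    show "integrable lborel (\<lambda>x. ?g x * ?d x)" by (rule L2_mult_integrable[OF gL L2_diff[OF L L1]])
    fix \<xi>
    have "fourier (\<lambda>x. ?g x * ?d x) \<xi> = (LINT x|lborel. fourier (?G \<xi>) x * \<psi> x - fourier (?G \<xi>) x * ifourier F x)"
      unfolding fourier_def[of "\<lambda>x. ?g x * ?d x"] fG
      by (intro Bochner_Integration.integral_cong refl) (simp add: algebra_simps)
    also have "\<dots> = 0"
      using A B by (subst Bochner_Integration.integral_diff) (auto intro: L2_mult_integrable hL L L1)
    finally show "fourier (\<lambda>x. ?g x * ?d x) \<xi> = 0" .
  qed
  then show ?thesis
    by eventually_elim (use gauss_pos[of 1] in \<open>auto simp: less_le\<close>)
qed

section \<open>Derivatives and decay of inverse Fourier integrals\<close>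

lemma integral_deriv_zero:
  fixes F f :: "real \<Rightarrow> complex"
  assumes F: "\<And>x. (F has_vector_derivative f x) (at x)" and f: "continuous_on UNIV f" "integrable lborel f"
    and lim: "(F \<longlongrightarrow> 0) at_top" "(F \<longlongrightarrow> 0) at_bot"
  shows "(LINT x|lborel. f x) = 0"
proof -
  have "(LBINT x=-\<infinity>..\<infinity>. f x) = 0 - 0"
  proof (rule interval_integral_FTC_integrable[where F=F])
    show "isCont f x" for x using f(1) by (simp add: continuous_on_eq_continuous_at)
    show "set_integrable lborel (einterval (- \<infinity>) \<infinity>) f"
      using f(2) by (simp add: set_integrable_def)
  qed (use F lim in \<open>auto simp: ereal_tendsto_simps\<close>)
  then show ?thesis by (simp add: interval_lebesgue_integral_def set_lebesgue_integral_def)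
qed

lemma cis_has_vector_derivative:
  "((\<lambda>\<xi>. cis (a * \<xi>)) has_vector_derivative (\<i> * of_real a * cis (a * x))) (at x within S)"
proof -
  have "((\<lambda>z. exp (\<i> * of_real a * z)) has_field_derivative (\<i> * of_real a * exp (\<i> * of_real a * of_real x))) (at (of_real x))"
    by (auto intro!: derivative_eq_intros)
  from has_vector_derivative_real_field[OF this] show ?thesis
    by (simp add: cis_conv_exp mult.assoc)
qed

text \<open>Integration by parts: the derivative of cis (2 pi x \<xi>) f(\<xi>) integrates to 0
  because f vanishes at both ends of the line.\<close>

lemma ifourier_deriv:
  fixes f f' :: "real \<Rightarrow> complex"
  assumes f: "\<And>x. (f has_vector_derivative f' x) (at x)" and f': "continuous_on UNIV f'" 
    and i: "integrable lborel f" "integrable lborel f'"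
    and lim: "(f \<longlongrightarrow> 0) at_top" "(f \<longlongrightarrow> 0) at_bot"
  shows "ifourier f' x = - (\<i> * of_real (2 * pi * x)) * ifourier f x"
proof -
  have fc: "continuous_on UNIV f"
    using f by (auto intro!: continuous_at_imp_continuous_on has_vector_derivative_continuous)
  let ?F = "\<lambda>\<xi>. cis (2 * pi * x * \<xi>) * f \<xi>"
  let ?f = "\<lambda>\<xi>. cis (2 * pi * x * \<xi>) * f' \<xi> + \<i> * of_real (2 * pi * x) * (cis (2 * pi * x * \<xi>) * f \<xi>)"
  have i1: "integrable lborel (\<lambda>\<xi>. cis (2 * pi * x * \<xi>) * f' \<xi>)"
    and i2: "integrable lborel (\<lambda>\<xi>. cis (2 * pi * x * \<xi>) * f \<xi>)"
    using i by (auto intro!: integrable_cis_mult)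
  have lim': "(?F \<longlongrightarrow> 0) Z" if "(f \<longlongrightarrow> 0) Z" for Z
    by (rule tendsto_norm_zero_cancel) (use tendsto_norm_zero[OF that] in \<open>simp add: norm_mult\<close>)
  have "(LINT \<xi>|lborel. ?f \<xi>) = 0"
  proof (rule integral_deriv_zero)
    show "(?F has_vector_derivative ?f \<xi>) (at \<xi>)" for \<xi>
      using has_vector_derivative_mult[OF cis_has_vector_derivative f, of "2 * pi * x" \<xi>] by (simp add: mult_ac)
    show "continuous_on UNIV ?f" using f' fc by (intro continuous_intros)
    show "integrable lborel ?f" using i1 i2 by simp
  qed (auto intro!: lim' lim)
  moreover have "(LINT \<xi>|lborel. ?f \<xi>) = ifourier f' x + \<i> * of_real (2 * pi * x) * ifourier f x"
    unfolding ifourier_def integral_mult_right_zero[symmetric]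
    by (rule Bochner_Integration.integral_add) (use i1 i2 in auto)
  ultimately show ?thesis by (simp add: eq_neg_iff_add_eq_0)
qed

lemma ifourier_decay:
  fixes f f' f'' :: "real \<Rightarrow> complex"
  assumes f: "\<And>x. (f has_vector_derivative f' x) (at x)" and f': "\<And>x. (f' has_vector_derivative f'' x) (at x)"
    and f'': "continuous_on UNIV f''"
    and i: "integrable lborel f" "integrable lborel f'" "integrable lborel f''"
    and lim: "(f \<longlongrightarrow> 0) at_top" "(f \<longlongrightarrow> 0) at_bot" "(f' \<longlongrightarrow> 0) at_top" "(f' \<longlongrightarrow> 0) at_bot"
  shows "x\<^sup>2 * cmod (ifourier f x) \<le> (LINT \<xi>|lborel. cmod (f'' \<xi>))"
proof -
  have f'c: "continuous_on UNIV f'"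
    using f' by (auto intro!: continuous_at_imp_continuous_on has_vector_derivative_continuous)
  have "ifourier f'' x = - (\<i> * of_real (2 * pi * x)) * (- (\<i> * of_real (2 * pi * x)) * ifourier f x)"
    using ifourier_deriv[OF f' f'' i(2,3) lim(3,4)] ifourier_deriv[OF f f'c i(1,2) lim(1,2)] by simp
  then have "cmod (ifourier f'' x) = (2 * pi)\<^sup>2 * (x\<^sup>2 * cmod (ifourier f x))"
    by (simp add: norm_mult power2_eq_square)
  \<comment> \<open>The factor (2 pi)^2 is at least 1 and is given away.\<close>
  moreover have "1 * (x\<^sup>2 * cmod (ifourier f x)) \<le> (2 * pi)\<^sup>2 * (x\<^sup>2 * cmod (ifourier f x))"
    using pi_gt3 by (intro mult_right_mono one_le_power) auto
  ultimately show ?thesis using norm_ifourier_le[of f'' x] by simp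
qed

section \<open>The dilation parameter and the weight\<close>

lemma beta_pos: "0 < beta \<alpha> \<omega>"
  by (simp add: beta_def)

lemma beta_le_1: "0 \<le> \<alpha> \<Longrightarrow> beta \<alpha> \<omega> \<le> 1"
  by (simp add: beta_def powr_minus inverse_le_1_iff ge_one_powr_ge_zero)

lemma beta_measurable [measurable]: "beta \<alpha> \<in> borel_measurable borel"
  unfolding beta_def[abs_def] by measurable

text \<open>With W = 1 + |\<omega>| the product \<open>beta \<alpha> \<omega> * W\<close> equals
  W^(1 - \<alpha>) and is at least 1, so |\<xi> - \<omega>| is at most W times the rescaled
  distance. The rescaled distance enters with exponent 1, and this gives the cheap power \<alpha> in
  \<open>beta_upper\<close>.\<close>

lemma growth_upper:
  assumes "0 \<le> \<alpha>" "\<alpha> < 1"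
  shows "1 + \<bar>\<xi>\<bar> \<le> (1 + beta \<alpha> \<omega> * \<bar>\<xi> - \<omega>\<bar>) * (1 + \<bar>\<omega>\<bar>)"
proof -
  define W where "W = 1 + \<bar>\<omega>\<bar>"
  have W: "W \<ge> 1" by (simp add: W_def)
  have b: "beta \<alpha> \<omega> * W = W powr (1 - \<alpha>)"
    using W by (simp add: beta_def W_def powr_diff powr_minus field_simps)
  have "1 \<le> W powr (1 - \<alpha>)" using W assms by (intro ge_one_powr_ge_zero) auto
  then have "\<bar>\<xi> - \<omega>\<bar> \<le> \<bar>\<xi> - \<omega>\<bar> * (beta \<alpha> \<omega> * W)"
    using b by (simp add: mult_le_cancel_left1)
  moreover have "1 + \<bar>\<xi>\<bar> \<le> W + \<bar>\<xi> - \<omega>\<bar>" by (simp add: W_def)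
  ultimately show ?thesis by (simp add: W_def[symmetric] algebra_simps)
qed

text \<open>Either 1 + |\<omega>| is at most 2 (1 + |\<xi>|), or |\<xi> - \<omega>| is at least half
  of 1 + |\<omega>|. In the second case the rescaled distance is at least (1 + |\<omega>|)^(1 -
  \<alpha>) / 2, and the power 1/(1 - \<alpha>) recovers 1 + |\<omega>|.\<close>

lemma growth_lower:
  assumes "0 \<le> \<alpha>" "\<alpha> < 1"
  shows "1 + \<bar>\<omega>\<bar> \<le> 2 powr (1/(1-\<alpha>)) * (1 + beta \<alpha> \<omega> * \<bar>\<xi> - \<omega>\<bar>) powr (1/(1-\<alpha>)) * (1 + \<bar>\<xi>\<bar>)"
proof -
  define W where "W = 1 + \<bar>\<omega>\<bar>"
  define u where "u = beta \<alpha> \<omega> * \<bar>\<xi> - \<omega>\<bar>"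
  define p where "p = 1/(1-\<alpha>)"
  have W: "W \<ge> 1" by (simp add: W_def)
  have u: "u \<ge> 0" using beta_pos[of \<alpha> \<omega>] by (simp add: u_def)
  have p: "p \<ge> 1" using assms by (simp add: p_def field_simps)
  have one: "1 \<le> (1 + u) powr p" using u p by (intro ge_one_powr_ge_zero) auto
  have two: "2 \<le> 2 powr p" using p powr_mono[of 1 p 2] by simp
  show ?thesis
  proof (cases "W \<le> 2 * (1 + \<bar>\<xi>\<bar>)")
    case True
    have "2 * 1 \<le> 2 powr p * (1 + u) powr p" using one two by (intro mult_mono) auto
    then have "2 * (1 + \<bar>\<xi>\<bar>) \<le> 2 powr p * (1 + u) powr p * (1 + \<bar>\<xi>\<bar>)" by (intro mult_right_mono) auto
    with True show ?thesis by (simp add: W_def u_def p_def)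
  next
    case False
    have "W \<le> (1 + \<bar>\<xi>\<bar>) + \<bar>\<xi> - \<omega>\<bar>" by (simp add: W_def)
    with False have "W / 2 \<le> \<bar>\<xi> - \<omega>\<bar>" by simp
    then have "beta \<alpha> \<omega> * (W/2) \<le> u" unfolding u_def using beta_pos[of \<alpha> \<omega>] by (intro mult_left_mono) auto
    moreover have b: "beta \<alpha> \<omega> * W = W powr (1 - \<alpha>)"
      using W by (simp add: beta_def W_def powr_diff powr_minus field_simps)
    ultimately have "W powr (1-\<alpha>) \<le> 2 * u" by simp
    then have "(W powr (1-\<alpha>)) powr p \<le> (2 * (1 + u)) powr p" using p u by (intro powr_mono2) auto
    moreover have "(W powr (1-\<alpha>)) powr p = W" using assms W by (simp add: powr_powr p_def)
    ultimately have "W \<le> 2 powr p * (1 + u) powr p" using u by (simp only: powr_mult)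
    also have "\<dots> \<le> 2 powr p * (1 + u) powr p * (1 + \<bar>\<xi>\<bar>)"
      using mult_left_mono[of 1 "1 + \<bar>\<xi>\<bar>" "2 powr p * (1 + u) powr p"] by simp
    finally show ?thesis by (simp add: W_def u_def p_def)
  qed
qed

text \<open>A deliberate weakening of \<open>growth_upper\<close> to the exponent of
  \<open>growth_lower\<close>, so that both directions of a comparison cost the same.\<close>

lemma growth_upper':
  assumes "0 \<le> \<alpha>" "\<alpha> < 1"
  shows "1 + \<bar>\<xi>\<bar> \<le> 2 powr (1/(1-\<alpha>)) * (1 + beta \<alpha> \<omega> * \<bar>\<xi> - \<omega>\<bar>) powr (1/(1-\<alpha>)) * (1 + \<bar>\<omega>\<bar>)"
proof -
  define u where "u = beta \<alpha> \<omega> * \<bar>\<xi> - \<omega>\<bar>"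
  define p where "p = 1/(1-\<alpha>)"
  have u: "u \<ge> 0" using beta_pos[of \<alpha> \<omega>] by (simp add: u_def)
  have p: "p \<ge> 1" using assms by (simp add: p_def field_simps)
  have "1 + u \<le> (1 + u) powr p" using powr_mono[of 1 p "1 + u"] p u by simp
  moreover have "1 \<le> 2 powr p" using p by (intro ge_one_powr_ge_zero) auto
  ultimately have "1 * (1 + u) \<le> 2 powr p * (1 + u) powr p" using u by (intro mult_mono) auto
  then have "(1 + u) * (1 + \<bar>\<omega>\<bar>) \<le> 2 powr p * (1 + u) powr p * (1 + \<bar>\<omega>\<bar>)" by (intro mult_right_mono) auto
  with growth_upper[OF assms, of \<xi> \<omega>] show ?thesis by (simp add: u_def p_def)
qed

lemma beta_ratio_le:
  assumes "0 \<le> \<alpha>" "1 + \<bar>\<omega>'\<bar> \<le> k * (1 + \<bar>\<omega>\<bar>)" "0 < k"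
  shows "beta \<alpha> \<omega> \<le> k powr \<alpha> * beta \<alpha> \<omega>'"
proof -
  have "(1 + \<bar>\<omega>'\<bar>) powr \<alpha> \<le> (k * (1 + \<bar>\<omega>\<bar>)) powr \<alpha>" using assms by (intro powr_mono2) auto
  also have "\<dots> = k powr \<alpha> * (1 + \<bar>\<omega>\<bar>) powr \<alpha>" using assms by (simp add: powr_mult)
  finally show ?thesis by (simp add: beta_def powr_minus field_simps)
qed

lemma beta_upper:
  assumes "0 \<le> \<alpha>" "\<alpha> < 1"
  shows "beta \<alpha> \<omega> \<le> (1 + beta \<alpha> \<omega> * \<bar>\<xi> - \<omega>\<bar>) powr \<alpha> * beta \<alpha> \<xi>"
  by (rule beta_ratio_le) (use assms growth_upper[OF assms] beta_pos in \<open>auto intro: add_pos_nonneg simp: less_imp_le\<close>)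

lemma beta_lower:
  assumes "0 \<le> \<alpha>" "\<alpha> < 1"
  shows "beta \<alpha> \<xi> \<le> 2 powr (\<alpha>/(1-\<alpha>)) * (1 + beta \<alpha> \<omega> * \<bar>\<xi> - \<omega>\<bar>) powr (\<alpha>/(1-\<alpha>)) * beta \<alpha> \<omega>"
proof -
  have u: "0 < 1 + beta \<alpha> \<omega> * \<bar>\<xi> - \<omega>\<bar>" using beta_pos[of \<alpha> \<omega>] by (simp add: add_pos_nonneg)
  have "beta \<alpha> \<xi> \<le> (2 powr (1/(1-\<alpha>)) * (1 + beta \<alpha> \<omega> * \<bar>\<xi> - \<omega>\<bar>) powr (1/(1-\<alpha>))) powr \<alpha> * beta \<alpha> \<omega>"
    using u by (intro beta_ratio_le assms growth_lower) auto
  then show ?thesis using u by (simp add: powr_mult powr_powr)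
qed

lemma beta_lower':
  assumes "0 \<le> \<alpha>" "\<alpha> < 1"
  shows "beta \<alpha> \<omega> \<le> 2 powr (\<alpha>/(1-\<alpha>)) * (1 + beta \<alpha> \<omega> * \<bar>\<xi> - \<omega>\<bar>) powr (\<alpha>/(1-\<alpha>)) * beta \<alpha> \<xi>"
proof -
  have u: "0 < 1 + beta \<alpha> \<omega> * \<bar>\<xi> - \<omega>\<bar>" using beta_pos[of \<alpha> \<omega>] by (simp add: add_pos_nonneg)
  have "beta \<alpha> \<omega> \<le> (2 powr (1/(1-\<alpha>)) * (1 + beta \<alpha> \<omega> * \<bar>\<xi> - \<omega>\<bar>) powr (1/(1-\<alpha>))) powr \<alpha> * beta \<alpha> \<xi>"
    using u by (intro beta_ratio_le assms growth_upper') auto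
  then show ?thesis using u by (simp add: powr_mult powr_powr)
qed

text \<open>The two frequencies are compared through a third one, \<xi>, which is arbitrary. Later
  \<xi> is the integration variable on the Fourier side, so the weight can be absorbed pointwise
  under that integral.\<close>

lemma weight_bound:
  assumes "0 \<le> \<alpha>" "\<alpha> < 1" "0 \<le> s"
  shows "weight s \<omega> \<omega>' \<le> 4 powr (s/(1-\<alpha>)) *
    ((1 + beta \<alpha> \<omega> * \<bar>\<xi> - \<omega>\<bar>) * (1 + beta \<alpha> \<omega>' * \<bar>\<xi> - \<omega>'\<bar>)) powr (s/(1-\<alpha>))"
proof -
  define u where "u = 1 + beta \<alpha> \<omega> * \<bar>\<xi> - \<omega>\<bar>"
  define v where "v = 1 + beta \<alpha> \<omega>' * \<bar>\<xi> - \<omega>'\<bar>"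
  define p where "p = 1/(1-\<alpha>)"
  have u: "u > 0" and v: "v > 0" using beta_pos[of \<alpha>] by (auto simp add: u_def v_def less_imp_le intro!: add_pos_nonneg)
  have *: "1 + \<bar>a\<bar> \<le> 4 powr p * (u * v) powr p * (1 + \<bar>b\<bar>)"
    if "1 + \<bar>a\<bar> \<le> 2 powr p * x powr p * (1 + \<bar>\<xi>\<bar>)" "1 + \<bar>\<xi>\<bar> \<le> 2 powr p * y powr p * (1 + \<bar>b\<bar>)" "x * y = u * v" "x > 0" "y > 0"
    for a b x y
  proof -
    have "1 + \<bar>a\<bar> \<le> 2 powr p * x powr p * (1 + \<bar>\<xi>\<bar>)" by fact
    also have "\<dots> \<le> 2 powr p * x powr p * (2 powr p * y powr p * (1 + \<bar>b\<bar>))" using that by (intro mult_left_mono) auto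
    also have "\<dots> = (2 powr p * 2 powr p) * (x powr p * y powr p) * (1 + \<bar>b\<bar>)" by simp
    also have "2 powr p * 2 powr p = 4 powr p" by (simp flip: powr_mult)
    also have "x powr p * y powr p = (x*y) powr p" using that(4,5) by (simp add: powr_mult)
    finally show ?thesis using that by simp
  qed
  have "1 + \<bar>\<omega>\<bar> \<le> 4 powr p * (u * v) powr p * (1 + \<bar>\<omega>'\<bar>)"
    by (rule *[of _ u v]) (use growth_lower[OF assms(1,2)] growth_upper'[OF assms(1,2)] u v in \<open>auto simp: u_def v_def p_def\<close>)
  moreover have "1 + \<bar>\<omega>'\<bar> \<le> 4 powr p * (u * v) powr p * (1 + \<bar>\<omega>\<bar>)"
    by (rule *[of _ v u]) (use growth_lower[OF assms(1,2)] growth_upper'[OF assms(1,2)] u v in \<open>auto simp: u_def v_def p_def\<close>)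
  ultimately have "max ((1 + \<bar>\<omega>'\<bar>) / (1 + \<bar>\<omega>\<bar>)) ((1 + \<bar>\<omega>\<bar>) / (1 + \<bar>\<omega>'\<bar>)) \<le> 4 powr p * (u * v) powr p"
    by (auto simp: field_simps)
  then have "weight s \<omega> \<omega>' \<le> (4 powr p * (u * v) powr p) powr s"
    unfolding weight_def using assms by (auto intro!: powr_mono2 simp: le_max_iff_disj)
  also have "\<dots> = 4 powr (s/(1-\<alpha>)) * (u * v) powr (s/(1-\<alpha>))"
    using u v by (simp add: powr_mult powr_powr p_def)
  finally show ?thesis by (simp add: u_def v_def)
qed

lemma weight_nonneg: "0 \<le> weight s \<omega> \<omega>'"
  by (simp add: weight_def)

lemma weight_sym: "weight s \<omega> \<omega>' = weight s \<omega>' \<omega>"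
  by (simp add: weight_def max.commute)

lemma weight_measurable [measurable (raw)]:
  assumes [measurable]: "f \<in> borel_measurable A" "f' \<in> borel_measurable A"
  shows "(\<lambda>x. weight s (f x) (f' x)) \<in> borel_measurable A"
  unfolding weight_def by measurable

lemma weight_ge_1: "weight s \<omega> \<omega>' \<ge> 1"
proof -
  have "max ((1 + \<bar>\<omega>'\<bar>) / (1 + \<bar>\<omega>\<bar>)) ((1 + \<bar>\<omega>\<bar>) / (1 + \<bar>\<omega>'\<bar>)) \<ge> 1"
    by (auto simp: le_max_iff_disj field_simps)
  then show ?thesis unfolding weight_def by (rule ge_one_powr_ge_zero) simp
qed

text \<open>Let y be the quotient of 1 + |\<eta>| by 1 + |\<omega>|. As 1/(1 + |\<omega>|) is at
  most \<beta>(\<omega>), y differs from 1 by at most \<delta>, and the ratio of the dilations,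
  y^(-\<alpha>), lies between 1 and 1/y. The factor 2 comes from y \<ge> 1/2.\<close>

lemma beta_local:
  assumes "0 \<le> \<alpha>" "\<alpha> < 1" "\<bar>\<eta> - \<omega>\<bar> * beta \<alpha> \<omega> \<le> \<delta>" "\<delta> \<le> 1/2"
  shows "\<bar>beta \<alpha> \<eta> / beta \<alpha> \<omega> - 1\<bar> \<le> 2 * \<delta>"
proof -
  define W where "W = 1 + \<bar>\<omega>\<bar>"
  define y where "y = (1 + \<bar>\<eta>\<bar>) / W"
  have W: "W \<ge> 1" by (simp add: W_def)
  have b: "beta \<alpha> \<omega> = W powr -\<alpha>"
    using W by (simp add: beta_def W_def)
  have "W powr -1 \<le> W powr -\<alpha>" using W assms by (intro powr_mono) auto
  then have "1 / W \<le> beta \<alpha> \<omega>" using W by (simp add: b powr_minus_divide)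
  then have "\<bar>\<eta> - \<omega>\<bar> * (1/W) \<le> \<delta>" using assms(3) by (meson abs_ge_zero mult_left_mono order_trans)
  moreover have "\<bar>y - 1\<bar> \<le> \<bar>\<eta> - \<omega>\<bar> * (1/W)" 
  proof -
    have "y - 1 = (\<bar>\<eta>\<bar> - \<bar>\<omega>\<bar>) / W" using W by (simp add: y_def W_def field_simps)
    then have "\<bar>y - 1\<bar> = \<bar>\<bar>\<eta>\<bar> - \<bar>\<omega>\<bar>\<bar> / W" using W by simp
    also have "\<dots> \<le> \<bar>\<eta> - \<omega>\<bar> / W" using W by (intro divide_right_mono) auto
    finally show ?thesis by simp
  qed
  ultimately have y: "\<bar>y - 1\<bar> \<le> \<delta>" by linarith
  then have y2: "y \<ge> 1/2" using assms(4) by (auto simp: abs_if split: if_splits)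
  have e: "beta \<alpha> \<eta> / beta \<alpha> \<omega> = y powr -\<alpha>" 
    using W by (simp add: b y_def beta_def powr_divide) (simp add: W_def)
  show ?thesis
  proof (cases "y \<ge> 1")
    case True
    have "y powr -1 \<le> y powr -\<alpha>" using True assms by (intro powr_mono) auto
    moreover have "y powr -\<alpha> \<le> 1" using True assms by (simp add: powr_minus field_simps ge_one_powr_ge_zero)
    moreover have "1 - y powr -1 \<le> y - 1" using True zero_le_power2[of "y - 1"] by (simp add: powr_minus_divide field_simps power2_eq_square)
    ultimately show ?thesis using y True e by auto
  next
    case False
    have "y powr \<alpha> \<ge> y powr 1" using y2 False assms by (intro powr_mono') auto
    then have "y powr -\<alpha> \<le> 1 / y" using y2 by (simp add: powr_minus field_simps)
    moreover have "y powr \<alpha> \<le> 1" using y2 False assms by (intro powr_le1) auto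
    then have "1 \<le> y powr -\<alpha>" using y2 by (simp add: powr_minus field_simps)
    moreover have "1 / y - 1 \<le> 2 * (1 - y)"
    proof -
      have "(1 - y) / y \<le> (1 - y) / (1/2)" using y2 False by (intro divide_left_mono) auto
      then show ?thesis using y2 by (simp add: field_simps)
    qed
    ultimately show ?thesis using y False e by auto
  qed
qed

section \<open>Integrals of decaying functions\<close>

text \<open>The linearisation error is bounded by \<open>2 * G\<close> through the mean value
  inequality, so dominated convergence along sequences gives the derivative. The majorant is
  required only on the unit window around \<open>x0\<close>.\<close>

lemma leibniz_rule_lebesgue:
  fixes f f' :: "real \<Rightarrow> 'a \<Rightarrow> complex"
  assumes f: "\<And>x t. ((\<lambda>x. f x t) has_vector_derivative f' x t) (at x)"
    and bound: "\<And>x t. \<bar>x - x0\<bar> < 1 \<Longrightarrow> cmod (f' x t) \<le> G t"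
    and G: "integrable M G" and fi: "\<And>x. integrable M (f x)" and f': "f' x0 \<in> borel_measurable M"
  shows "((\<lambda>x. LINT t|M. f x t) has_vector_derivative (LINT t|M. f' x0 t)) (at x0)"
proof -
  have f'i: "integrable M (f' x0)"
  proof (rule Bochner_Integration.integrable_bound[OF G f'], rule AE_I2)
    show "norm (f' x0 t) \<le> norm (G t)" for t
      using bound[of x0 t] by (auto intro: order_trans[OF _ abs_ge_self])
  qed
  let ?q = "\<lambda>y t. (f y t - f x0 t - (y - x0) *\<^sub>R f' x0 t) /\<^sub>R norm (y - x0)"
  have lim: "((\<lambda>y. LINT t|M. ?q y t) \<longlongrightarrow> 0) (at x0)"
    unfolding tendsto_at_iff_sequentially comp_def
  proof (intro allI impI)
    fix X assume X: "\<forall>i. X i \<in> UNIV - {x0}" "X \<longlonglongrightarrow> x0"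
    from tendstoD[OF X(2), of 1] obtain N where N: "\<And>n. n \<ge> N \<Longrightarrow> \<bar>X n - x0\<bar> < 1"
      by (auto simp: eventually_sequentially dist_real_def)
    have "(\<lambda>n. LINT t|M. ?q (X (n + N)) t) \<longlonglongrightarrow> (LINT t|M. 0)"
    proof (rule integral_dominated_convergence[where w="\<lambda>t. 2 * G t"])
      show "AE t in M. (\<lambda>n. ?q (X (n + N)) t) \<longlonglongrightarrow> 0"
      proof (rule AE_I2)
        fix t
        have "((\<lambda>y. ?q y t) \<longlongrightarrow> 0) (at x0)"
          using f[of t x0] unfolding has_vector_derivative_def has_derivative_at_within by auto
        then have "(\<lambda>n. ?q (X n) t) \<longlonglongrightarrow> 0"
          using X unfolding tendsto_at_iff_sequentially comp_def by blast
        then show "(\<lambda>n. ?q (X (n + N)) t) \<longlonglongrightarrow> 0" by (rule LIMSEQ_ignore_initial_segment)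
      qed
      show "AE t in M. norm (?q (X (n + N)) t) \<le> 2 * G t" for n
      proof (rule AE_I2)
        fix t
        have n: "\<bar>X (n + N) - x0\<bar> < 1" and ne: "X (n + N) \<noteq> x0" using N[of "n + N"] X(1) by auto
        have "norm (f (X (n + N)) t - f x0 t - (X (n + N) - x0) *\<^sub>R f' x0 t) \<le> norm (X (n + N) - x0) * (2 * G t)"
        proof (rule vector_differentiable_bound_linearization[where S="ball x0 1" and f'="\<lambda>x. f' x t"])
          show "closed_segment x0 (X (n + N)) \<subseteq> ball x0 1"
            using n by (intro closed_segment_subset) (auto simp: dist_real_def)
          show "norm (f' x t - f' x0 t) \<le> 2 * G t" if "x \<in> ball x0 1" for x
            using norm_triangle_ineq4[of "f' x t" "f' x0 t"] bound[of x t] bound[of x0 t] that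
            by (auto simp: dist_real_def abs_minus_commute)
        qed (auto intro: has_vector_derivative_at_within f)
        then show "norm (?q (X (n + N)) t) \<le> 2 * G t"
          using ne by (simp add: divide_simps mult.commute)
      qed
    qed (use fi f'i G in auto)
    then show "(\<lambda>n. LINT t|M. ?q (X n) t) \<longlonglongrightarrow> 0" using LIMSEQ_offset by force
  qed
  have eq: "(LINT t|M. ?q y t) = ((LINT t|M. f y t) - (LINT t|M. f x0 t) - (y - x0) *\<^sub>R (LINT t|M. f' x0 t)) /\<^sub>R norm (y - x0)" for y
    using fi f'i by simp
  show ?thesis
    unfolding has_vector_derivative_def has_derivative_at_within
    by (intro conjI bounded_linear_scaleR_left) (rule lim[unfolded eq])
qed

lemma nn_integral_powr_abs_finite:
  assumes "q > 1"
  shows "(\<integral>\<^sup>+ t. ennreal ((1 + \<bar>t\<bar>) powr - q) \<partial>lborel) < \<infinity>"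
proof -
  let ?F = "\<lambda>t. - ((1 + t) powr (1 - q)) / (q - 1)"
  have "(\<integral>\<^sup>+ t. ennreal ((1 + t) powr - q) * indicator {0..} t \<partial>lborel) = 0 - ?F 0"
  proof (rule nn_integral_FTC_atLeast)
    show "DERIV ?F t :> (1 + t) powr - q" if "0 \<le> t" for t
    proof -
      have "DERIV (\<lambda>t. 1 + t) t :> 1" by (auto intro!: derivative_eq_intros)
      from DERIV_cdivide[OF DERIV_minus[OF DERIV_fun_powr[OF this, of "1 - q"]], of "q - 1"]
      have "DERIV ?F t :> - ((1 - q) * (1 + t) powr - q) / (q - 1)" using that by simp
      moreover have "- ((1 - q) * (1 + t) powr - q) / (q - 1) = (1 + t) powr - q"
        using assms by (simp add: divide_simps) (simp add: algebra_simps)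
      ultimately show ?thesis by simp
    qed
    have "((\<lambda>t. (1 + t) powr (1 - q)) \<longlongrightarrow> 0) at_top"
      using assms by (intro tendsto_neg_powr filterlim_tendsto_add_at_top[OF tendsto_const filterlim_ident]) auto
    from tendsto_divide[OF tendsto_minus[OF this] tendsto_const, of "q - 1"]
    show "(?F \<longlongrightarrow> 0) at_top" using assms by simp
  qed auto
  then have pos: "(\<integral>\<^sup>+ t. ennreal ((1 + t) powr - q) * indicator {0..} t \<partial>lborel) < \<infinity>" by simp
  have neg: "(\<integral>\<^sup>+ t. ennreal ((1 - t) powr - q) * indicator {0..} (- t) \<partial>lborel) < \<infinity>"
    using pos by (subst (asm) nn_integral_real_affine[where c="-1" and t=0]) auto
  have "(\<integral>\<^sup>+ t. ennreal ((1 + \<bar>t\<bar>) powr - q) \<partial>lborel) \<le>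
    (\<integral>\<^sup>+ t. ennreal ((1 + t) powr - q) * indicator {0..} t + ennreal ((1 - t) powr - q) * indicator {0..} (- t) \<partial>lborel)"
    by (intro nn_integral_mono) (auto simp: indicator_def abs_if)
  also have "\<dots> = (\<integral>\<^sup>+ t. ennreal ((1 + t) powr - q) * indicator {0..} t \<partial>lborel) + (\<integral>\<^sup>+ t. ennreal ((1 - t) powr - q) * indicator {0..} (- t) \<partial>lborel)"
    by (rule nn_integral_add) auto
  also have "\<dots> < \<infinity>" using pos neg by (simp add: less_top)
  finally show ?thesis .
qed

text \<open>\<open>enn2real\<close> turns an infinite integral into 0, so this is the true integral
  only for exponents greater than 1.\<close>

definition decay_integral :: "real \<Rightarrow> real" where
  "decay_integral q = enn2real (\<integral>\<^sup>+ t. ennreal ((1 + \<bar>t\<bar>) powr - q) \<partial>lborel)"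

lemma nn_integral_decay:
  assumes "q > 1" "b > 0"
  shows "(\<integral>\<^sup>+ t. ennreal (b * (1 + b * \<bar>t - w\<bar>) powr - q) \<partial>lborel) = ennreal (decay_integral q)"
proof -
  have "(\<integral>\<^sup>+ t. ennreal (b * (1 + b * \<bar>t - w\<bar>) powr - q) \<partial>lborel) =
      ennreal \<bar>1/b\<bar> * (\<integral>\<^sup>+ t. ennreal (b * (1 + b * \<bar>w + 1/b * t - w\<bar>) powr - q) \<partial>lborel)"
    using assms by (intro nn_integral_real_affine) auto
  also have "\<dots> = ennreal \<bar>1/b\<bar> * (\<integral>\<^sup>+ t. ennreal b * ennreal ((1 + \<bar>t\<bar>) powr - q) \<partial>lborel)"
    using assms by (simp add: abs_mult ennreal_mult)
  also have "\<dots> = ennreal \<bar>1/b\<bar> * (ennreal b * (\<integral>\<^sup>+ t. ennreal ((1 + \<bar>t\<bar>) powr - q) \<partial>lborel))"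
    by (subst nn_integral_cmult) auto
  also have "\<dots> = (ennreal \<bar>1/b\<bar> * ennreal b) * (\<integral>\<^sup>+ t. ennreal ((1 + \<bar>t\<bar>) powr - q) \<partial>lborel)"
    by (simp only: mult.assoc)
  also have "ennreal \<bar>1/b\<bar> * ennreal b = 1" using assms by (simp flip: ennreal_mult)
  finally show ?thesis using nn_integral_powr_abs_finite[OF assms(1)] by (simp add: decay_integral_def)
qed

lemma decay_integral_nonneg: "decay_integral q \<ge> 0"
  by (simp add: decay_integral_def)

text \<open>The scale \<beta>(\<omega>) moves with the integration variable and is therefore frozen
  at \<xi>. Replacing the factor \<beta>(\<omega>) costs the power \<alpha>. The decay is rewritten
  in terms of V = 1 + \<beta>(\<xi>) |\<omega> - \<xi>|, which is at most a constant times U^(1/(1 -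
  \<alpha>)); this multiplies the exponent by 1 - \<alpha>.\<close>

lemma nn_integral_beta_bound:
  assumes a: "0 \<le> \<alpha>" "\<alpha> < 1" and q: "(q - \<alpha>) * (1 - \<alpha>) > 1"
  shows "(\<integral>\<^sup>+ \<omega>. ennreal (beta \<alpha> \<omega> * (1 + beta \<alpha> \<omega> * \<bar>\<xi> - \<omega>\<bar>) powr - q) \<partial>lborel)
    \<le> ennreal (2 powr (\<alpha> * (q - \<alpha>)) * decay_integral ((q - \<alpha>) * (1 - \<alpha>)))"
proof -
  define p where "p = \<alpha> / (1 - \<alpha>)"
  define q' where "q' = (q - \<alpha>) * (1 - \<alpha>)"
  have p0: "p \<ge> 0" using a by (simp add: p_def)
  have q0: "q - \<alpha> > 0" using q a mult_nonpos_nonneg[of "q - \<alpha>" "1 - \<alpha>"]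
    by (cases "q - \<alpha> \<le> 0") auto
  have pw: "beta \<alpha> \<omega> * (1 + beta \<alpha> \<omega> * \<bar>\<xi> - \<omega>\<bar>) powr - q \<le>
     2 powr (\<alpha> * (q - \<alpha>)) * (beta \<alpha> \<xi> * (1 + beta \<alpha> \<xi> * \<bar>\<omega> - \<xi>\<bar>) powr - q')" for \<omega>
  proof -
    define U where "U = 1 + beta \<alpha> \<omega> * \<bar>\<xi> - \<omega>\<bar>"
    define V where "V = 1 + beta \<alpha> \<xi> * \<bar>\<omega> - \<xi>\<bar>"
    have U: "U \<ge> 1" and V: "V \<ge> 1" using beta_pos[of \<alpha> \<omega>] beta_pos[of \<alpha> \<xi>] by (auto simp: U_def V_def)
    have c1: "1 \<le> 2 powr p * U powr p" using mult_mono[of 1 "2 powr p" 1 "U powr p"] U p0 by (auto simp: ge_one_powr_ge_zero)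
    have "beta \<alpha> \<xi> * \<bar>\<omega> - \<xi>\<bar> \<le> 2 powr p * U powr p * beta \<alpha> \<omega> * \<bar>\<omega> - \<xi>\<bar>"
      using beta_lower[OF a, of \<xi> \<omega>] by (intro mult_right_mono) (auto simp: U_def p_def)
    also have "\<dots> = 2 powr p * U powr p * (U - 1)" by (simp add: U_def abs_minus_commute)
    finally have "V \<le> 2 powr p * U powr p * U" using c1 by (simp add: V_def algebra_simps)
    also have "\<dots> = 2 powr p * U powr (p + 1)" using U by (simp add: powr_add)
    also have "p + 1 = 1 / (1 - \<alpha>)" using a by (simp add: p_def field_simps)
    finally have "V powr q' \<le> (2 powr p * U powr (1 / (1 - \<alpha>))) powr q'"
      using V q unfolding q'_def by (intro powr_mono2) auto
    also have "\<dots> = 2 powr (\<alpha> * (q - \<alpha>)) * U powr (q - \<alpha>)"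
      using a by (simp add: powr_mult powr_powr q'_def p_def)
    finally have VU: "V powr q' \<le> 2 powr (\<alpha> * (q - \<alpha>)) * U powr (q - \<alpha>)" .
    have "U powr - e \<le> K * V powr - f" if "V powr f \<le> K * U powr e" for e f K
      using U V that by (simp add: powr_minus field_simps)
    from this[OF VU] have "U powr - (q - \<alpha>) \<le> 2 powr (\<alpha> * (q - \<alpha>)) * V powr - q'" .
    then have "beta \<alpha> \<xi> * U powr - (q - \<alpha>) \<le> 2 powr (\<alpha> * (q - \<alpha>)) * (beta \<alpha> \<xi> * V powr - q')"
      using mult_left_mono[of _ _ "beta \<alpha> \<xi>"] beta_pos[of \<alpha> \<xi>] by (simp add: mult_ac)
    moreover have "beta \<alpha> \<omega> * U powr - q \<le> U powr \<alpha> * beta \<alpha> \<xi> * U powr - q"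
      using beta_upper[OF a, of \<omega> \<xi>] by (intro mult_right_mono) (auto simp: U_def)
    moreover have "U powr \<alpha> * beta \<alpha> \<xi> * U powr - q = beta \<alpha> \<xi> * U powr - (q - \<alpha>)"
      using U by (simp add: powr_diff powr_minus field_simps)
    ultimately have "beta \<alpha> \<omega> * U powr - q \<le> 2 powr (\<alpha> * (q - \<alpha>)) * (beta \<alpha> \<xi> * V powr - q')"
      by linarith
    then show ?thesis by (simp only: U_def V_def)
  qed
  have "(\<integral>\<^sup>+ \<omega>. ennreal (beta \<alpha> \<omega> * (1 + beta \<alpha> \<omega> * \<bar>\<xi> - \<omega>\<bar>) powr - q) \<partial>lborel) \<le>
    (\<integral>\<^sup>+ \<omega>. ennreal (2 powr (\<alpha> * (q - \<alpha>))) * ennreal (beta \<alpha> \<xi> * (1 + beta \<alpha> \<xi> * \<bar>\<omega> - \<xi>\<bar>) powr - q') \<partial>lborel)"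
    using pw beta_pos[of \<alpha> \<xi>] by (intro nn_integral_mono) (simp flip: ennreal_mult)
  also have "\<dots> = ennreal (2 powr (\<alpha> * (q - \<alpha>))) * ennreal (decay_integral q')"
    using q beta_pos[of \<alpha> \<xi>] by (subst nn_integral_cmult) (auto simp: nn_integral_decay q'_def)
  finally show ?thesis by (simp add: q'_def ennreal_mult decay_integral_nonneg)
qed

section \<open>The symbol of the frame operator\<close>

text \<open>Only the Fourier side is axiomatised: \<open>g n\<close> stands for the
  \<open>n\<close>-th derivative of the transform of \<psi>. The function \<psi> itself, which the
  transform determines only almost everywhere, enters in \<open>wavelet_generator\<close>.\<close>

locale wavelet =
  fixes \<alpha> s r C :: real and g :: "nat \<Rightarrow> real \<Rightarrow> complex"
  assumes \<alpha>: "0 \<le> \<alpha>" "\<alpha> < 1" and s: "0 \<le> s" and C: "C > 0"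
    and g_deriv: "\<And>n t. n < 3 \<Longrightarrow> (g n has_vector_derivative g (Suc n) t) (at t)"
    and g_cont3: "continuous_on UNIV (g 3)"
    and g_bound: "\<And>n t. n \<le> 3 \<Longrightarrow> cmod (g n t) \<le> C * (1 + \<bar>t\<bar>) powr - r"
    and r: "r > (2 + 2 * s + 7 * \<alpha> - 4 * \<alpha>\<^sup>2) / (2 * (1 - \<alpha>)\<^sup>2) + 1"
    and g_nonzero: "\<exists>t. g 0 t \<noteq> 0"
begin

abbreviation b where "b \<equiv> beta \<alpha>"

text \<open>The decay that is left after the weight, the mismatch of the scales and one factor $1+|t|$ have been
  absorbed. The lower bound on \<open>r\<close> enters only through \<open>q_cond\<close> below.\<close>

definition q where "q = r - 1 - (\<alpha> + s) / (1 - \<alpha>)"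

lemma q_cond: "(q - \<alpha>) * (1 - \<alpha>) > 1"
proof -
  define d where "d = 1 - \<alpha>"
  have d: "0 < d" "d \<le> 1" using \<alpha> by (auto simp: d_def)
  have "2 * d\<^sup>2 * (r - 1) > 2 + 2 * s + 7 * \<alpha> - 4 * \<alpha>\<^sup>2"
    using r d unfolding d_def[symmetric] by (simp add: field_simps)
  then have 1: "(2 * (r - 1) * d) * d > 2 + 2 * s + 7 * \<alpha> - 4 * \<alpha>\<^sup>2"
    by (simp add: power2_eq_square mult_ac)
  have aa: "\<alpha>\<^sup>2 \<le> \<alpha>" using \<alpha> by (simp add: power2_eq_square mult_left_le)
  have pos: "2 + 2 * s + 7 * \<alpha> - 4 * \<alpha>\<^sup>2 > 0" using aa s \<alpha> by linarith
  then have "(2 * (r - 1) * d) > 0" using 1 d by (metis less_trans zero_less_mult_pos2)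
  then have "(2 * (r - 1) * d) * d \<le> 2 * (r - 1) * d" using d by (intro mult_left_le) auto
  with 1 have 2: "2 * (r - 1) * d > 2 + 2 * s + 7 * \<alpha> - 4 * \<alpha>\<^sup>2" by simp
  have "(q - \<alpha>) * d = (r - 1) * d - (\<alpha> + s) - \<alpha> * d"
    using d by (simp add: q_def d_def[symmetric] field_simps)
  also have "\<dots> = (r - 1) * d - 2 * \<alpha> - s + \<alpha>\<^sup>2" by (simp add: d_def power2_eq_square algebra_simps)
  finally have "(q - \<alpha>) * d = (r - 1) * d - 2 * \<alpha> - s + \<alpha>\<^sup>2" .
  moreover have "2 * ((r - 1) * d) > 2 + 2 * s + 7 * \<alpha> - 4 * \<alpha>\<^sup>2" using 2 by (simp only: mult.assoc)
  ultimately have "(q - \<alpha>) * d > 1" using aa \<alpha> by linarith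
  then show ?thesis by (simp add: d_def)
qed

lemma q_gt_1: "q > 1"
proof -
  have d: "0 < 1 - \<alpha>" "1 - \<alpha> \<le> 1" using \<alpha> by auto
  have "q - \<alpha> > 0" using q_cond d by (meson less_trans zero_less_mult_pos2 zero_less_one)
  then have "(q - \<alpha>) * (1 - \<alpha>) \<le> q - \<alpha>" using d by (intro mult_left_le) auto
  then show ?thesis using q_cond \<alpha> by linarith
qed

lemma r_ge: "r \<ge> q + 1 + (\<alpha> + s) / (1 - \<alpha>)" "r > 2" "r \<ge> q + 1"
proof -
  have "(\<alpha> + s) / (1 - \<alpha>) \<ge> 0" using \<alpha> s by auto
  then show "r \<ge> q + 1 + (\<alpha> + s) / (1 - \<alpha>)" "r > 2" "r \<ge> q + 1" using q_gt_1 by (auto simp: q_def)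
qed

text \<open>By \<open>U_eq\<close> this is 1 + |t| at the argument t of the dilated generator, so
  every loss and gain of decay is recorded as a power of \<open>U\<close>.\<close>

definition U where "U \<omega> \<xi> = 1 + b \<omega> * \<bar>\<xi> - \<omega>\<bar>"

lemma U_ge_1: "U \<omega> \<xi> \<ge> 1"
  using beta_pos[of \<alpha> \<omega>] by (simp add: U_def)

lemma U_measurable [measurable (raw)]:
  assumes [measurable]: "f \<in> borel_measurable A" "h \<in> borel_measurable A"
  shows "(\<lambda>x. U (f x) (h x)) \<in> borel_measurable A"
  unfolding U_def by measurable

definition B where "B = 2 powr (\<alpha> * (q - \<alpha>)) * decay_integral ((q - \<alpha>) * (1 - \<alpha>))"

lemma B_nonneg: "B \<ge> 0"
  by (simp add: B_def decay_integral_nonneg)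

lemma nn_integral_U_omega: "(\<integral>\<^sup>+ \<omega>. ennreal (b \<omega> * U \<omega> \<xi> powr - q) \<partial>lborel) \<le> ennreal B"
  using nn_integral_beta_bound[OF \<alpha> q_cond] by (simp add: B_def U_def)

lemma nn_integral_U_xi: "p > 1 \<Longrightarrow> (\<integral>\<^sup>+ \<xi>. ennreal (b \<omega> * U \<omega> \<xi> powr - p) \<partial>lborel) = ennreal (decay_integral p)"
  using nn_integral_decay[OF _ beta_pos] by (simp add: U_def)

lemma integrable_U_omega: "integrable lborel (\<lambda>\<omega>. b \<omega> * U \<omega> \<xi> powr - q)"
  using le_less_trans[OF nn_integral_U_omega[of \<xi>]] beta_pos[of \<alpha>]
  by (auto intro!: integrableI_nonneg simp: less_imp_le)

lemma integral_U_omega: "(LINT \<omega>|lborel. b \<omega> * U \<omega> \<xi> powr - q) \<le> B"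
proof -
  have "ennreal (LINT \<omega>|lborel. b \<omega> * U \<omega> \<xi> powr - q) = (\<integral>\<^sup>+ \<omega>. ennreal (b \<omega> * U \<omega> \<xi> powr - q) \<partial>lborel)"
    using beta_pos[of \<alpha>] by (intro nn_integral_eq_integral[symmetric] integrable_U_omega) (auto simp: less_imp_le)
  with nn_integral_U_omega[of \<xi>] show ?thesis by (metis ennreal_le_iff B_nonneg)
qed

lemma integrable_U_xi:
  assumes "p > 1" shows "integrable lborel (\<lambda>\<xi>. U \<omega> \<xi> powr - p)"
proof -
  have "integrable lborel (\<lambda>\<xi>. b \<omega> * U \<omega> \<xi> powr - p)"
    using nn_integral_U_xi[OF assms, of \<omega>] beta_pos[of \<alpha>]
    by (intro integrableI_nonneg) (auto simp: less_imp_le)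
  then show ?thesis using beta_pos[of \<alpha> \<omega>] by simp
qed

lemma g_cont: "n \<le> 3 \<Longrightarrow> continuous_on UNIV (g n)"
  using g_cont3 g_deriv[of n]
  by (cases "n = 3") (auto intro!: continuous_at_imp_continuous_on has_vector_derivative_continuous)

lemma g_measurable [measurable]: "g 0 \<in> borel_measurable borel" "g (Suc 0) \<in> borel_measurable borel"
  "g 2 \<in> borel_measurable borel"
  by (auto intro!: borel_measurable_continuous_onI g_cont)

text \<open>For $k \le 2$, \<open>P k\<close>, \<open>M k\<close> and, further below, \<open>N k\<close> are the \<open>k\<close>-th derivatives of $|\hat\psi|^2$,
  $m_\psi$ and $1/m_\psi$.\<close>

definition P :: "nat \<Rightarrow> real \<Rightarrow> complex" where
  "P k t = (if k = 0 then g 0 t * cnj (g 0 t)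
     else if k = 1 then g 1 t * cnj (g 0 t) + g 0 t * cnj (g 1 t)
     else g 2 t * cnj (g 0 t) + 2 * (g 1 t * cnj (g 1 t)) + g 0 t * cnj (g 2 t))"

lemma P_deriv: "k < 2 \<Longrightarrow> (P k has_vector_derivative P (Suc k) t) (at t)"
proof -
  have g01: "(g 0 has_vector_derivative g 1 t) (at t)" "(g 1 has_vector_derivative g 2 t) (at t)"
    using g_deriv[of 0 t] g_deriv[of 1 t] by (auto simp: numeral_2_eq_2)
  note c = has_vector_derivative_cnj[OF g01(1)] has_vector_derivative_cnj[OF g01(2)]
  assume "k < 2"
  then consider "k = 0" | "k = 1" by linarith
  then show ?thesis
  proof cases
    case 1
    then show ?thesis
      using has_vector_derivative_mult[OF g01(1) c(1)] by (simp add: P_def[abs_def] add.commute)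
  next
    case 2
    then show ?thesis
      using has_vector_derivative_add[OF has_vector_derivative_mult[OF g01(2) c(1)] has_vector_derivative_mult[OF g01(1) c(2)]]
      by (simp add: P_def[abs_def] algebra_simps numeral_2_eq_2)
  qed
qed

lemma P_cont: "k \<le> 2 \<Longrightarrow> continuous_on UNIV (P k)"
  unfolding P_def[abs_def] using g_cont[of 0] g_cont[of 1] g_cont[of 2]
  by (cases "k = 0"; cases "k = 1") (auto intro!: continuous_intros)

lemma P_measurable [measurable]: "k \<le> 2 \<Longrightarrow> P k \<in> borel_measurable borel"
  by (rule borel_measurable_continuous_onI[OF P_cont])

lemma P_bound: "k \<le> 2 \<Longrightarrow> cmod (P k t) \<le> 4 * C\<^sup>2 * (1 + \<bar>t\<bar>) powr - (2 * r)"
proof -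
  assume k: "k \<le> 2"
  have gg: "cmod (g i t * cnj (g j t)) \<le> C\<^sup>2 * (1 + \<bar>t\<bar>) powr - (2 * r)" if "i \<le> 2" "j \<le> 2" for i j
  proof -
    have "cmod (g i t) * cmod (g j t) \<le> (C * (1 + \<bar>t\<bar>) powr - r) * (C * (1 + \<bar>t\<bar>) powr - r)"
      using that C by (intro mult_mono g_bound) auto
    also have "\<dots> = C\<^sup>2 * ((1 + \<bar>t\<bar>) powr - r * (1 + \<bar>t\<bar>) powr - r)" by (simp add: power2_eq_square)
    also have "(1 + \<bar>t\<bar>) powr - r * (1 + \<bar>t\<bar>) powr - r = (1 + \<bar>t\<bar>) powr - (2 * r)"
      by (simp add: powr_add[symmetric])
    finally show ?thesis by (simp add: norm_mult)
  qed
  let ?X = "C\<^sup>2 * (1 + \<bar>t\<bar>) powr - (2 * r)"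
  have X: "0 \<le> ?X" by simp
  consider "k = 0" | "k = 1" | "k = 2" using k by linarith
  then have "cmod (P k t) \<le> 4 * ?X"
  proof cases
    case 1
    then have "cmod (P k t) \<le> ?X" using gg[of 0 0] by (simp add: P_def)
    with X show ?thesis by linarith
  next
    case 2
    then have "cmod (P k t) = cmod (g 1 t * cnj (g 0 t) + g 0 t * cnj (g 1 t))" by (simp add: P_def)
    then show ?thesis using gg[of 1 0] gg[of 0 1] X norm_triangle_ineq[of "g 1 t * cnj (g 0 t)" "g 0 t * cnj (g 1 t)"]
      by linarith
  next
    case 3
    have "cmod (P k t) \<le> cmod (g 2 t * cnj (g 0 t)) + cmod (2 * (g 1 t * cnj (g 1 t))) + cmod (g 0 t * cnj (g 2 t))"
      using 3 unfolding P_def by (auto intro!: norm_triangle_le add_mono norm_triangle_ineq)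
    also have "\<dots> \<le> ?X + 2 * ?X + ?X"
      using gg[of 2 0] gg[of 1 1] gg[of 0 2] by (intro add_mono) (auto simp: norm_mult)
    finally show ?thesis by simp
  qed
  then show ?thesis by simp
qed

definition M :: "nat \<Rightarrow> real \<Rightarrow> complex" where
  "M k \<xi> = (LINT \<omega>|lborel. P k (b \<omega> * (\<xi> - \<omega>)) * of_real (b \<omega> ^ Suc k))"

lemma U_eq: "1 + \<bar>b \<omega> * (\<xi> - \<omega>)\<bar> = U \<omega> \<xi>"
  using beta_pos[of \<alpha> \<omega>] by (simp add: U_def abs_mult)

text \<open>The chain rule produces \<beta>(\<omega>)^k, but the bound has to carry
  \<beta>(\<xi>)^k, which can be pulled out of the \<omega>-integral. The exchange costs at most
  U^2; the decay 2 r of the squared modulus pays for it and still leaves the exponent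
  \<open>q\<close>.\<close>

lemma M_integrand_bound:
  assumes "k \<le> 2"
  shows "cmod (P k (b \<omega> * (\<xi> - \<omega>)) * of_real (b \<omega> ^ Suc k)) \<le> 4 * C\<^sup>2 * b \<xi> ^ k * (b \<omega> * U \<omega> \<xi> powr - q)"
proof -
  have b: "0 < b \<omega>" "0 < b \<xi>" by (auto simp: beta_pos)
  have "b \<omega> ^ k \<le> (U \<omega> \<xi> powr \<alpha> * b \<xi>) ^ k"
    using beta_upper[OF \<alpha>, of \<omega> \<xi>] b by (intro power_mono) (auto simp: U_def)
  also have "\<dots> = U \<omega> \<xi> powr (k * \<alpha>) * b \<xi> ^ k"
    using U_ge_1[of \<omega> \<xi>] by (simp add: power_mult_distrib powr_power mult.commute)
  also have "\<dots> \<le> U \<omega> \<xi> powr 2 * b \<xi> ^ k"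
    using U_ge_1[of \<omega> \<xi>] \<alpha> assms b mult_mono[of "real k" 2 \<alpha> 1]
    by (intro mult_right_mono powr_mono) auto
  finally have bk: "b \<omega> ^ k \<le> U \<omega> \<xi> powr 2 * b \<xi> ^ k" .
  have "cmod (P k (b \<omega> * (\<xi> - \<omega>)) * of_real (b \<omega> ^ Suc k)) = cmod (P k (b \<omega> * (\<xi> - \<omega>))) * (b \<omega> ^ k * b \<omega>)"
    using b by (simp add: norm_mult norm_power)
  also have "\<dots> \<le> (4 * C\<^sup>2 * U \<omega> \<xi> powr - (2 * r)) * ((U \<omega> \<xi> powr 2 * b \<xi> ^ k) * b \<omega>)"
    using P_bound[OF assms, of "b \<omega> * (\<xi> - \<omega>)"] b bk unfolding U_eq
    by (intro mult_mono) auto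
  also have "\<dots> = (4 * C\<^sup>2 * b \<xi> ^ k * b \<omega>) * (U \<omega> \<xi> powr 2 * U \<omega> \<xi> powr - (2 * r))"
    by simp
  also have "U \<omega> \<xi> powr 2 * U \<omega> \<xi> powr - (2 * r) = U \<omega> \<xi> powr (2 - 2 * r)"
    using U_ge_1[of \<omega> \<xi>] by (simp only: powr_add[symmetric]) simp
  also have "(4 * C\<^sup>2 * b \<xi> ^ k * b \<omega>) * U \<omega> \<xi> powr (2 - 2 * r) \<le> (4 * C\<^sup>2 * b \<xi> ^ k * b \<omega>) * U \<omega> \<xi> powr - q"
    using U_ge_1[of \<omega> \<xi>] b r_ge q_gt_1 by (intro mult_left_mono powr_mono) auto
  finally show ?thesis by simp
qed

lemma M_integrand_measurable:
  assumes "k \<le> 2"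
  shows "(\<lambda>\<omega>. P k (b \<omega> * (\<xi> - \<omega>)) * of_real (b \<omega> ^ Suc k)) \<in> borel_measurable borel"
  using P_measurable[OF assms] by measurable

lemma M_integrable:
  assumes "k \<le> 2"
  shows "integrable lborel (\<lambda>\<omega>. P k (b \<omega> * (\<xi> - \<omega>)) * of_real (b \<omega> ^ Suc k))"
proof (rule Bochner_Integration.integrable_bound)
  show "integrable lborel (\<lambda>\<omega>. 4 * C\<^sup>2 * b \<xi> ^ k * (b \<omega> * U \<omega> \<xi> powr - q))"
    by (intro integrable_mult_right integrable_U_omega)
  show "AE \<omega> in lborel. norm (P k (b \<omega> * (\<xi> - \<omega>)) * of_real (b \<omega> ^ Suc k)) \<le> norm (4 * C\<^sup>2 * b \<xi> ^ k * (b \<omega> * U \<omega> \<xi> powr - q))"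
    using M_integrand_bound[OF assms] by (intro AE_I2) (auto intro: order_trans[OF _ abs_ge_self])
qed (use M_integrand_measurable[OF assms] in auto)

lemma M_bound:
  assumes "k \<le> 2"
  shows "cmod (M k \<xi>) \<le> 4 * C\<^sup>2 * B * b \<xi> ^ k"
proof -
  have "cmod (M k \<xi>) \<le> (LINT \<omega>|lborel. 4 * C\<^sup>2 * b \<xi> ^ k * (b \<omega> * U \<omega> \<xi> powr - q))"
    unfolding M_def
    by (rule order_trans[OF integral_norm_bound], rule integral_mono)
       (use M_integrand_bound[OF assms] M_integrable[OF assms] integrable_U_omega in auto)
  also have "\<dots> = 4 * C\<^sup>2 * b \<xi> ^ k * (LINT \<omega>|lborel. b \<omega> * U \<omega> \<xi> powr - q)" by simp
  also have "\<dots> \<le> 4 * C\<^sup>2 * b \<xi> ^ k * B"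
    using beta_pos[of \<alpha> \<xi>] by (intro mult_left_mono integral_U_omega) auto
  finally show ?thesis by (simp add: mult_ac)
qed

text \<open>Moving \<xi> by less than 1 changes \<open>U\<close> by at most the factor 2, because
  \<beta>(\<omega>) \<le> 1. The majorant thus depends only on the centre \<open>x0\<close> and
  serves both for differentiation under the integral and for continuity.\<close>

lemma M_integrand_local_bound:
  assumes k: "k \<le> 2" and x: "\<bar>x - x0\<bar> < 1"
  shows "cmod (P k (b \<omega> * (x - \<omega>)) * of_real (b \<omega> ^ Suc k)) \<le> 4 * C\<^sup>2 * 2 powr q * (b \<omega> * U \<omega> x0 powr - q)"
proof -
  have b: "0 < b \<omega>" "b \<omega> \<le> 1" "0 < b x" "b x \<le> 1" using \<alpha> by (auto simp: beta_pos beta_le_1)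
  have "\<bar>x0 - \<omega>\<bar> \<le> \<bar>x - \<omega>\<bar> + 1" using x by linarith
  then have "b \<omega> * \<bar>x0 - \<omega>\<bar> \<le> b \<omega> * (\<bar>x - \<omega>\<bar> + 1)" using b by (intro mult_left_mono) auto
  then have "U \<omega> x0 \<le> U \<omega> x + b \<omega>" by (simp add: U_def algebra_simps)
  then have "U \<omega> x0 \<le> 2 * U \<omega> x" using b U_ge_1[of \<omega> x] by linarith
  then have "U \<omega> x0 powr q \<le> (2 * U \<omega> x) powr q" using U_ge_1[of \<omega> x0] q_gt_1 by (intro powr_mono2) auto
  also have "\<dots> = 2 powr q * U \<omega> x powr q" using U_ge_1[of \<omega> x] by (intro powr_mult)
  finally have le: "U \<omega> x powr - q \<le> 2 powr q * U \<omega> x0 powr - q"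
    using U_ge_1[of \<omega> x] U_ge_1[of \<omega> x0] by (simp add: powr_minus field_simps)
  have "cmod (P k (b \<omega> * (x - \<omega>)) * of_real (b \<omega> ^ Suc k)) \<le> 4 * C\<^sup>2 * b x ^ k * (b \<omega> * U \<omega> x powr - q)"
    by (rule M_integrand_bound[OF k])
  also have "\<dots> \<le> 4 * C\<^sup>2 * 1 * (b \<omega> * (2 powr q * U \<omega> x0 powr - q))"
    using b le by (intro mult_mono mult_left_mono power_le_one) auto
  finally show ?thesis by (simp add: mult_ac)
qed

lemma M_deriv:
  assumes "k < 2"
  shows "(M k has_vector_derivative M (Suc k) x0) (at x0)"
  unfolding M_def
proof (rule leibniz_rule_lebesgue)
  show "((\<lambda>x. P k (b \<omega> * (x - \<omega>)) * of_real (b \<omega> ^ Suc k)) has_vector_derivative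
    P (Suc k) (b \<omega> * (x - \<omega>)) * of_real (b \<omega> ^ Suc (Suc k))) (at x)" for x \<omega>
  proof -
    have "((\<lambda>x. b \<omega> * (x - \<omega>)) has_real_derivative b \<omega>) (at x)" by (auto intro!: derivative_eq_intros)
    from has_vector_derivative_mult_left[OF vector_diff_chain_at[OF this[unfolded has_real_derivative_iff_has_vector_derivative] P_deriv[OF assms]], of "of_real (b \<omega> ^ Suc k)"]
    show ?thesis by (simp add: comp_def scaleR_conv_of_real mult_ac)
  qed
  show "integrable lborel (\<lambda>\<omega>. 4 * C\<^sup>2 * 2 powr q * (b \<omega> * U \<omega> x0 powr - q))"
    by (intro integrable_mult_right integrable_U_omega)
qed (use assms M_integrable M_integrand_local_bound[of "Suc k"] M_integrand_measurable[of "Suc k"] in auto)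

lemma M2_cont: "continuous_on UNIV (M 2)"
  unfolding M_def
proof (intro continuous_at_imp_continuous_on ballI isCont_parametric_integral)
  fix x0
  show "integrable lborel (\<lambda>\<omega>. 4 * C\<^sup>2 * 2 powr q * (b \<omega> * U \<omega> x0 powr - q))"
    by (intro integrable_mult_right integrable_U_omega)
  show "cmod (P 2 (b \<omega> * (x - \<omega>)) * of_real (b \<omega> ^ Suc 2)) \<le> 4 * C\<^sup>2 * 2 powr q * (b \<omega> * U \<omega> x0 powr - q)"
    if "\<bar>x - x0\<bar> < 1" for x \<omega>
    by (rule M_integrand_local_bound) (use that in auto)
  show "isCont (\<lambda>x. P 2 (b \<omega> * (x - \<omega>)) * of_real (b \<omega> ^ Suc 2)) x0" for \<omega>
  proof -
    have "continuous_on UNIV (\<lambda>x. P 2 (b \<omega> * (x - \<omega>)) * of_real (b \<omega> ^ Suc 2))"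
      by (intro continuous_intros continuous_on_compose2[OF P_cont[of 2]]) auto
    then show ?thesis unfolding continuous_on_eq_continuous_at[OF open_UNIV] by blast
  qed
qed (use M_integrand_measurable[of 2] in auto)

end

section \<open>Lower bound for the symbol and derivatives of its reciprocal\<close>

lemma has_vector_derivative_inverse_complex:
  fixes f :: "real \<Rightarrow> complex"
  assumes "(f has_vector_derivative f') (at x)" "f x \<noteq> 0"
  shows "((\<lambda>x. inverse (f x)) has_vector_derivative (- (f' * (inverse (f x))\<^sup>2))) (at x)"
proof -
  have "(inverse has_field_derivative - (inverse (f x))\<^sup>2) (at (f x))"
    using DERIV_inverse[OF assms(2)] by (simp add: numeral_2_eq_2)
  from field_vector_diff_chain_at[OF assms(1) this] show ?thesis by (simp add: comp_def)
qed

context wavelet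
begin

text \<open>\<beta>(y) R is at least of order R^(1 - \<alpha>) for |y| \<le> |\<xi>| + R, and this
  is unbounded because \<alpha> < 1. The two terms in the choice of \<open>R\<close> ensure 1 + |y|
  \<le> 2 R and R^(1 - \<alpha>) \<ge> 2 |T|.\<close>

lemma argument_large:
  "\<exists>R\<ge>0. b (\<xi> + R) * R \<ge> T \<and> b (\<xi> - R) * R \<ge> T"
proof -
  define R where "R = max (1 + \<bar>\<xi>\<bar>) ((2 * \<bar>T\<bar>) powr (1 / (1 - \<alpha>)))"
  have R: "R \<ge> 1 + \<bar>\<xi>\<bar>" "R \<ge> (2 * \<bar>T\<bar>) powr (1 / (1 - \<alpha>))" by (auto simp: R_def)
  have R1: "R \<ge> 1" using R(1) by linarith
  have "((2 * \<bar>T\<bar>) powr (1 / (1 - \<alpha>))) powr (1 - \<alpha>) \<le> R powr (1 - \<alpha>)"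
    using R \<alpha> by (intro powr_mono2) auto
  then have RT: "2 * \<bar>T\<bar> \<le> R powr (1 - \<alpha>)" using \<alpha> by (simp add: powr_powr)
  have *: "b y * R \<ge> T" if "\<bar>y\<bar> \<le> \<bar>\<xi>\<bar> + R" for y
  proof -
    have "(1 + \<bar>y\<bar>) powr \<alpha> \<le> (2 * R) powr \<alpha>" using that R \<alpha> by (intro powr_mono2) auto
    also have "\<dots> = 2 powr \<alpha> * R powr \<alpha>" using R1 by (simp add: powr_mult)
    also have "\<dots> \<le> 2 * R powr \<alpha>" using powr_mono[of \<alpha> 1 2] \<alpha> by (intro mult_right_mono) auto
    finally have 1: "(1 + \<bar>y\<bar>) powr \<alpha> \<le> 2 * R powr \<alpha>" .
    have "\<bar>T\<bar> * (1 + \<bar>y\<bar>) powr \<alpha> \<le> (R powr (1 - \<alpha>) / 2) * (2 * R powr \<alpha>)"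
      using RT 1 by (intro mult_mono) auto
    also have "\<dots> = R" using R1 by (simp add: powr_diff)
    finally have "\<bar>T\<bar> \<le> b y * R" by (simp add: beta_def powr_minus field_simps)
    then show ?thesis by linarith
  qed
  show ?thesis using R1 by (intro exI[of _ R] conjI *) auto
qed

text \<open>Intermediate value theorem between \<xi> - R and \<xi> + R. It allows
  \<open>m_lower\<close> to reach a prescribed argument of the generator from every \<xi>.\<close>

lemma argument_surj: "\<exists>\<omega>. b \<omega> * (\<xi> - \<omega>) = t"
proof -
  obtain R where R: "R \<ge> 0" "b (\<xi> + R) * R \<ge> \<bar>t\<bar>" "b (\<xi> - R) * R \<ge> \<bar>t\<bar>"
    using argument_large[of "\<bar>t\<bar>" \<xi>] by blast
  let ?f = "\<lambda>\<omega>. b \<omega> * (\<xi> - \<omega>)"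
  have c: "continuous_on {\<xi> - R..\<xi> + R} ?f"
    unfolding beta_def by (intro continuous_intros) auto
  have "?f (\<xi> + R) \<le> t" "t \<le> ?f (\<xi> - R)" using R by auto
  with IVT2'[of ?f "\<xi> + R" t "\<xi> - R"] c R(1) show ?thesis by fastforce
qed

definition m where "m \<xi> = (LINT \<omega>|lborel. (cmod (g 0 (b \<omega> * (\<xi> - \<omega>))))\<^sup>2 * b \<omega>)"

lemma M0_eq: "M 0 \<xi> = of_real (m \<xi>)"
  unfolding M_def m_def P_def integral_complex_of_real[symmetric]
  by (simp add: complex_norm_square[symmetric])

lemma m_integrable: "integrable lborel (\<lambda>\<omega>. (cmod (g 0 (b \<omega> * (\<xi> - \<omega>))))\<^sup>2 * b \<omega>)"
proof -
  have "integrable lborel (\<lambda>\<omega>. complex_of_real ((cmod (g 0 (b \<omega> * (\<xi> - \<omega>))))\<^sup>2 * b \<omega>))"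
    using M_integrable[of 0 \<xi>] by (simp add: P_def complex_norm_square[symmetric])
  then show ?thesis by (simp only: complex_of_real_integrable_eq)
qed

text \<open>For every \<xi> some \<omega>0 makes the argument equal to a fixed t0 at which the
  generator does not vanish. On an interval of length 2 \<delta> / \<beta>(\<omega>0) around
  \<omega>0 the integrand is at least h^2 \<beta>(\<omega>0) / 2. The scale cancels, so the bound
  h^2 \<delta> is uniform in \<xi>.\<close>

lemma m_lower: "\<exists>\<mu>>0. \<forall>\<xi>. m \<xi> \<ge> \<mu>"
proof -
  obtain t0 where t0: "g 0 t0 \<noteq> 0" using g_nonzero by blast
  define h where "h = cmod (g 0 t0) / 2"
  have h: "h > 0" using t0 by (simp add: h_def)
  have "isCont (\<lambda>t. cmod (g 0 t)) t0"
    using g_cont[of 0] by (auto simp: continuous_on_eq_continuous_at intro!: continuous_intros)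
  then obtain d where d: "d > 0" "\<And>t. \<bar>t - t0\<bar> < d \<Longrightarrow> \<bar>cmod (g 0 t) - cmod (g 0 t0)\<bar> < h"
    unfolding continuous_at_eps_delta using h by (auto simp: dist_real_def) 
  \<comment> \<open>The term 1/4 keeps the ratio of the dilations in [1/2, 3/2]; the other term
    keeps the displacement 2 \<delta> |t0| + 3/2 \<delta> of the argument below
    \<open>d\<close>.\<close>
  define \<delta> where "\<delta> = min (1/4) (d / (8 * (1 + \<bar>t0\<bar>)))"
  have \<delta>: "\<delta> > 0" "\<delta> \<le> 1/4"
    using d unfolding \<delta>_def by (auto simp: add_pos_nonneg simp del: distrib_left_numeral)
  have "\<delta> * (8 * (1 + \<bar>t0\<bar>)) \<le> d / (8 * (1 + \<bar>t0\<bar>)) * (8 * (1 + \<bar>t0\<bar>))"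
    by (intro mult_right_mono) (auto simp: \<delta>_def)
  also have "d / (8 * (1 + \<bar>t0\<bar>)) * (8 * (1 + \<bar>t0\<bar>)) = d"
  proof -
    have eq: "d / x * x = d" if "x \<noteq> 0" for x using that by simp
    have "8 * (1 + \<bar>t0\<bar>) > 0" using abs_ge_zero[of t0] by (intro mult_pos_pos) linarith+
    from eq[OF less_imp_neq[OF this, symmetric]] show ?thesis .
  qed
  finally have \<delta>d: "8 * \<delta> + 8 * (\<delta> * \<bar>t0\<bar>) \<le> d" by (simp add: algebra_simps)
  have "m \<xi> \<ge> h\<^sup>2 * \<delta>" for \<xi>
  proof -
    obtain \<omega>0 where \<omega>0: "b \<omega>0 * (\<xi> - \<omega>0) = t0" using argument_surj by blast
    have b0: "b \<omega>0 > 0" by (rule beta_pos)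
    define I where "I = {\<omega>0 - \<delta> / b \<omega>0 .. \<omega>0 + \<delta> / b \<omega>0}"
    have le: "h\<^sup>2 * (b \<omega>0 / 2) * indicator I \<omega> \<le> (cmod (g 0 (b \<omega> * (\<xi> - \<omega>))))\<^sup>2 * b \<omega>" for \<omega>
    proof (cases "\<omega> \<in> I")
      case True
      then have dist: "\<bar>\<omega> - \<omega>0\<bar> \<le> \<delta> / b \<omega>0" by (auto simp: I_def abs_le_iff)
      then have dist': "\<bar>\<omega> - \<omega>0\<bar> * b \<omega>0 \<le> \<delta>" using b0 by (simp add: field_simps)
      define \<rho> where "\<rho> = b \<omega> / b \<omega>0"
      have \<rho>: "\<bar>\<rho> - 1\<bar> \<le> 2 * \<delta>" unfolding \<rho>_def using beta_local[OF \<alpha> dist'] \<delta> by simp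
      then have \<rho>2: "\<rho> \<ge> 1/2" "\<rho> \<le> 3/2" using \<delta> by (auto simp: abs_le_iff)
      have b: "b \<omega> = \<rho> * b \<omega>0" using b0 by (simp add: \<rho>_def)
      \<comment> \<open>The argument is displaced for two reasons: the dilation changes, and the
        centre moves.\<close>
      have "b \<omega> * (\<xi> - \<omega>) - t0 = (\<rho> - 1) * t0 - \<rho> * ((\<omega> - \<omega>0) * b \<omega>0)"
        unfolding b \<omega>0[symmetric] by (simp add: algebra_simps)
      also have "\<bar>\<dots>\<bar> \<le> \<bar>\<rho> - 1\<bar> * \<bar>t0\<bar> + \<bar>\<rho>\<bar> * (\<bar>\<omega> - \<omega>0\<bar> * b \<omega>0)"
        using abs_triangle_ineq4[of "(\<rho> - 1) * t0" "\<rho> * ((\<omega> - \<omega>0) * b \<omega>0)"] b0 by (simp add: abs_mult)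
      also have "\<dots> \<le> (2 * \<delta>) * \<bar>t0\<bar> + (3/2) * \<delta>"
        using \<rho> \<rho>2 dist' \<delta> b0 by (intro add_mono mult_mono) auto
      also have "\<dots> < d"
      proof -
        have "0 \<le> \<delta> * \<bar>t0\<bar>" using \<delta> by simp
        moreover have "(2 * \<delta>) * \<bar>t0\<bar> = 2 * (\<delta> * \<bar>t0\<bar>)" by (simp only: mult.assoc)
        ultimately show ?thesis using \<delta>d \<delta> by linarith
      qed
      finally have "\<bar>b \<omega> * (\<xi> - \<omega>) - t0\<bar> < d" .
      from d(2)[OF this] have "cmod (g 0 (b \<omega> * (\<xi> - \<omega>))) \<ge> h" unfolding h_def by linarith
      then have "h\<^sup>2 \<le> (cmod (g 0 (b \<omega> * (\<xi> - \<omega>))))\<^sup>2" using h by (intro power_mono) auto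
      moreover have "b \<omega>0 / 2 \<le> b \<omega>" unfolding b using \<rho>2 b0 mult_right_mono[of "1/2" \<rho> "b \<omega>0"] by simp
      ultimately have "h\<^sup>2 * (b \<omega>0 / 2) \<le> (cmod (g 0 (b \<omega> * (\<xi> - \<omega>))))\<^sup>2 * b \<omega>"
        using b0 by (intro mult_mono) auto
      with True show ?thesis by simp
    next
      case False
      then show ?thesis using beta_pos[of \<alpha> \<omega>] by simp
    qed
    have fin: "emeasure lborel I < \<infinity>" by (simp add: I_def emeasure_lborel_Icc_eq)
    have "measure lborel I = 2 * (\<delta> / b \<omega>0)" using \<delta> b0 by (simp add: I_def)
    then have "h\<^sup>2 * \<delta> = h\<^sup>2 * (b \<omega>0 / 2) * measure lborel I" using b0 by simp
    also have "\<dots> = (LINT \<omega>|lborel. h\<^sup>2 * (b \<omega>0 / 2) * indicator I \<omega>)" using fin by (simp add: I_def)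
    also have "\<dots> \<le> m \<xi>"
      unfolding m_def using fin by (intro integral_mono m_integrable le integrable_mult_right integrable_real_indicator) (auto simp: I_def)
    finally show ?thesis .
  qed
  with h \<delta> show ?thesis by (intro exI[of _ "h\<^sup>2 * \<delta>"]) auto
qed

definition N :: "nat \<Rightarrow> real \<Rightarrow> complex" where
  "N k \<xi> = (if k = 0 then inverse (M 0 \<xi>)
     else if k = 1 then - (M 1 \<xi> * (inverse (M 0 \<xi>))\<^sup>2)
     else - (M 2 \<xi> * (inverse (M 0 \<xi>))\<^sup>2) + 2 * ((M 1 \<xi>)\<^sup>2 * (inverse (M 0 \<xi>))^3))"

lemma M0_nonzero: "M 0 \<xi> \<noteq> 0"
  using m_lower by (auto simp: M0_eq) (metis less_le_not_le)

lemma N0_real: "cnj (N 0 \<xi>) = N 0 \<xi>"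
  by (simp add: N_def M0_eq)

lemma N0_M0: "N 0 \<xi> * M 0 \<xi> = 1"
  using M0_nonzero[of \<xi>] by (simp add: N_def)

lemma N_deriv:
  assumes "k < 2"
  shows "(N k has_vector_derivative N (Suc k) \<xi>) (at \<xi>)"
proof -
  have M01: "(M 0 has_vector_derivative M 1 \<xi>) (at \<xi>)" "(M 1 has_vector_derivative M 2 \<xi>) (at \<xi>)"
    using M_deriv[of 0 \<xi>] M_deriv[of 1 \<xi>] by (auto simp: numeral_2_eq_2)
  note i = has_vector_derivative_inverse_complex[OF M01(1) M0_nonzero]
  consider "k = 0" | "k = 1" using assms by linarith
  then show ?thesis
  proof cases
    case 1
    with i show ?thesis by (simp add: N_def[abs_def])
  next
    case 2
    have "((\<lambda>\<xi>. - (M 1 \<xi> * (inverse (M 0 \<xi>) * inverse (M 0 \<xi>)))) has_vector_derivative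
      - (M 1 \<xi> * (inverse (M 0 \<xi>) * - (M 1 \<xi> * (inverse (M 0 \<xi>))\<^sup>2) + - (M 1 \<xi> * (inverse (M 0 \<xi>))\<^sup>2) * inverse (M 0 \<xi>)) + M 2 \<xi> * (inverse (M 0 \<xi>) * inverse (M 0 \<xi>)))) (at \<xi>)"
      by (intro has_vector_derivative_minus has_vector_derivative_mult M01 i)
    with 2 show ?thesis
      by (simp add: N_def[abs_def] power2_eq_square power3_eq_cube algebra_simps numeral_2_eq_2)
  qed
qed

lemma M_cont: "k \<le> 2 \<Longrightarrow> continuous_on UNIV (M k)"
  using M2_cont M_deriv[of k]
  by (cases "k = 2") (auto intro!: continuous_at_imp_continuous_on has_vector_derivative_continuous)

lemma N_cont: "k \<le> 2 \<Longrightarrow> continuous_on UNIV (N k)"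
  unfolding N_def[abs_def] using M_cont[of 0] M_cont[of 1] M_cont[of 2] M0_nonzero
  by (cases "k = 0"; cases "k = 1") (auto intro!: continuous_intros)

text \<open>Every summand of \<open>N k\<close> contains derivatives of the symbol of total order
  \<open>k\<close>, which supply the power of \<beta>(\<xi>), while the reciprocal of
  \<open>M 0\<close> is bounded by 1/\<mu>. \<open>K\<close> dominates the constants of all three
  orders.\<close>

lemma N_bound: "\<exists>K\<ge>0. \<forall>k\<le>2. \<forall>\<xi>. cmod (N k \<xi>) \<le> K * b \<xi> ^ k"
proof -
  obtain \<mu> where \<mu>: "\<mu> > 0" "\<And>\<xi>. m \<xi> \<ge> \<mu>" using m_lower by blast
  define L where "L = 4 * C\<^sup>2 * B"
  have L: "L \<ge> 0" by (simp add: L_def B_nonneg)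
  have i: "cmod (inverse (M 0 \<xi>)) \<le> inverse \<mu>" for \<xi>
    using \<mu>(1) \<mu>(2)[of \<xi>] by (simp add: M0_eq norm_inverse del: of_real_inverse) 
  have Mb: "cmod (M k \<xi>) \<le> L * b \<xi> ^ k" if "k \<le> 2" for k \<xi>
    using M_bound[OF that] by (simp add: L_def)
  let ?v = "inverse \<mu>"
  have v: "?v > 0" using \<mu> by simp
  have i2: "cmod (inverse (M 0 \<xi>)) ^ j \<le> ?v ^ j" for \<xi> j
    using i by (intro power_mono) auto
  define K where "K = ?v + L * ?v\<^sup>2 + 2 * (L\<^sup>2 * ?v ^ 3)"
  have "cmod (N k \<xi>) \<le> K * b \<xi> ^ k" if k: "k \<le> 2" for k \<xi>
  proof -
    have b: "b \<xi> > 0" by (rule beta_pos)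
    have 1: "cmod (M k \<xi>) * cmod (inverse (M 0 \<xi>)) ^ 2 \<le> (L * ?v ^ 2) * b \<xi> ^ k" if "k \<le> 2" for k
      using mult_mono[OF Mb[OF that, of \<xi>] i2[of \<xi> 2]] L b by (simp add: mult_ac)
    have 2: "cmod (M 1 \<xi>) ^ 2 * cmod (inverse (M 0 \<xi>)) ^ 3 \<le> (L\<^sup>2 * ?v ^ 3) * b \<xi> ^ 2"
    proof -
      have "cmod (M 1 \<xi>) ^ 2 \<le> (L * b \<xi> ^ 1) ^ 2" by (intro power_mono Mb) auto
      from mult_mono[OF this i2[of \<xi> 3]] L b show ?thesis by (simp add: mult_ac power_mult_distrib)
    qed
    have K: "?v \<le> K" "L * ?v\<^sup>2 \<le> K" "L * ?v\<^sup>2 + 2 * (L\<^sup>2 * ?v ^ 3) \<le> K"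
      using v L by (auto simp: K_def)
    consider "k = 0" | "k = 1" | "k = 2" using k by linarith
    then show ?thesis
    proof cases
      case 1
      then show ?thesis using i[of \<xi>] K(1) by (simp add: N_def del: inverse_eq_divide)
    next
      case c: 2
      then have "cmod (N k \<xi>) = cmod (M 1 \<xi>) * cmod (inverse (M 0 \<xi>)) ^ 2"
        by (simp add: N_def norm_mult norm_power)
      also have "\<dots> \<le> (L * ?v ^ 2) * b \<xi> ^ 1" by (rule 1) simp
      also have "\<dots> \<le> K * b \<xi> ^ 1" using K b by (intro mult_right_mono) auto
      finally show ?thesis using c by simp
    next
      case c: 3
      then have Nk: "N k \<xi> = - (M 2 \<xi> * (inverse (M 0 \<xi>))\<^sup>2) + 2 * ((M 1 \<xi>)\<^sup>2 * (inverse (M 0 \<xi>))^3)"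
        by (simp add: N_def)
      have "cmod (N k \<xi>) \<le> cmod (- (M 2 \<xi> * (inverse (M 0 \<xi>))\<^sup>2)) + cmod (2 * ((M 1 \<xi>)\<^sup>2 * (inverse (M 0 \<xi>))^3))"
        unfolding Nk by (rule norm_triangle_ineq)
      also have "\<dots> = cmod (M 2 \<xi>) * cmod (inverse (M 0 \<xi>)) ^ 2 + 2 * (cmod (M 1 \<xi>) ^ 2 * cmod (inverse (M 0 \<xi>)) ^ 3)"
        by (simp add: norm_mult norm_power)
      also have "\<dots> \<le> (L * ?v ^ 2) * b \<xi> ^ 2 + 2 * ((L\<^sup>2 * ?v ^ 3) * b \<xi> ^ 2)"
        using 1[of 2] 2 by (intro add_mono mult_left_mono) auto
      also have "\<dots> = (L * ?v\<^sup>2 + 2 * (L\<^sup>2 * ?v ^ 3)) * b \<xi> ^ 2" by (simp add: algebra_simps)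
      also have "\<dots> \<le> K * b \<xi> ^ 2" using K b by (intro mult_right_mono) auto
      finally show ?thesis using c by simp
    qed
  qed
  moreover have "K \<ge> 0" using v L by (simp add: K_def)
  ultimately show ?thesis by blast
qed

end

section \<open>Decay of the kernel\<close>

text \<open>Families of functions are indexed by the order of the derivative, so \<open>prod3 X Y Z k\<close> is the
  \<open>k\<close>-th derivative of \<open>X 0 * Y 0 * Z 0\<close> for $k \le 2$.\<close>

definition prod3 :: "(nat \<Rightarrow> real \<Rightarrow> complex) \<Rightarrow> (nat \<Rightarrow> real \<Rightarrow> complex) \<Rightarrow> (nat \<Rightarrow> real \<Rightarrow> complex) \<Rightarrow> nat \<Rightarrow> real \<Rightarrow> complex" where
  "prod3 X Y Z k t =
     (if k = 0 then X 0 t * Y 0 t * Z 0 t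
      else if k = 1 then X 1 t * Y 0 t * Z 0 t + X 0 t * Y 1 t * Z 0 t + X 0 t * Y 0 t * Z 1 t
      else X 2 t * Y 0 t * Z 0 t + X 0 t * Y 2 t * Z 0 t + X 0 t * Y 0 t * Z 2 t
        + 2 * (X 1 t * Y 1 t * Z 0 t + X 1 t * Y 0 t * Z 1 t + X 0 t * Y 1 t * Z 1 t))"

lemma prod3_deriv:
  assumes "\<And>k t. k < 2 \<Longrightarrow> (X k has_vector_derivative X (Suc k) t) (at t)"
    "\<And>k t. k < 2 \<Longrightarrow> (Y k has_vector_derivative Y (Suc k) t) (at t)"
    "\<And>k t. k < 2 \<Longrightarrow> (Z k has_vector_derivative Z (Suc k) t) (at t)" "k < 2"
  shows "(prod3 X Y Z k has_vector_derivative prod3 X Y Z (Suc k) t) (at t)"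
proof -
  have d: "(X 0 has_vector_derivative X 1 t) (at t)" "(X 1 has_vector_derivative X 2 t) (at t)"
    "(Y 0 has_vector_derivative Y 1 t) (at t)" "(Y 1 has_vector_derivative Y 2 t) (at t)"
    "(Z 0 has_vector_derivative Z 1 t) (at t)" "(Z 1 has_vector_derivative Z 2 t) (at t)"
    using assms(1)[of 0 t] assms(1)[of 1 t] assms(2)[of 0 t] assms(2)[of 1 t] assms(3)[of 0 t] assms(3)[of 1 t]
    by (auto simp: numeral_2_eq_2)
  consider "k = 0" | "k = 1" using assms(4) by linarith
  then show ?thesis
  proof cases
    case 1
    have "((\<lambda>t. X 0 t * Y 0 t * Z 0 t) has_vector_derivative
      X 0 t * Y 0 t * Z 1 t + (X 0 t * Y 1 t + X 1 t * Y 0 t) * Z 0 t) (at t)"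
      by (intro has_vector_derivative_mult d)
    with 1 show ?thesis by (simp add: prod3_def[abs_def] algebra_simps)
  next
    case 2
    have "((\<lambda>t. X 1 t * Y 0 t * Z 0 t + X 0 t * Y 1 t * Z 0 t + X 0 t * Y 0 t * Z 1 t) has_vector_derivative
      (X 1 t * Y 0 t * Z 1 t + (X 1 t * Y 1 t + X 2 t * Y 0 t) * Z 0 t)
      + (X 0 t * Y 1 t * Z 1 t + (X 0 t * Y 2 t + X 1 t * Y 1 t) * Z 0 t)
      + (X 0 t * Y 0 t * Z 2 t + (X 0 t * Y 1 t + X 1 t * Y 0 t) * Z 1 t)) (at t)"
      by (intro has_vector_derivative_add has_vector_derivative_mult d)
    with 2 show ?thesis by (simp add: prod3_def[abs_def] algebra_simps numeral_2_eq_2)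
  qed
qed

lemma prod3_cont:
  assumes "\<And>k. k \<le> 2 \<Longrightarrow> continuous_on UNIV (X k)" "\<And>k. k \<le> 2 \<Longrightarrow> continuous_on UNIV (Y k)"
    "\<And>k. k \<le> 2 \<Longrightarrow> continuous_on UNIV (Z k)"
  shows "continuous_on UNIV (prod3 X Y Z k)"
  unfolding prod3_def[abs_def] by (cases "k = 0"; cases "k = 1") (auto intro!: continuous_intros assms)

text \<open>If differentiating the three factors costs p, q and r per order, the Leibniz formula
  adds up to the trinomial expansion of (p + q + r)^k.\<close>

lemma prod3_bound:
  assumes X: "\<And>k. k \<le> 2 \<Longrightarrow> cmod (X k t) \<le> x * p ^ k" and Y: "\<And>k. k \<le> 2 \<Longrightarrow> cmod (Y k t) \<le> y * q ^ k"
    and Z: "\<And>k. k \<le> 2 \<Longrightarrow> cmod (Z k t) \<le> z * r ^ k" and nn: "0 \<le> x" "0 \<le> y" "0 \<le> z" "0 \<le> p" "0 \<le> q" "0 \<le> r" and k: "k \<le> 2"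
  shows "cmod (prod3 X Y Z k t) \<le> x * y * z * (p + q + r) ^ k"
proof -
  have t: "cmod (X i t * Y j t * Z l t) \<le> x * y * z * (p ^ i * q ^ j * r ^ l)" if "i \<le> 2" "j \<le> 2" "l \<le> 2" for i j l
  proof -
    have "cmod (X i t * Y j t * Z l t) \<le> (x * p ^ i) * (y * q ^ j) * (z * r ^ l)"
      unfolding norm_mult using that nn by (intro mult_mono X Y Z) auto
    then show ?thesis by (simp add: mult_ac)
  qed
  let ?W = "x * y * z"
  consider "k = 0" | "k = 1" | "k = 2" using k by linarith
  then show ?thesis
  proof cases
    case 1 then show ?thesis using t[of 0 0 0] by (simp add: prod3_def)
  next
    case 2
    then have "cmod (prod3 X Y Z k t) \<le> cmod (X 1 t * Y 0 t * Z 0 t) + cmod (X 0 t * Y 1 t * Z 0 t) + cmod (X 0 t * Y 0 t * Z 1 t)"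
      unfolding prod3_def by (auto intro!: norm_triangle_mono)
    also have "\<dots> \<le> ?W * (p ^ 1 * q ^ 0 * r ^ 0) + ?W * (p ^ 0 * q ^ 1 * r ^ 0) + ?W * (p ^ 0 * q ^ 0 * r ^ 1)"
      by (intro add_mono t) auto
    finally show ?thesis using 2 by (simp add: algebra_simps)
  next
    case 3
    have "cmod (prod3 X Y Z k t) = cmod (X 2 t * Y 0 t * Z 0 t + X 0 t * Y 2 t * Z 0 t + X 0 t * Y 0 t * Z 2 t
        + 2 * (X 1 t * Y 1 t * Z 0 t + X 1 t * Y 0 t * Z 1 t + X 0 t * Y 1 t * Z 1 t))"
      using 3 by (simp add: prod3_def)
    also have "\<dots> \<le> cmod (X 2 t * Y 0 t * Z 0 t) + cmod (X 0 t * Y 2 t * Z 0 t) + cmod (X 0 t * Y 0 t * Z 2 t)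
        + cmod (2 * (X 1 t * Y 1 t * Z 0 t + X 1 t * Y 0 t * Z 1 t + X 0 t * Y 1 t * Z 1 t))"
      by (intro norm_triangle_mono order_refl)
    also have "cmod (2 * (X 1 t * Y 1 t * Z 0 t + X 1 t * Y 0 t * Z 1 t + X 0 t * Y 1 t * Z 1 t))
       = 2 * cmod (X 1 t * Y 1 t * Z 0 t + X 1 t * Y 0 t * Z 1 t + X 0 t * Y 1 t * Z 1 t)"
      by (simp only: norm_mult) simp
    also have "cmod (X 2 t * Y 0 t * Z 0 t) + cmod (X 0 t * Y 2 t * Z 0 t) + cmod (X 0 t * Y 0 t * Z 2 t) + 2 * cmod (X 1 t * Y 1 t * Z 0 t + X 1 t * Y 0 t * Z 1 t + X 0 t * Y 1 t * Z 1 t) \<le>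
      ?W * (p ^ 2 * q ^ 0 * r ^ 0) + ?W * (p ^ 0 * q ^ 2 * r ^ 0) + ?W * (p ^ 0 * q ^ 0 * r ^ 2) +
      2 * (?W * (p ^ 1 * q ^ 1 * r ^ 0) + ?W * (p ^ 1 * q ^ 0 * r ^ 1) + ?W * (p ^ 0 * q ^ 1 * r ^ 1))"
      by (intro add_mono mult_left_mono norm_triangle_mono t) auto
    finally show ?thesis using 3 by (simp add: power2_eq_square algebra_simps)
  qed
qed

context wavelet
begin

definition scaled :: "real \<Rightarrow> (nat \<Rightarrow> real \<Rightarrow> complex) \<Rightarrow> nat \<Rightarrow> real \<Rightarrow> complex" where
  "scaled \<omega> u k \<xi> = u k (b \<omega> * (\<xi> - \<omega>)) * of_real (b \<omega> ^ k)"

lemma scaled_deriv: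
  assumes "\<And>t. (u k has_vector_derivative u (Suc k) t) (at t)"
  shows "(scaled \<omega> u k has_vector_derivative scaled \<omega> u (Suc k) \<xi>) (at \<xi>)"
proof -
  have "((\<lambda>x. b \<omega> * (x - \<omega>)) has_real_derivative b \<omega>) (at \<xi>)" by (auto intro!: derivative_eq_intros)
  from has_vector_derivative_mult_left[OF vector_diff_chain_at[OF this[unfolded has_real_derivative_iff_has_vector_derivative] assms], of "of_real (b \<omega> ^ k)"]
  show ?thesis by (simp add: scaled_def[abs_def] comp_def scaleR_conv_of_real mult_ac)
qed

lemma scaled_cont:
  assumes "continuous_on UNIV (u k)"
  shows "continuous_on UNIV (scaled \<omega> u k)"
  unfolding scaled_def[abs_def]
  by (intro continuous_intros continuous_on_compose2[OF assms]) auto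

lemma scaled_bound:
  assumes "\<And>t. cmod (u k t) \<le> D * (1 + \<bar>t\<bar>) powr - e"
  shows "cmod (scaled \<omega> u k \<xi>) \<le> (D * U \<omega> \<xi> powr - e) * b \<omega> ^ k"
proof -
  have "cmod (scaled \<omega> u k \<xi>) = cmod (u k (b \<omega> * (\<xi> - \<omega>))) * b \<omega> ^ k"
    using beta_pos[of \<alpha> \<omega>] by (simp add: scaled_def norm_mult norm_power)
  also have "\<dots> \<le> (D * U \<omega> \<xi> powr - e) * b \<omega> ^ k"
    using assms[of "b \<omega> * (\<xi> - \<omega>)"] beta_pos[of \<alpha> \<omega>] unfolding U_eq by (intro mult_right_mono) auto
  finally show ?thesis .
qed

text \<open>Fixed by \<open>SOME\<close> so that later constants of the locale, such as
  \<open>K0\<close>, can refer to it.\<close>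

definition KN where "KN = (SOME K. K \<ge> 0 \<and> (\<forall>k\<le>2. \<forall>\<xi>. cmod (N k \<xi>) \<le> K * b \<xi> ^ k))"

lemma KN: "KN \<ge> 0" "k \<le> 2 \<Longrightarrow> cmod (N k \<xi>) \<le> KN * b \<xi> ^ k"
  using someI_ex[OF N_bound] unfolding KN_def by blast+

text \<open>The family \<open>v\<close> is left open because three are inserted: the conjugates of
  \<open>g\<close> for the kernel, their difference to the perturbed copies for the oscillation, and
  \<open>unit_seq\<close> for the dual functions. The normalising factors and the phase stay
  outside.\<close>

definition integrand :: "real \<Rightarrow> real \<Rightarrow> (nat \<Rightarrow> real \<Rightarrow> complex) \<Rightarrow> nat \<Rightarrow> real \<Rightarrow> complex" where
  "integrand \<omega> \<omega>' v = prod3 (scaled \<omega> g) N (scaled \<omega>' v)"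

definition decaying :: "(nat \<Rightarrow> real \<Rightarrow> complex) \<Rightarrow> real \<Rightarrow> real \<Rightarrow> bool" where
  "decaying v D e \<longleftrightarrow> D \<ge> 0 \<and> e \<ge> 0 \<and> (\<forall>k<2. \<forall>t. (v k has_vector_derivative v (Suc k) t) (at t)) \<and>
     continuous_on UNIV (v 2) \<and> (\<forall>k\<le>2. \<forall>t. cmod (v k t) \<le> D * (1 + \<bar>t\<bar>) powr - e)"

lemma decaying_cont:
  assumes "decaying v D e" "k \<le> 2"
  shows "continuous_on UNIV (v k)"
proof (cases "k = 2")
  case False
  then have "(v k has_vector_derivative v (Suc k) t) (at t)" for t using assms by (auto simp: decaying_def)
  then show ?thesis
    by (intro continuous_at_imp_continuous_on ballI) (rule has_vector_derivative_continuous)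
qed (use assms in \<open>auto simp: decaying_def\<close>)

lemma integrand_deriv:
  assumes "decaying v D e" "k < 2"
  shows "(integrand \<omega> \<omega>' v k has_vector_derivative integrand \<omega> \<omega>' v (Suc k) \<xi>) (at \<xi>)"
  unfolding integrand_def
  by (rule prod3_deriv) (use assms in \<open>auto intro!: scaled_deriv N_deriv g_deriv simp: decaying_def\<close>)

lemma integrand_cont:
  assumes "decaying v D e"
  shows "continuous_on UNIV (integrand \<omega> \<omega>' v k)"
  unfolding integrand_def
  by (rule prod3_cont) (use assms in \<open>auto intro!: scaled_cont N_cont g_cont decaying_cont\<close>)

lemma integrand_bound:
  assumes "decaying v D e" "k \<le> 2"
  shows "cmod (integrand \<omega> \<omega>' v k \<xi>) \<le> C * KN * D * (U \<omega> \<xi> powr - r * U \<omega>' \<xi> powr - e) * (b \<omega> + b \<xi> + b \<omega>') ^ k"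
proof -
  have "cmod (integrand \<omega> \<omega>' v k \<xi>) \<le> (C * U \<omega> \<xi> powr - r) * KN * (D * U \<omega>' \<xi> powr - e) * (b \<omega> + b \<xi> + b \<omega>') ^ k"
    unfolding integrand_def
  proof (rule prod3_bound)
    show "cmod (scaled \<omega> g k \<xi>) \<le> (C * U \<omega> \<xi> powr - r) * b \<omega> ^ k" if "k \<le> 2" for k
      using that by (intro scaled_bound g_bound) auto
    show "cmod (scaled \<omega>' v k \<xi>) \<le> (D * U \<omega>' \<xi> powr - e) * b \<omega>' ^ k" if "k \<le> 2" for k
      using that assms by (intro scaled_bound) (auto simp: decaying_def)
  qed (use KN C assms beta_pos[of \<alpha>] in \<open>auto simp: decaying_def less_imp_le\<close>)
  then show ?thesis by (simp add: mult_ac)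
qed

lemma U_tendsto: "((\<lambda>\<xi>. U \<omega> \<xi> powr - r) \<longlongrightarrow> 0) at_top" "((\<lambda>\<xi>. U \<omega> \<xi> powr - r) \<longlongrightarrow> 0) at_bot"
proof -
  have 1: "filterlim (\<lambda>\<xi>. \<bar>\<xi> - \<omega>\<bar>) at_top at_top"
    by (rule filterlim_at_top_mono[OF filterlim_tendsto_add_at_top[OF tendsto_const[of "-\<omega>"] filterlim_ident]])
       (auto intro!: always_eventually)
  have 2: "filterlim (\<lambda>\<xi>. \<bar>\<xi> - \<omega>\<bar>) at_top at_bot"
    by (rule filterlim_at_top_mono[OF filterlim_tendsto_add_at_top[OF tendsto_const[of "\<omega>"] filterlim_uminus_at_top_at_bot]])
       (auto intro!: always_eventually)
  have *: "((\<lambda>\<xi>. U \<omega> \<xi> powr - r) \<longlongrightarrow> 0) F" if "filterlim (\<lambda>\<xi>. \<bar>\<xi> - \<omega>\<bar>) at_top F" for F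
    unfolding U_def using r_ge beta_pos[of \<alpha> \<omega>] that
    by (intro tendsto_neg_powr filterlim_tendsto_add_at_top[OF tendsto_const] filterlim_tendsto_pos_mult_at_top[OF tendsto_const]) auto
  from *[OF 1] *[OF 2] show "((\<lambda>\<xi>. U \<omega> \<xi> powr - r) \<longlongrightarrow> 0) at_top" "((\<lambda>\<xi>. U \<omega> \<xi> powr - r) \<longlongrightarrow> 0) at_bot" by auto
qed

lemma U_powr_le_1: "e \<ge> 0 \<Longrightarrow> U \<omega> \<xi> powr - e \<le> 1"
  using U_ge_1[of \<omega> \<xi>] by (simp add: powr_minus inverse_le_1_iff ge_one_powr_ge_zero)

text \<open>A coarse bound that keeps the decay of the first generator only; 9 = 3^2, each dilation
  being at most 1. It provides integrability and the vanishing boundary terms, and it covers the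
  case \<open>e\<close> = 0 of \<open>unit_seq\<close>.\<close>

lemma integrand_bound_simple:
  assumes "decaying v D e" "k \<le> 2"
  shows "cmod (integrand \<omega> \<omega>' v k \<xi>) \<le> 9 * C * KN * D * U \<omega> \<xi> powr - r"
proof -
  have D: "D \<ge> 0" "e \<ge> 0" using assms by (auto simp: decaying_def)
  have "(b \<omega> + b \<xi> + b \<omega>') ^ k \<le> 3 ^ k"
    using beta_le_1[OF \<alpha>(1), of \<omega>] beta_le_1[OF \<alpha>(1), of \<xi>] beta_le_1[OF \<alpha>(1), of \<omega>']
      beta_pos[of \<alpha> \<omega>] beta_pos[of \<alpha> \<xi>] beta_pos[of \<alpha> \<omega>']
    by (intro power_mono) linarith+
  also have "\<dots> \<le> (3::real) ^ 2" using assms(2) by (intro power_increasing) auto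
  finally have 1: "(b \<omega> + b \<xi> + b \<omega>') ^ k \<le> 9" by simp
  have "cmod (integrand \<omega> \<omega>' v k \<xi>) \<le> C * KN * D * (U \<omega> \<xi> powr - r * U \<omega>' \<xi> powr - e) * (b \<omega> + b \<xi> + b \<omega>') ^ k"
    by (rule integrand_bound[OF assms])
  also have "\<dots> \<le> C * KN * D * (U \<omega> \<xi> powr - r * 1) * 9"
    using C KN D beta_pos[of \<alpha>] 1 U_powr_le_1[OF D(2)]
    by (intro mult_mono mult_left_mono) (auto intro!: mult_nonneg_nonneg add_nonneg_nonneg zero_le_power simp: less_imp_le)
  finally show ?thesis by simp
qed

lemma integrand_integrable:
  assumes "decaying v D e" "k \<le> 2"
  shows "integrable lborel (integrand \<omega> \<omega>' v k)"
proof (rule Bochner_Integration.integrable_bound)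
  show "integrable lborel (\<lambda>\<xi>. 9 * C * KN * D * U \<omega> \<xi> powr - r)"
    using r_ge by (intro integrable_mult_right integrable_U_xi) auto
  show "AE \<xi> in lborel. norm (integrand \<omega> \<omega>' v k \<xi>) \<le> norm (9 * C * KN * D * U \<omega> \<xi> powr - r)"
    using integrand_bound_simple[OF assms] by (intro AE_I2) (auto intro: order_trans[OF _ abs_ge_self])
  show "integrand \<omega> \<omega>' v k \<in> borel_measurable lborel"
    using integrand_cont[OF assms(1)] by (simp add: borel_measurable_continuous_onI)
qed

lemma integrand_tendsto:
  assumes "decaying v D e" "k \<le> 2"
  shows "(integrand \<omega> \<omega>' v k \<longlongrightarrow> 0) at_top" "(integrand \<omega> \<omega>' v k \<longlongrightarrow> 0) at_bot"
proof -
  have *: "(integrand \<omega> \<omega>' v k \<longlongrightarrow> 0) F" if "((\<lambda>\<xi>. U \<omega> \<xi> powr - r) \<longlongrightarrow> 0) F" for F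
  proof (rule Lim_null_comparison)
    show "\<forall>\<^sub>F \<xi> in F. norm (integrand \<omega> \<omega>' v k \<xi>) \<le> 9 * C * KN * D * U \<omega> \<xi> powr - r"
      using integrand_bound_simple[OF assms] by (intro always_eventually) auto
    show "((\<lambda>\<xi>. 9 * C * KN * D * U \<omega> \<xi> powr - r) \<longlongrightarrow> 0) F"
      using tendsto_mult_left[OF that, of "9 * C * KN * D"] by simp
  qed
  from *[OF U_tendsto(1)] *[OF U_tendsto(2)]
  show "(integrand \<omega> \<omega>' v k \<longlongrightarrow> 0) at_top" "(integrand \<omega> \<omega>' v k \<longlongrightarrow> 0) at_bot" by auto
qed

lemma ifourier_integrand_decay:
  assumes "decaying v D e"
  shows "x\<^sup>2 * cmod (ifourier (integrand \<omega> \<omega>' v 0) x) \<le> (LINT \<xi>|lborel. cmod (integrand \<omega> \<omega>' v 2 \<xi>))"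
  by (rule ifourier_decay[where f'="integrand \<omega> \<omega>' v 1"])
     (use assms integrand_deriv[of v D e 0] integrand_deriv[of v D e 1] in
      \<open>auto intro!: integrand_cont integrand_integrable integrand_tendsto simp: numeral_2_eq_2\<close>)


section \<open>The exponents, the common scale and the majorant of the kernel\<close>

definition p where "p = \<alpha> / (1 - \<alpha>)"

text \<open>The decay left when the comparison of the scales has been paid but the weight has not;
  the weight takes another s/(1 - \<alpha>) and leaves \<open>q\<close>, see
  \<open>e1_eq\<close>.\<close>

definition e1 where "e1 = r - 1 - p"

lemma p_nonneg: "p \<ge> 0" using \<alpha> by (simp add: p_def)

lemma e1_eq: "e1 = q + s / (1 - \<alpha>)"
  using \<alpha> by (simp add: e1_def q_def p_def add_divide_distrib)

lemma e1_gt_1: "e1 > 1"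
proof -
  have "s / (1 - \<alpha>) \<ge> 0" using \<alpha> s by simp
  with q_gt_1 show ?thesis by (simp add: e1_eq)
qed

definition UU where "UU \<omega> \<omega>' \<xi> = U \<omega> \<xi> * U \<omega>' \<xi>"

lemma UU_ge_1: "UU \<omega> \<omega>' \<xi> \<ge> 1"
  using mult_mono[OF U_ge_1 U_ge_1, of \<omega> \<xi> \<omega>' \<xi>] U_ge_1[of \<omega> \<xi>] by (simp add: UU_def)

lemma UU_commute: "UU \<omega> \<omega>' = UU \<omega>' \<omega>"
  by (simp add: UU_def fun_eq_iff mult.commute)

lemma UU_measurable [measurable (raw)]:
  assumes [measurable]: "f \<in> borel_measurable A" "f' \<in> borel_measurable A" "h \<in> borel_measurable A"
  shows "(\<lambda>x. UU (f x) (f' x) (h x)) \<in> borel_measurable A"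
  unfolding UU_def U_def by measurable

text \<open>The second derivative of the integrand brings the square of \<beta>(\<omega>) +
  \<beta>(\<xi>) + \<beta>(\<omega>'), whereas decay at scale S calls for \<beta>(\<omega>)
  \<beta>(\<omega>'). All exchanges pass through \<xi>, each side costing a power \<open>p\<close>
  of its own \<open>U\<close>.\<close>

lemma beta_sq_bounds:
  "b \<omega> ^ 2 \<le> 4 powr p * UU \<omega> \<omega>' \<xi> powr p * (b \<omega> * b \<omega>')"
  "b \<omega>' ^ 2 \<le> 4 powr p * UU \<omega> \<omega>' \<xi> powr p * (b \<omega> * b \<omega>')"
  "b \<xi> ^ 2 \<le> 4 powr p * UU \<omega> \<omega>' \<xi> powr p * (b \<omega> * b \<omega>')"
proof -
  have four: "4 powr p = 2 powr p * 2 powr p" by (simp flip: powr_mult)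
  have UU: "UU \<omega> \<omega>' \<xi> powr p = U \<omega> \<xi> powr p * U \<omega>' \<xi> powr p"
    using U_ge_1[of \<omega> \<xi>] U_ge_1[of \<omega>' \<xi>] by (simp add: UU_def powr_mult)
  have l: "b \<xi> \<le> 2 powr p * U \<omega> \<xi> powr p * b \<omega>" for \<omega>
    using beta_lower[OF \<alpha>, of \<xi> \<omega>] by (simp add: p_def U_def)
  have l': "b \<omega> \<le> 2 powr p * U \<omega> \<xi> powr p * b \<xi>" for \<omega>
    using beta_lower'[OF \<alpha>, of \<omega> \<xi>] by (simp add: p_def U_def)
  have bp: "b x > 0" for x by (rule beta_pos)
  have ll: "b \<omega> \<le> 4 powr p * (U \<omega> \<xi> powr p * U \<omega>' \<xi> powr p) * b \<omega>'" for \<omega> \<omega>'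
  proof -
    have "b \<omega> \<le> 2 powr p * U \<omega> \<xi> powr p * b \<xi>" by (rule l')
    also have "\<dots> \<le> 2 powr p * U \<omega> \<xi> powr p * (2 powr p * U \<omega>' \<xi> powr p * b \<omega>')"
      by (intro mult_left_mono l) auto
    finally show ?thesis by (simp add: four mult_ac)
  qed
  show "b \<omega> ^ 2 \<le> 4 powr p * UU \<omega> \<omega>' \<xi> powr p * (b \<omega> * b \<omega>')"
    using mult_left_mono[OF ll[of \<omega> \<omega>'], of "b \<omega>"] bp[of \<omega>] by (simp add: UU power2_eq_square mult_ac)
  show "b \<omega>' ^ 2 \<le> 4 powr p * UU \<omega> \<omega>' \<xi> powr p * (b \<omega> * b \<omega>')"
    using mult_left_mono[OF ll[of \<omega>' \<omega>], of "b \<omega>'"] bp[of \<omega>'] by (simp add: UU power2_eq_square mult_ac)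
  show "b \<xi> ^ 2 \<le> 4 powr p * UU \<omega> \<omega>' \<xi> powr p * (b \<omega> * b \<omega>')"
    using mult_mono[OF l[of \<omega>] l[of \<omega>']] bp[of \<xi>] bp[of \<omega>] by (simp add: UU four power2_eq_square mult_ac)
qed

definition T where "T \<omega> \<omega>' = (LINT \<xi>|lborel. UU \<omega> \<omega>' \<xi> powr - e1)"

lemma T_integrable: "integrable lborel (\<lambda>\<xi>. UU \<omega> \<omega>' \<xi> powr - e1)"
proof (rule Bochner_Integration.integrable_bound)
  show "integrable lborel (\<lambda>\<xi>. U \<omega> \<xi> powr - e1)" by (rule integrable_U_xi[OF e1_gt_1])
  show "AE \<xi> in lborel. norm (UU \<omega> \<omega>' \<xi> powr - e1) \<le> norm (U \<omega> \<xi> powr - e1)"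
  proof (rule AE_I2)
    fix \<xi>
    have "UU \<omega> \<omega>' \<xi> powr - e1 = U \<omega> \<xi> powr - e1 * U \<omega>' \<xi> powr - e1"
      using U_ge_1[of \<omega> \<xi>] U_ge_1[of \<omega>' \<xi>] by (simp add: UU_def powr_mult)
    also have "\<dots> \<le> U \<omega> \<xi> powr - e1" using U_powr_le_1[of e1 \<omega>' \<xi>] e1_gt_1 by (intro mult_left_le) auto
    finally show "norm (UU \<omega> \<omega>' \<xi> powr - e1) \<le> norm (U \<omega> \<xi> powr - e1)" by simp
  qed
qed (auto simp: UU_def U_def)

lemma T_nonneg: "T \<omega> \<omega>' \<ge> 0" by (simp add: T_def)

lemma T_commute: "T \<omega> \<omega>' = T \<omega>' \<omega>" by (simp add: T_def UU_commute)

lemma T_measurable [measurable (raw)]: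
  assumes [measurable]: "f \<in> borel_measurable A" "f' \<in> borel_measurable A"
  shows "(\<lambda>x. T (f x) (f' x)) \<in> borel_measurable A"
  unfolding T_def by measurable

definition S where "S \<omega> \<omega>' = sqrt (b \<omega>) * sqrt (b \<omega>')"

lemma S_pos: "S \<omega> \<omega>' > 0"
  using beta_pos[of \<alpha>] by (simp add: S_def)

lemma S_sq: "S \<omega> \<omega>' * S \<omega> \<omega>' = b \<omega> * b \<omega>'"
proof -
  have "S \<omega> \<omega>' * S \<omega> \<omega>' = (sqrt (b \<omega>) * sqrt (b \<omega>)) * (sqrt (b \<omega>') * sqrt (b \<omega>'))"
    by (simp only: S_def mult_ac)
  then show ?thesis using beta_pos[of \<alpha>] by (simp add: less_imp_le)
qed

lemma S_commute: "S \<omega> \<omega>' = S \<omega>' \<omega>"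
  by (simp add: S_def mult.commute)

text \<open>Majorant of all kernels that occur: the normalisation S of two dilated copies, their
  overlap \<open>T\<close> on the frequency side, and quadratic decay at scale S. Its integral over
  x is a constant times S^2 \<open>T\<close>.\<close>

definition H where "H x \<omega> \<omega>' = S \<omega> \<omega>' * T \<omega> \<omega>' * (1 + \<bar>x\<bar> / S \<omega> \<omega>') powr -2"

lemma H_nonneg: "H x \<omega> \<omega>' \<ge> 0"
  using S_pos[of \<omega> \<omega>'] T_nonneg[of \<omega> \<omega>'] by (simp add: H_def)

lemma H_measurable [measurable (raw)]:
  assumes [measurable]: "h \<in> borel_measurable A" "f \<in> borel_measurable A" "f' \<in> borel_measurable A"
  shows "(\<lambda>x. H (h x) (f x) (f' x)) \<in> borel_measurable A"
  unfolding H_def S_def by measurable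

lemma H_commute: "H x \<omega> \<omega>' = H x \<omega>' \<omega>"
  by (simp add: H_def S_commute T_commute)

lemma H_even: "H (- x) \<omega> \<omega>' = H x \<omega> \<omega>'"
  by (simp add: H_def)

definition K0 where "K0 = 2 * (C * KN * (1 + 9 * 4 powr p))"

text \<open>The trivial estimate, multiplied by S^2, is added to the one from two integrations by
  parts; then (S + |x|)^2 \<le> 2 (S^2 + x^2) is used. For \<open>v\<close> only the exponent r - 1
  is assumed, since this is what remains for a difference of generators.\<close>

lemma kernel_bound:
  assumes v: "decaying v D (r - 1)"
  shows "S \<omega> \<omega>' * cmod (ifourier (integrand \<omega> \<omega>' v 0) x) \<le> K0 * D * H x \<omega> \<omega>'"
proof -
  let ?J = "cmod (ifourier (integrand \<omega> \<omega>' v 0) x)"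
  let ?S = "S \<omega> \<omega>'"
  have D: "D \<ge> 0" using v by (simp add: decaying_def)
  let ?c = "C * KN * D"
  have CK: "?c \<ge> 0" using C KN D by simp
  have UUr: "U \<omega> \<xi> powr - r * U \<omega>' \<xi> powr - (r - 1) \<le> UU \<omega> \<omega>' \<xi> powr - (r - 1)" for \<xi>
  proof -
    have "U \<omega> \<xi> powr - r * U \<omega>' \<xi> powr - (r - 1) \<le> U \<omega> \<xi> powr - (r - 1) * U \<omega>' \<xi> powr - (r - 1)"
      using U_ge_1[of \<omega> \<xi>] by (intro mult_right_mono powr_mono) auto
    then show ?thesis using U_ge_1[of \<omega> \<xi>] U_ge_1[of \<omega>' \<xi>] by (simp add: UU_def powr_mult)
  qed
  have UUe: "UU \<omega> \<omega>' \<xi> powr - (r - 1) * UU \<omega> \<omega>' \<xi> powr p = UU \<omega> \<omega>' \<xi> powr - e1" for \<xi>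
  proof -
    have "- (r - 1) + p = - e1" by (simp add: e1_def)
    then show ?thesis by (simp only: powr_add[symmetric])
  qed
  have I0: "cmod (integrand \<omega> \<omega>' v 0 \<xi>) \<le> ?c * UU \<omega> \<omega>' \<xi> powr - e1" for \<xi>
  proof -
    have "cmod (integrand \<omega> \<omega>' v 0 \<xi>) \<le> ?c * (U \<omega> \<xi> powr - r * U \<omega>' \<xi> powr - (r - 1))"
      using integrand_bound[OF v, of 0] by simp
    also have "\<dots> \<le> ?c * UU \<omega> \<omega>' \<xi> powr - (r - 1)" by (intro mult_left_mono UUr CK)
    also have "\<dots> \<le> ?c * UU \<omega> \<omega>' \<xi> powr - e1"
      using UU_ge_1[of \<omega> \<omega>' \<xi>] p_nonneg by (intro mult_left_mono powr_mono CK) (auto simp: e1_def)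
    finally show ?thesis .
  qed
  have I2: "cmod (integrand \<omega> \<omega>' v 2 \<xi>) \<le> ?c * (9 * 4 powr p) * (b \<omega> * b \<omega>') * UU \<omega> \<omega>' \<xi> powr - e1" for \<xi>
  proof -
    \<comment> \<open>Squaring a sum of three terms gives one factor 3, the three bounds of
      \<open>beta_sq_bounds\<close> another: hence the 9 in \<open>K0\<close>.\<close>
    have "(b \<omega> + b \<xi> + b \<omega>')\<^sup>2 \<le> 3 * (b \<omega> ^ 2 + b \<xi> ^ 2 + b \<omega>' ^ 2)"
      using sum_squares_bound[of "b \<omega>" "b \<xi>"] sum_squares_bound[of "b \<omega>" "b \<omega>'"] sum_squares_bound[of "b \<xi>" "b \<omega>'"]
      by (simp add: power2_eq_square algebra_simps)
    also have "\<dots> \<le> 9 * (4 powr p * UU \<omega> \<omega>' \<xi> powr p * (b \<omega> * b \<omega>'))"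
    proof -
      have "3 * (x + y + z) \<le> 9 * Y" if "x \<le> Y" "z \<le> Y" "y \<le> Y" for x y z Y :: real using that by simp
      from this[OF beta_sq_bounds] show ?thesis .
    qed
    finally have 1: "(b \<omega> + b \<xi> + b \<omega>')\<^sup>2 \<le> 9 * (4 powr p * UU \<omega> \<omega>' \<xi> powr p * (b \<omega> * b \<omega>'))" .
    have "cmod (integrand \<omega> \<omega>' v 2 \<xi>) \<le> ?c * (U \<omega> \<xi> powr - r * U \<omega>' \<xi> powr - (r - 1)) * (b \<omega> + b \<xi> + b \<omega>')\<^sup>2"
      by (rule integrand_bound[OF v]) simp
    also have "\<dots> \<le> ?c * UU \<omega> \<omega>' \<xi> powr - (r - 1) * (9 * (4 powr p * UU \<omega> \<omega>' \<xi> powr p * (b \<omega> * b \<omega>')))"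
      using CK by (intro mult_mono mult_left_mono UUr 1) auto
    also have "\<dots> = ?c * (9 * 4 powr p) * (b \<omega> * b \<omega>') * (UU \<omega> \<omega>' \<xi> powr - (r - 1) * UU \<omega> \<omega>' \<xi> powr p)"
      by simp
    finally show ?thesis unfolding UUe .
  qed
  have J0: "?J \<le> ?c * T \<omega> \<omega>'"
  proof -
    have "?J \<le> (LINT \<xi>|lborel. cmod (integrand \<omega> \<omega>' v 0 \<xi>))" by (rule norm_ifourier_le)
    also have "\<dots> \<le> (LINT \<xi>|lborel. ?c * UU \<omega> \<omega>' \<xi> powr - e1)"
      using integrand_integrable[OF v, of 0] T_integrable I0 by (intro integral_mono) auto
    finally show ?thesis by (simp add: T_def)
  qed
  have J2: "x\<^sup>2 * ?J \<le> ?c * (9 * 4 powr p) * (b \<omega> * b \<omega>') * T \<omega> \<omega>'"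
  proof -
    have "x\<^sup>2 * ?J \<le> (LINT \<xi>|lborel. cmod (integrand \<omega> \<omega>' v 2 \<xi>))" by (rule ifourier_integrand_decay[OF v])
    also have "\<dots> \<le> (LINT \<xi>|lborel. ?c * (9 * 4 powr p) * (b \<omega> * b \<omega>') * UU \<omega> \<omega>' \<xi> powr - e1)"
      using integrand_integrable[OF v, of 2] T_integrable I2 by (intro integral_mono) auto
    finally show ?thesis by (simp add: T_def)
  qed
  have S: "?S > 0" by (rule S_pos)
  have S2: "?S\<^sup>2 = b \<omega> * b \<omega>'" using S_sq[of \<omega> \<omega>'] by (simp add: power2_eq_square)
  have "(?S\<^sup>2 + x\<^sup>2) * ?J \<le> (C * KN * (1 + 9 * 4 powr p)) * D * ?S\<^sup>2 * T \<omega> \<omega>'"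
    using mult_left_mono[OF J0, of "?S\<^sup>2"] J2 unfolding S2[symmetric] by (simp add: algebra_simps)
  moreover have "(?S + \<bar>x\<bar>)\<^sup>2 \<le> 2 * (?S\<^sup>2 + x\<^sup>2)"
    using sum_squares_bound[of ?S "\<bar>x\<bar>"] by (simp add: power2_sum)
  then have "(?S + \<bar>x\<bar>)\<^sup>2 * ?J \<le> 2 * (?S\<^sup>2 + x\<^sup>2) * ?J" by (intro mult_right_mono) auto
  moreover have "2 * (?S\<^sup>2 + x\<^sup>2) * ?J = 2 * ((?S\<^sup>2 + x\<^sup>2) * ?J)" by (rule mult.assoc)
  moreover have "K0 * D * ?S\<^sup>2 * T \<omega> \<omega>' = 2 * ((C * KN * (1 + 9 * 4 powr p)) * D * ?S\<^sup>2 * T \<omega> \<omega>')"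
    unfolding K0_def by (simp only: mult.assoc)
  ultimately have "(?S + \<bar>x\<bar>)\<^sup>2 * ?J \<le> K0 * D * ?S\<^sup>2 * T \<omega> \<omega>'"
    by linarith
  then have "?J \<le> K0 * D * ?S\<^sup>2 * T \<omega> \<omega>' / (?S + \<bar>x\<bar>)\<^sup>2"
    using S by (simp add: pos_le_divide_eq add_pos_nonneg mult.commute)
  also have "\<dots> = K0 * D * T \<omega> \<omega>' * (1 + \<bar>x\<bar> / ?S) powr -2"
  proof -
    have "1 + \<bar>x\<bar> / ?S = (?S + \<bar>x\<bar>) / ?S" using S by (simp add: field_simps)
    moreover have "?S + \<bar>x\<bar> > 0" using S by simp
    ultimately have "(1 + \<bar>x\<bar> / ?S) powr -2 = ?S\<^sup>2 / (?S + \<bar>x\<bar>)\<^sup>2"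
      using S by (simp add: powr_minus powr_divide)
    then show ?thesis by simp
  qed
  finally have "?S * ?J \<le> ?S * (K0 * D * T \<omega> \<omega>' * (1 + \<bar>x\<bar> / ?S) powr -2)"
    using S by (intro mult_left_mono) auto
  then show ?thesis by (simp add: H_def mult_ac)
qed

definition Wc where "Wc = decay_integral 2 * 4 powr (s / (1 - \<alpha>)) * B * decay_integral q"

lemma Wc_nonneg: "Wc \<ge> 0"
  by (simp add: Wc_def decay_integral_nonneg B_nonneg)

lemma nn_integral_H_x: "(\<integral>\<^sup>+ x. ennreal (H (x - a) \<omega> \<omega>') \<partial>lborel) = ennreal (decay_integral 2 * (b \<omega> * b \<omega>' * T \<omega> \<omega>'))"
proof -
  let ?S = "S \<omega> \<omega>'"
  have S: "?S > 0" by (rule S_pos)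
  have "(\<integral>\<^sup>+ x. ennreal (H (x - a) \<omega> \<omega>') \<partial>lborel) =
    (\<integral>\<^sup>+ x. ennreal (b \<omega> * b \<omega>' * T \<omega> \<omega>') * ennreal ((1 / ?S) * (1 + (1 / ?S) * \<bar>x - a\<bar>) powr -2) \<partial>lborel)"
  proof (rule nn_integral_cong)
    fix x
    have eq: "H (x - a) \<omega> \<omega>' = (b \<omega> * b \<omega>' * T \<omega> \<omega>') * ((1 / ?S) * (1 + (1 / ?S) * \<bar>x - a\<bar>) powr -2)"
      using S unfolding S_sq[symmetric] by (simp add: H_def)
    show "ennreal (H (x - a) \<omega> \<omega>') = ennreal (b \<omega> * b \<omega>' * T \<omega> \<omega>') * ennreal ((1 / ?S) * (1 + (1 / ?S) * \<bar>x - a\<bar>) powr -2)"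
      unfolding eq using S T_nonneg[of \<omega> \<omega>'] beta_pos[of \<alpha>] by (intro ennreal_mult) (auto simp: less_imp_le)
  qed
  also have "\<dots> = ennreal (b \<omega> * b \<omega>' * T \<omega> \<omega>') * (\<integral>\<^sup>+ x. ennreal ((1 / ?S) * (1 + (1 / ?S) * \<bar>x - a\<bar>) powr -2) \<partial>lborel)"
    by (rule nn_integral_cmult) measurable
  also have "(\<integral>\<^sup>+ x. ennreal ((1 / ?S) * (1 + (1 / ?S) * \<bar>x - a\<bar>) powr -2) \<partial>lborel) = ennreal (decay_integral 2)"
    by (rule nn_integral_decay) (use S in auto)
  finally show ?thesis
    using T_nonneg[of \<omega> \<omega>'] beta_pos[of \<alpha>] by (simp add: ennreal_mult[symmetric] decay_integral_nonneg less_imp_le mult.commute)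
qed

text \<open>Integrating out x leaves \<beta>(\<omega>) \<beta>(\<omega>') \<open>T\<close>, and
  \<open>T\<close> is opened as an integral over \<xi>. Under it the weight is bounded pointwise,
  which lowers \<open>e1\<close> to \<open>q\<close>, and the integrand factorises into one function
  of \<omega> and \<xi> and one of \<omega>' and \<xi>.\<close>

lemma nn_integral_H_weight:
  "(\<integral>\<^sup>+ \<omega>. \<integral>\<^sup>+ x. ennreal (H (x - a) \<omega> \<omega>') * ennreal (weight s \<omega> \<omega>') \<partial>lborel \<partial>lborel) \<le> ennreal Wc"
proof -
  let ?E = "4 powr (s / (1 - \<alpha>))"
  have bp: "b x > 0" for x by (rule beta_pos)
  let ?T = "\<lambda>\<omega>. \<integral>\<^sup>+ \<xi>. ennreal (b \<omega> * b \<omega>' * UU \<omega> \<omega>' \<xi> powr - e1) \<partial>lborel"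
  let ?w = "\<lambda>\<omega>. ennreal (weight s \<omega> \<omega>')" and ?u = "\<lambda>\<omega> \<xi>. ennreal (b \<omega> * U \<omega> \<xi> powr - q)"
  let ?h = "\<lambda>\<omega> x. ennreal (H (x - a) \<omega> \<omega>')" and ?d = "ennreal (decay_integral 2)"
  have 1: "ennreal (b \<omega> * b \<omega>' * T \<omega> \<omega>') = ?T \<omega>" for \<omega>
    using T_integrable[of \<omega> \<omega>'] bp by (subst nn_integral_eq_integral) (auto simp: T_def less_imp_le)
  have 2: "ennreal (b \<omega> * b \<omega>' * UU \<omega> \<omega>' \<xi> powr - e1) * ?w \<omega> \<le>
     ennreal ?E * (?u \<omega>' \<xi> * ?u \<omega> \<xi>)" for \<omega> \<xi>
  proof -
    have "weight s \<omega> \<omega>' \<le> ?E * UU \<omega> \<omega>' \<xi> powr (s / (1 - \<alpha>))"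
      using weight_bound[OF \<alpha> s, of \<omega> \<omega>' \<xi>] by (simp add: UU_def U_def)
    then have "b \<omega> * b \<omega>' * UU \<omega> \<omega>' \<xi> powr - e1 * weight s \<omega> \<omega>' \<le> b \<omega> * b \<omega>' * UU \<omega> \<omega>' \<xi> powr - e1 * (?E * UU \<omega> \<omega>' \<xi> powr (s / (1 - \<alpha>)))"
      using bp by (intro mult_left_mono) (auto simp: less_imp_le)
    also have "\<dots> = ?E * b \<omega> * b \<omega>' * (UU \<omega> \<omega>' \<xi> powr - e1 * UU \<omega> \<omega>' \<xi> powr (s / (1 - \<alpha>)))" by simp
    also have "UU \<omega> \<omega>' \<xi> powr - e1 * UU \<omega> \<omega>' \<xi> powr (s / (1 - \<alpha>)) = UU \<omega> \<omega>' \<xi> powr - q"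
      using UU_ge_1[of \<omega> \<omega>' \<xi>] by (simp add: e1_eq powr_add[symmetric])
    also have "\<dots> = U \<omega> \<xi> powr - q * U \<omega>' \<xi> powr - q"
      using U_ge_1[of \<omega> \<xi>] U_ge_1[of \<omega>' \<xi>] by (simp add: UU_def powr_mult)
    finally have "b \<omega> * b \<omega>' * UU \<omega> \<omega>' \<xi> powr - e1 * weight s \<omega> \<omega>' \<le> ?E * ((b \<omega>' * U \<omega>' \<xi> powr - q) * (b \<omega> * U \<omega> \<xi> powr - q))"
      by (simp add: mult_ac)
    then have "ennreal (b \<omega> * b \<omega>' * UU \<omega> \<omega>' \<xi> powr - e1 * weight s \<omega> \<omega>') \<le> ennreal (?E * ((b \<omega>' * U \<omega>' \<xi> powr - q) * (b \<omega> * U \<omega> \<xi> powr - q)))"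
      by (rule ennreal_leI)
    then show ?thesis using bp weight_nonneg[of s \<omega> \<omega>'] by (simp add: ennreal_mult less_imp_le)
  qed
  have E1: "(\<integral>\<^sup>+ \<omega>. \<integral>\<^sup>+ x. ?h \<omega> x * ?w \<omega> \<partial>lborel \<partial>lborel) =
    (\<integral>\<^sup>+ \<omega>. ?d * (?T \<omega> * ?w \<omega>) \<partial>lborel)"
  proof (rule nn_integral_cong)
    fix \<omega> :: real
    have "(\<integral>\<^sup>+ x. ?h \<omega> x * ?w \<omega> \<partial>lborel)
      = (\<integral>\<^sup>+ x. ?h \<omega> x \<partial>lborel) * ?w \<omega>"
      by (rule nn_integral_multc) measurable
    also have "\<dots> = ennreal (decay_integral 2 * (b \<omega> * b \<omega>' * T \<omega> \<omega>')) * ?w \<omega>"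
      by (simp only: nn_integral_H_x)
    also have "ennreal (decay_integral 2 * (b \<omega> * b \<omega>' * T \<omega> \<omega>')) = ?d * ennreal (b \<omega> * b \<omega>' * T \<omega> \<omega>')"
      using bp T_nonneg by (intro ennreal_mult) (auto simp: decay_integral_nonneg less_imp_le)
    finally show "(\<integral>\<^sup>+ x. ?h \<omega> x * ?w \<omega> \<partial>lborel)
      = ?d * (?T \<omega> * ?w \<omega>)"
      unfolding 1 by (simp only: mult.assoc)
  qed
  have E2: "(\<integral>\<^sup>+ \<omega>. ?d * (?T \<omega> * ?w \<omega>) \<partial>lborel) = ?d * (\<integral>\<^sup>+ \<omega>. ?T \<omega> * ?w \<omega> \<partial>lborel)"
    by (rule nn_integral_cmult) measurable
  have "(\<integral>\<^sup>+ \<omega>. ?T \<omega> * ?w \<omega> \<partial>lborel)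
    = (\<integral>\<^sup>+ \<omega>. \<integral>\<^sup>+ \<xi>. ennreal (b \<omega> * b \<omega>' * UU \<omega> \<omega>' \<xi> powr - e1) * ?w \<omega> \<partial>lborel \<partial>lborel)"
    by (intro nn_integral_cong nn_integral_multc[symmetric]) (auto simp: UU_def U_def)
  also have "\<dots> \<le> (\<integral>\<^sup>+ \<omega>. \<integral>\<^sup>+ \<xi>. ennreal ?E * (?u \<omega>' \<xi> * ?u \<omega> \<xi>) \<partial>lborel \<partial>lborel)"
    by (intro nn_integral_mono 2)
  \<comment> \<open>After the exchange the moving scale is integrated first, with a bound
    \<open>B\<close> uniform in \<xi>; the remaining \<xi>-integral has the fixed scale
    \<beta>(\<omega>').\<close>
  also have "\<dots> = (\<integral>\<^sup>+ \<xi>. \<integral>\<^sup>+ \<omega>. ennreal ?E * (?u \<omega>' \<xi> * ?u \<omega> \<xi>) \<partial>lborel \<partial>lborel)"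
  proof -
    have "(\<lambda>(\<omega>, \<xi>). ennreal ?E * (?u \<omega>' \<xi> * ?u \<omega> \<xi>)) \<in> borel_measurable (lborel \<Otimes>\<^sub>M lborel)"
      unfolding U_def by measurable
    from lborel_pair.Fubini'[OF this] show ?thesis by (rule sym)
  qed
  also have "\<dots> = (\<integral>\<^sup>+ \<xi>. ennreal ?E * (?u \<omega>' \<xi> * (\<integral>\<^sup>+ \<omega>. ?u \<omega> \<xi> \<partial>lborel)) \<partial>lborel)"
  proof (rule nn_integral_cong)
    fix \<xi> :: real
    have "(\<integral>\<^sup>+ \<omega>. ennreal ?E * (?u \<omega>' \<xi> * ?u \<omega> \<xi>) \<partial>lborel)
      = ennreal ?E * (\<integral>\<^sup>+ \<omega>. ?u \<omega>' \<xi> * ?u \<omega> \<xi> \<partial>lborel)"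
      by (rule nn_integral_cmult) measurable
    also have "(\<integral>\<^sup>+ \<omega>. ?u \<omega>' \<xi> * ?u \<omega> \<xi> \<partial>lborel)
      = ?u \<omega>' \<xi> * (\<integral>\<^sup>+ \<omega>. ?u \<omega> \<xi> \<partial>lborel)"
      by (rule nn_integral_cmult) measurable
    finally show "(\<integral>\<^sup>+ \<omega>. ennreal ?E * (?u \<omega>' \<xi> * ?u \<omega> \<xi>) \<partial>lborel)
      = ennreal ?E * (?u \<omega>' \<xi> * (\<integral>\<^sup>+ \<omega>. ?u \<omega> \<xi> \<partial>lborel))" .
  qed
  also have "\<dots> \<le> (\<integral>\<^sup>+ \<xi>. ennreal ?E * (?u \<omega>' \<xi> * ennreal B) \<partial>lborel)"
    by (intro nn_integral_mono mult_left_mono nn_integral_U_omega) auto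
  also have "\<dots> = ennreal ?E * (\<integral>\<^sup>+ \<xi>. ?u \<omega>' \<xi> * ennreal B \<partial>lborel)"
    by (rule nn_integral_cmult) measurable
  also have "(\<integral>\<^sup>+ \<xi>. ?u \<omega>' \<xi> * ennreal B \<partial>lborel) = (\<integral>\<^sup>+ \<xi>. ?u \<omega>' \<xi> \<partial>lborel) * ennreal B"
    by (rule nn_integral_multc) measurable
  also have "(\<integral>\<^sup>+ \<xi>. ?u \<omega>' \<xi> \<partial>lborel) = ennreal (decay_integral q)"
    by (rule nn_integral_U_xi[OF q_gt_1])
  finally have E3: "(\<integral>\<^sup>+ \<omega>. ?T \<omega> * ?w \<omega> \<partial>lborel) \<le> ennreal ?E * (ennreal (decay_integral q) * ennreal B)" .
  have "?d * (\<integral>\<^sup>+ \<omega>. ?T \<omega> * ?w \<omega> \<partial>lborel) \<le> ?d * (ennreal ?E * (ennreal (decay_integral q) * ennreal B))"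
    by (intro mult_left_mono E3) simp
  also have "\<dots> = ennreal Wc"
    by (simp add: Wc_def ennreal_mult decay_integral_nonneg B_nonneg mult_ac)
  finally show ?thesis unfolding E1 E2 .
qed

lemma nn_integral_H_plane:
  "(\<integral>\<^sup>+ z. ennreal (H (fst z - a) (snd z) \<omega>') * ennreal (weight s (snd z) \<omega>') \<partial>(lborel :: (real \<times> real) measure)) \<le> ennreal Wc"
proof -
  have "(\<integral>\<^sup>+ z. ennreal (H (fst z - a) (snd z) \<omega>') * ennreal (weight s (snd z) \<omega>') \<partial>(lborel \<Otimes>\<^sub>M lborel)) =
    (\<integral>\<^sup>+ \<omega>. \<integral>\<^sup>+ x. ennreal (H (x - a) \<omega> \<omega>') * ennreal (weight s \<omega> \<omega>') \<partial>lborel \<partial>lborel)"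
    by (subst lborel_pair.nn_integral_snd[symmetric]) auto
  with nn_integral_H_weight show ?thesis by (simp add: lborel_prod)
qed

end

section \<open>The inverse of the frame operator\<close>

lemma integrable_of_quadratic_decay:
  fixes f :: "real \<Rightarrow> complex"
  assumes [measurable]: "f \<in> borel_measurable borel" and A: "\<And>t. cmod (f t) \<le> A" and B: "\<And>t. t\<^sup>2 * cmod (f t) \<le> B"
  shows "integrable lborel f"
proof (rule Bochner_Integration.integrable_bound)
  have "(\<integral>\<^sup>+ t. ennreal (2 * (A + B) * (1 + \<bar>t\<bar>) powr -2) \<partial>lborel) = (\<integral>\<^sup>+ t. ennreal (2 * (A + B)) * ennreal (1 * (1 + 1 * \<bar>t - 0\<bar>) powr -2) \<partial>lborel)"
    using order_trans[OF norm_ge_zero A] B[of 0] by (intro nn_integral_cong) (simp add: ennreal_mult)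
  also have "\<dots> = ennreal (2 * (A + B)) * (\<integral>\<^sup>+ t. ennreal (1 * (1 + 1 * \<bar>t - 0\<bar>) powr -2) \<partial>lborel)"
    by (rule nn_integral_cmult) measurable
  also have "\<dots> = ennreal (2 * (A + B)) * ennreal (decay_integral 2)"
    by (subst nn_integral_decay) auto
  also have "\<dots> < \<infinity>" by (simp add: ennreal_mult_less_top)
  finally show "integrable lborel (\<lambda>t. 2 * (A + B) * (1 + \<bar>t\<bar>) powr -2)"
    using order_trans[OF norm_ge_zero A] B[of 0] by (intro integrableI_nonneg) auto
  show "AE t in lborel. norm (f t) \<le> norm (2 * (A + B) * (1 + \<bar>t\<bar>) powr -2)"
  proof (rule AE_I2)
    fix t :: real
    have "(1 + \<bar>t\<bar>)\<^sup>2 \<le> 2 * (1 + t\<^sup>2)" using sum_squares_bound[of 1 "\<bar>t\<bar>"] by (simp add: power2_sum)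
    then have "(1 + \<bar>t\<bar>)\<^sup>2 * cmod (f t) \<le> 2 * (1 + t\<^sup>2) * cmod (f t)" by (intro mult_right_mono) auto
    also have "\<dots> = 2 * (cmod (f t) + t\<^sup>2 * cmod (f t))" by (simp add: algebra_simps)
    also have "\<dots> \<le> 2 * (A + B)" using A[of t] B[of t] by simp
    finally have "cmod (f t) \<le> 2 * (A + B) / (1 + \<bar>t\<bar>)\<^sup>2"
      by (simp add: pos_le_divide_eq add_pos_nonneg mult.commute)
    also have "\<dots> = 2 * (A + B) * (1 + \<bar>t\<bar>) powr -2" by (simp add: powr_minus field_simps)
    finally show "norm (f t) \<le> norm (2 * (A + B) * (1 + \<bar>t\<bar>) powr -2)" by (auto intro: order_trans[OF _ abs_ge_self])
  qed
qed auto

text \<open>Null sets are invariant under invertible affine maps; the proof applies the substitution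
  rule to the integral of |f - g|.\<close>

lemma AE_lborel_affine:
  fixes f g :: "real \<Rightarrow> complex"
  assumes [measurable]: "f \<in> borel_measurable borel" "g \<in> borel_measurable borel"
    and ae: "AE t in lborel. f t = g t" and c: "c \<noteq> 0"
  shows "AE t in lborel. f (a + c * t) = g (a + c * t)"
proof -
  have "(\<integral>\<^sup>+ t. ennreal (cmod (f t - g t)) \<partial>lborel) = 0"
    by (subst nn_integral_0_iff_AE) (use ae in auto)
  then have "ennreal \<bar>c\<bar> * (\<integral>\<^sup>+ t. ennreal (cmod (f (a + c * t) - g (a + c * t))) \<partial>lborel) = 0"
    by (subst (asm) nn_integral_real_affine[OF _ c, of _ a]) auto
  then have "(\<integral>\<^sup>+ t. ennreal (cmod (f (a + c * t) - g (a + c * t))) \<partial>lborel) = 0" using c by simp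
  then have "AE t in lborel. ennreal (cmod (f (a + c * t) - g (a + c * t))) = 0"
    by (subst (asm) nn_integral_0_iff_AE) auto
  then show ?thesis by eventually_elim simp
qed

lemma cnj_measurable [measurable (raw)]: "f \<in> borel_measurable A \<Longrightarrow> (\<lambda>x. cnj (f x)) \<in> borel_measurable A"
  by (rule measurable_compose[OF _ borel_measurable_continuous_onI]) (auto intro!: continuous_intros)

lemma L2_inner_cnj: "L2_inner f g = cnj (L2_inner g f)"
  unfolding L2_inner_def Bochner_Integration.integral_cnj[symmetric] by (simp add: mult.commute del: Bochner_Integration.integral_cnj)

lemma L2_inner_cong_AE:
  assumes "L2 f" "L2 g" "L2 g'" "AE t in lborel. g t = g' t"
  shows "L2_inner f g = L2_inner f g'" "L2_inner g f = L2_inner g' f"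
proof -
  have [measurable]: "f \<in> borel_measurable lborel" "g \<in> borel_measurable lborel" "g' \<in> borel_measurable lborel"
    using assms by (auto simp: L2_def)
  show "L2_inner f g = L2_inner f g'" "L2_inner g f = L2_inner g' f"
    unfolding L2_inner_def using assms(4) by (auto intro!: integral_cong_AE)
qed

text \<open>Parseval's relation in the form that the multiplication formula yields for integrable
  functions.\<close>

lemma L2_inner_ifourier:
  assumes "integrable lborel f" "integrable lborel G"
  shows "L2_inner (ifourier f) G = (LINT \<xi>|lborel. f \<xi> * cnj (fourier G \<xi>))"
proof -
  have "integrable lborel (\<lambda>x. cnj (G x))" using assms(2) by simp
  from ifourier_swap[OF assms(1) this]
  have "L2_inner (ifourier f) G = (LINT \<xi>|lborel. f \<xi> * ifourier (\<lambda>x. cnj (G x)) \<xi>)" by (simp add: L2_inner_def)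
  moreover have "ifourier (\<lambda>x. cnj (G x)) \<xi> = cnj (fourier G \<xi>)" for \<xi>
    unfolding ifourier_def fourier_def Bochner_Integration.integral_cnj[symmetric] by (simp add: cis_cnj del: Bochner_Integration.integral_cnj)
  ultimately show ?thesis by simp
qed

lemma integrable_affine_div:
  fixes f :: "real \<Rightarrow> 'b::{banach, second_countable_topology}"
  assumes "integrable lborel f" "c > 0"
  shows "integrable lborel (\<lambda>t. f ((t - x) / c))"
proof -
  have "(t - x) / c = - x / c + (1 / c) * t" for t by (simp add: diff_divide_distrib)
  then show ?thesis using lborel_integrable_real_affine[OF assms(1), of "1/c" "-x/c"] assms(2) by simp
qed

context wavelet
begin

text \<open>The continuous representative of \<psi>. For the functions built from it Fourier
  inversion holds at every point, not just almost everywhere.\<close>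

definition \<psi>1 where "\<psi>1 = ifourier (g 0)"

lemma U0: "U 0 \<xi> = 1 + \<bar>\<xi>\<bar>"
  by (simp add: U_def beta_def)

lemma g_integrable: "n \<le> 2 \<Longrightarrow> integrable lborel (g n)"
proof (rule Bochner_Integration.integrable_bound)
  assume n: "n \<le> 2"
  show "integrable lborel (\<lambda>\<xi>. C * U 0 \<xi> powr - r)"
    using r_ge by (intro integrable_mult_right integrable_U_xi) auto
  show "AE \<xi> in lborel. norm (g n \<xi>) \<le> norm (C * U 0 \<xi> powr - r)"
    using n g_bound[of n] C by (intro AE_I2) (auto simp: U0 abs_mult)
  show "g n \<in> borel_measurable lborel" using g_cont[of n] n by (simp add: borel_measurable_continuous_onI)
qed

lemma g_le_C:
  assumes "n \<le> 3" shows "cmod (g n t) \<le> C"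
proof -
  have "(1 + \<bar>t\<bar>) powr - r \<le> 1" using U_powr_le_1[of r 0 t] r_ge by (auto simp: U0)
  then have "C * (1 + \<bar>t\<bar>) powr - r \<le> C" using C by (intro mult_left_le) auto
  with g_bound[OF assms, of t] show ?thesis by linarith
qed

lemma g_tendsto: "n \<le> 3 \<Longrightarrow> (g n \<longlongrightarrow> 0) at_top" "n \<le> 3 \<Longrightarrow> (g n \<longlongrightarrow> 0) at_bot"
proof -
  have *: "(g n \<longlongrightarrow> 0) F" if "n \<le> 3" "((\<lambda>\<xi>. U 0 \<xi> powr - r) \<longlongrightarrow> 0) F" for F n
  proof (rule Lim_null_comparison)
    show "\<forall>\<^sub>F \<xi> in F. norm (g n \<xi>) \<le> C * U 0 \<xi> powr - r"
      using g_bound[OF that(1)] by (intro always_eventually) (auto simp: U0)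
    show "((\<lambda>\<xi>. C * U 0 \<xi> powr - r) \<longlongrightarrow> 0) F"
      using tendsto_mult_left[OF that(2), of C] by simp
  qed
  from *[OF _ U_tendsto(1)] *[OF _ U_tendsto(2)]
  show "n \<le> 3 \<Longrightarrow> (g n \<longlongrightarrow> 0) at_top" "n \<le> 3 \<Longrightarrow> (g n \<longlongrightarrow> 0) at_bot" by auto
qed

lemma \<psi>1_cont: "continuous_on UNIV \<psi>1"
  unfolding \<psi>1_def by (intro continuous_ifourier g_integrable) simp

lemma \<psi>1_measurable [measurable]: "\<psi>1 \<in> borel_measurable borel"
  by (rule borel_measurable_continuous_onI[OF \<psi>1_cont])

lemma \<psi>1_bounded: "\<exists>A. \<forall>t. cmod (\<psi>1 t) \<le> A"
  using norm_ifourier_le[of "g 0"] unfolding \<psi>1_def by blast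

lemma \<psi>1_integrable: "integrable lborel \<psi>1"
proof (rule integrable_of_quadratic_decay)
  show "cmod (\<psi>1 t) \<le> (LINT \<xi>|lborel. cmod (g 0 \<xi>))" for t
    unfolding \<psi>1_def by (rule norm_ifourier_le)
  show "t\<^sup>2 * cmod (\<psi>1 t) \<le> (LINT \<xi>|lborel. cmod (g 2 \<xi>))" for t
    unfolding \<psi>1_def
    by (rule ifourier_decay[where f'="g 1"])
       (use g_deriv[of 0] g_deriv[of 1] in \<open>auto intro!: g_cont g_integrable g_tendsto simp: numeral_2_eq_2\<close>)
qed measurable

lemma \<psi>1_L2: "L2 \<psi>1"
  using L2_of_bounded_integrable[OF \<psi>1_integrable] \<psi>1_bounded by blast

text \<open>The Fourier transform of \<open>pw x \<omega>\<close>, see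
  \<open>fourier_pw\<close>.\<close>

definition gh where "gh x \<omega> \<xi> = cis (- (2 * pi * x * \<xi>)) * (of_real (sqrt (b \<omega>)) * g 0 (b \<omega> * (\<xi> - \<omega>)))"

lemma gh_integrable: "integrable lborel (gh x \<omega>)"
proof -
  have "integrable lborel (\<lambda>\<xi>. g 0 (- b \<omega> * \<omega> + b \<omega> * \<xi>))"
    using g_integrable[of 0] beta_pos[of \<alpha> \<omega>] by (intro lborel_integrable_real_affine) auto
  then have "integrable lborel (\<lambda>\<xi>. of_real (sqrt (b \<omega>)) * g 0 (b \<omega> * (\<xi> - \<omega>)))"
    by (simp add: algebra_simps)
  then show ?thesis unfolding gh_def[abs_def] by (rule integrable_cis_mult) auto
qed

lemma gh_measurable [measurable (raw)]:
  assumes [measurable]: "f \<in> borel_measurable A" "f' \<in> borel_measurable A" "h \<in> borel_measurable A"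
  shows "(\<lambda>z. gh (f z) (f' z) (h z)) \<in> borel_measurable A"
  unfolding gh_def by measurable

lemma gh_cont: "continuous_on UNIV (gh x \<omega>)"
  unfolding gh_def[abs_def] cis_conv_exp
  by (intro continuous_intros continuous_on_compose2[OF g_cont[of 0]]) auto

lemma norm_gh: "cmod (gh x \<omega> \<xi>) = sqrt (b \<omega>) * cmod (g 0 (b \<omega> * (\<xi> - \<omega>)))"
  using beta_pos[of \<alpha> \<omega>] by (simp add: gh_def norm_mult abs_of_pos)

lemma gh_bounded: "cmod (gh x \<omega> \<xi>) \<le> C"
proof -
  have "sqrt (b \<omega>) * cmod (g 0 (b \<omega> * (\<xi> - \<omega>))) \<le> 1 * C"
    using beta_le_1[OF \<alpha>(1), of \<omega>] g_le_C[of 0] beta_pos[of \<alpha> \<omega>] by (intro mult_mono) auto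
  then show ?thesis by (simp add: norm_gh)
qed

definition pw where "pw x \<omega> = pi_sigma \<alpha> x \<omega> \<psi>1"

lemma pi_sigma_eq: "pi_sigma \<alpha> x \<omega> f t = cis (2 * pi * \<omega> * (t - x)) * of_real (b \<omega> powr (-1/2)) * f ((t - x) / b \<omega>)"
  by (simp add: pi_sigma_def translation_def modulation_def dilation_def cis_conv_exp mult_ac)

lemma pw_eq_ifourier: "pw x \<omega> = ifourier (gh x \<omega>)"
proof
  fix t
  have b: "b \<omega> > 0" by (rule beta_pos)
  have "ifourier (gh x \<omega>) t = \<bar>1 / b \<omega>\<bar> *\<^sub>R (LINT \<eta>|lborel. cis (2 * pi * t * (\<omega> + 1 / b \<omega> * \<eta>)) * gh x \<omega> (\<omega> + 1 / b \<omega> * \<eta>))"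
    unfolding ifourier_def using b by (intro lborel_integral_real_affine) auto
  also have "(LINT \<eta>|lborel. cis (2 * pi * t * (\<omega> + 1 / b \<omega> * \<eta>)) * gh x \<omega> (\<omega> + 1 / b \<omega> * \<eta>)) =
     (LINT \<eta>|lborel. (cis (2 * pi * \<omega> * (t - x)) * of_real (sqrt (b \<omega>))) * (cis (2 * pi * ((t - x) / b \<omega>) * \<eta>) * g 0 \<eta>))"
  proof (rule Bochner_Integration.integral_cong[OF refl])
    fix \<eta>
    have "2 * pi * t * (\<omega> + 1 / b \<omega> * \<eta>) + - (2 * pi * x * (\<omega> + 1 / b \<omega> * \<eta>)) = 2 * pi * \<omega> * (t - x) + 2 * pi * ((t - x) / b \<omega>) * \<eta>"
      using b by (simp add: field_simps)
    then have "cis (2 * pi * t * (\<omega> + 1 / b \<omega> * \<eta>)) * cis (- (2 * pi * x * (\<omega> + 1 / b \<omega> * \<eta>))) = cis (2 * pi * \<omega> * (t - x)) * cis (2 * pi * ((t - x) / b \<omega>) * \<eta>)"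
      by (simp only: cis_mult)
    moreover have "b \<omega> * (\<omega> + 1 / b \<omega> * \<eta> - \<omega>) = \<eta>" using b by simp
    ultimately show "cis (2 * pi * t * (\<omega> + 1 / b \<omega> * \<eta>)) * gh x \<omega> (\<omega> + 1 / b \<omega> * \<eta>) = (cis (2 * pi * \<omega> * (t - x)) * of_real (sqrt (b \<omega>))) * (cis (2 * pi * ((t - x) / b \<omega>) * \<eta>) * g 0 \<eta>)"
      unfolding gh_def by (simp only: mult.assoc[symmetric]) (simp only: mult_ac)
  qed
  also have "\<dots> = (cis (2 * pi * \<omega> * (t - x)) * of_real (sqrt (b \<omega>))) * \<psi>1 ((t - x) / b \<omega>)"
    unfolding \<psi>1_def ifourier_def by (rule integral_mult_right_zero)
  also have "\<bar>1 / b \<omega>\<bar> *\<^sub>R \<dots> = cis (2 * pi * \<omega> * (t - x)) * of_real (sqrt (b \<omega>) / b \<omega>) * \<psi>1 ((t - x) / b \<omega>)"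
    using b by (simp add: scaleR_conv_of_real)
  also have "sqrt (b \<omega>) / b \<omega> = b \<omega> powr (-1/2)"
    using b by (simp add: powr_minus powr_half_sqrt real_div_sqrt field_simps)
  finally show "pw x \<omega> t = ifourier (gh x \<omega>) t"
    unfolding pw_def pi_sigma_eq by simp
qed

lemma pw_measurable [measurable (raw)]:
  assumes [measurable]: "f \<in> borel_measurable A" "f' \<in> borel_measurable A" "h \<in> borel_measurable A"
  shows "(\<lambda>z. pw (f z) (f' z) (h z)) \<in> borel_measurable A"
  unfolding pw_def pi_sigma_eq by measurable

lemma pw_integrable: "integrable lborel (pw x \<omega>)"
proof -
  have "integrable lborel (\<lambda>t. cis (2 * pi * \<omega> * (t - x)) * (of_real (b \<omega> powr (-1/2)) * \<psi>1 ((t - x) / b \<omega>)))"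
    by (intro integrable_cis_mult integrable_mult_right integrable_affine_div \<psi>1_integrable beta_pos) auto
  then show ?thesis unfolding pw_def by (simp add: pi_sigma_eq[abs_def] mult.assoc)
qed

lemma pw_L2: "L2 (pw x \<omega>)"
proof (rule L2_of_bounded_integrable[OF pw_integrable])
  show "cmod (pw x \<omega> t) \<le> (LINT \<xi>|lborel. cmod (gh x \<omega> \<xi>))" for t
    unfolding pw_eq_ifourier by (rule norm_ifourier_le)
qed

text \<open>The operators are isometries. Hence the bound in \<open>pw_inner_bound\<close> is
  uniform in x and \<omega>, which is what dominates the integral over plane and line in
  \<open>reconstruction_weak\<close>.\<close>

lemma pw_L2_norm: "(LINT t|lborel. (cmod (pw x \<omega> t))\<^sup>2) = (LINT t|lborel. (cmod (\<psi>1 t))\<^sup>2)"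
proof -
  have b: "b \<omega> > 0" by (rule beta_pos)
  have "(LINT t|lborel. (cmod (pw x \<omega> t))\<^sup>2) = \<bar>b \<omega>\<bar> *\<^sub>R (LINT t|lborel. (cmod (pw x \<omega> (x + b \<omega> * t)))\<^sup>2)"
    using b by (intro lborel_integral_real_affine) auto
  also have "\<dots> = (LINT t|lborel. b \<omega> * (cmod (pw x \<omega> (x + b \<omega> * t)))\<^sup>2)" using b by simp
  also have "\<dots> = (LINT t|lborel. (cmod (\<psi>1 t))\<^sup>2)"
  proof (rule Bochner_Integration.integral_cong[OF refl])
    fix t
    have "(b \<omega> powr (-1/2))\<^sup>2 = 1 / b \<omega>" using b by (simp add: powr_power powr_minus field_simps)
    then show "b \<omega> * (cmod (pw x \<omega> (x + b \<omega> * t)))\<^sup>2 = (cmod (\<psi>1 t))\<^sup>2"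
      using b by (simp add: pw_def pi_sigma_eq norm_mult power_mult_distrib)
  qed
  finally show ?thesis .
qed

lemma fourier_pw: "fourier (pw x \<omega>) \<xi> = gh x \<omega> \<xi>"
  using fourier_inversion[OF gh_cont gh_bounded gh_integrable, of x \<omega>] pw_integrable[of x \<omega>]
  unfolding pw_eq_ifourier by auto

text \<open>The explicit preimage of \<open>pw x \<omega>\<close> under the frame operator: division
  by the symbol on the Fourier side.\<close>

definition dual where "dual x \<omega> = ifourier (\<lambda>\<xi>. gh x \<omega> \<xi> * N 0 \<xi>)"

lemma N0_measurable [measurable]: "N 0 \<in> borel_measurable borel"
  by (rule borel_measurable_continuous_onI[OF N_cont]) simp

lemma N0_bound: "cmod (N 0 \<xi>) \<le> KN"
  using KN(2)[of 0] by simp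

lemma ghN_integrable: "integrable lborel (\<lambda>\<xi>. gh x \<omega> \<xi> * N 0 \<xi>)"
proof (rule Bochner_Integration.integrable_bound)
  show "integrable lborel (\<lambda>\<xi>. KN * cmod (gh x \<omega> \<xi>))"
    by (intro integrable_mult_right integrable_norm gh_integrable)
  show "AE \<xi> in lborel. norm (gh x \<omega> \<xi> * N 0 \<xi>) \<le> norm (KN * cmod (gh x \<omega> \<xi>))"
    using N0_bound KN(1) by (intro AE_I2) (auto simp: norm_mult abs_mult mult.commute intro!: mult_right_mono)
qed measurable

text \<open>A constant second factor turns the dual function into an instance of the kernel estimate.\<close>

definition unit_seq :: "nat \<Rightarrow> real \<Rightarrow> complex" where "unit_seq k t = (if k = 0 then 1 else 0)"

lemma unit_seq_decaying: "decaying unit_seq 1 0"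
  by (auto simp: decaying_def unit_seq_def[abs_def])

lemma dual_eq: "dual x \<omega> t = of_real (sqrt (b \<omega>)) * ifourier (integrand \<omega> 0 unit_seq 0) (t - x)"
  unfolding dual_def ifourier_def integral_mult_right_zero[symmetric]
proof (rule Bochner_Integration.integral_cong[OF refl])
  fix \<xi>
  have "cis (2 * pi * (t - x) * \<xi>) = cis (2 * pi * t * \<xi>) * cis (- (2 * pi * x * \<xi>))"
    by (simp add: cis_mult algebra_simps)
  then show "cis (2 * pi * t * \<xi>) * (gh x \<omega> \<xi> * N 0 \<xi>) = of_real (sqrt (b \<omega>)) * (cis (2 * pi * (t - x) * \<xi>) * integrand \<omega> 0 unit_seq 0 \<xi>)"
    by (simp add: gh_def integrand_def prod3_def scaled_def unit_seq_def)
qed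

lemma dual_integrable: "integrable lborel (dual x \<omega>)"
proof -
  let ?f = "ifourier (integrand \<omega> 0 unit_seq 0)"
  have m: "?f \<in> borel_measurable borel" by (intro measurable_ifourier integrand_integrable[OF unit_seq_decaying]) simp
  have "integrable lborel ?f"
    by (rule integrable_of_quadratic_decay[OF m norm_ifourier_le ifourier_integrand_decay[OF unit_seq_decaying]])
  then have "integrable lborel (\<lambda>t. of_real (sqrt (b \<omega>)) * ?f ((t - x) / 1))"
    by (intro integrable_mult_right integrable_affine_div) auto
  then show ?thesis by (simp add: dual_eq[abs_def])
qed

lemma dual_L2: "L2 (dual x \<omega>)"
  by (rule L2_of_bounded_integrable[OF dual_integrable]) (unfold dual_def, rule norm_ifourier_le)

lemma R_integrand_integrable: "integrable lborel (\<lambda>\<xi>. gh x \<omega> \<xi> * N 0 \<xi> * cnj (gh x' \<omega>' \<xi>))"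
proof (rule Bochner_Integration.integrable_bound)
  show "integrable lborel (\<lambda>\<xi>. C * cmod (gh x \<omega> \<xi> * N 0 \<xi>))"
    by (intro integrable_mult_right integrable_norm ghN_integrable)
  have "cmod (gh x \<omega> \<xi> * N 0 \<xi> * cnj (gh x' \<omega>' \<xi>)) \<le> C * cmod (gh x \<omega> \<xi> * N 0 \<xi>)" for \<xi>
    using mult_left_mono[OF gh_bounded[of x' \<omega>' \<xi>], of "cmod (gh x \<omega> \<xi> * N 0 \<xi>)"] by (simp add: norm_mult mult_ac)
  then show "AE \<xi> in lborel. norm (gh x \<omega> \<xi> * N 0 \<xi> * cnj (gh x' \<omega>' \<xi>)) \<le> norm (C * cmod (gh x \<omega> \<xi> * N 0 \<xi>))"
    by (intro AE_I2) (auto intro: order_trans[OF _ abs_ge_self])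
qed measurable

definition R where "R x \<omega> x' \<omega>' = (LINT \<xi>|lborel. gh x \<omega> \<xi> * N 0 \<xi> * cnj (gh x' \<omega>' \<xi>))"

lemma L2_inner_dual_pw: "L2_inner (dual x \<omega>) (pw x' \<omega>') = R x \<omega> x' \<omega>'"
  unfolding dual_def R_def by (subst L2_inner_ifourier[OF ghN_integrable pw_integrable]) (simp add: fourier_pw)

lemma R_cnj: "cnj (R x' \<omega>' x \<omega>) = R x \<omega> x' \<omega>'"
  unfolding R_def Bochner_Integration.integral_cnj[symmetric] by (simp add: N0_real mult_ac del: Bochner_Integration.integral_cnj)

lemma R_measurable [measurable (raw)]:
  assumes [measurable]: "f \<in> borel_measurable A" "f' \<in> borel_measurable A"
  shows "(\<lambda>z. R x \<omega> (f z) (f' z)) \<in> borel_measurable A"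
  unfolding R_def by measurable

lemma R_eq: "R x \<omega> x' \<omega>' = of_real (S \<omega> \<omega>') * ifourier (integrand \<omega> \<omega>' (\<lambda>k t. cnj (g k t)) 0) (x' - x)"
  unfolding R_def ifourier_def integral_mult_right_zero[symmetric]
proof (rule Bochner_Integration.integral_cong[OF refl])
  fix \<xi>
  have "cis (2 * pi * (x' - x) * \<xi>) = cis (- (2 * pi * x * \<xi>)) * cis (2 * pi * x' * \<xi>)"
    by (simp add: cis_mult algebra_simps)
  then show "gh x \<omega> \<xi> * N 0 \<xi> * cnj (gh x' \<omega>' \<xi>) = of_real (S \<omega> \<omega>') * (cis (2 * pi * (x' - x) * \<xi>) * integrand \<omega> \<omega>' (\<lambda>k t. cnj (g k t)) 0 \<xi>)"
    by (simp add: gh_def integrand_def prod3_def scaled_def S_def cis_cnj mult_ac)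
qed

lemma cnj_g_decaying: "decaying (\<lambda>k t. cnj (g k t)) C (r - 1)"
  unfolding decaying_def
proof (intro conjI allI impI)
  fix k t
  show "((\<lambda>t. cnj (g k t)) has_vector_derivative cnj (g (Suc k) t)) (at t)" if "k < 2"
    using that by (intro has_vector_derivative_cnj g_deriv) auto
  show "cmod (cnj (g k t)) \<le> C * (1 + \<bar>t\<bar>) powr - (r - 1)" if "k \<le> 2"
  proof -
    have "C * (1 + \<bar>t\<bar>) powr - r \<le> C * (1 + \<bar>t\<bar>) powr - (r - 1)"
      using C by (intro mult_left_mono powr_mono) auto
    with g_bound[of k t] that show ?thesis by simp
  qed
qed (use C r_ge g_cont[of 2] in \<open>auto intro!: continuous_intros\<close>)

lemma R_bound: "cmod (R x \<omega> x' \<omega>') \<le> K0 * C * H (x' - x) \<omega> \<omega>'"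
  using kernel_bound[OF cnj_g_decaying, of \<omega> \<omega>' "x' - x"] S_pos[of \<omega> \<omega>']
  by (simp add: R_eq norm_mult abs_of_pos)

lemma K0_nonneg: "K0 \<ge> 0" using C KN(1) by (simp add: K0_def)

lemma R_integrable: "integrable (lborel :: (real \<times> real) measure) (\<lambda>z. R x \<omega> (fst z) (snd z))"
proof (rule Bochner_Integration.integrable_bound)
  show "integrable (lborel :: (real \<times> real) measure) (\<lambda>z. K0 * C * (H (fst z - x) (snd z) \<omega> * weight s (snd z) \<omega>))"
  proof (intro integrable_mult_right integrableI_nonneg)
    show "(\<lambda>z. H (fst z - x) (snd z) \<omega> * weight s (snd z) \<omega>) \<in> borel_measurable (lborel :: (real \<times> real) measure)"
      by (simp add: borel_prod[symmetric])
    have "(\<integral>\<^sup>+ z. ennreal (H (fst z - x) (snd z) \<omega> * weight s (snd z) \<omega>) \<partial>(lborel :: (real \<times> real) measure)) \<le> ennreal Wc"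
      using nn_integral_H_plane[of x \<omega>] by (simp add: ennreal_mult H_nonneg weight_nonneg)
    then show "(\<integral>\<^sup>+ z. ennreal (H (fst z - x) (snd z) \<omega> * weight s (snd z) \<omega>) \<partial>(lborel :: (real \<times> real) measure)) < \<infinity>"
      by (rule le_less_trans) simp
  qed (auto simp: H_nonneg weight_nonneg)
  show "AE z in lborel. norm (R x \<omega> (fst z) (snd z)) \<le> norm (K0 * C * (H (fst z - x) (snd z) \<omega> * weight s (snd z) \<omega>))"
  proof (rule AE_I2)
    fix z :: "real \<times> real"
    have "cmod (R x \<omega> (fst z) (snd z)) \<le> K0 * C * H (fst z - x) (snd z) \<omega>"
      using R_bound[of x \<omega> "fst z" "snd z"] by (simp add: H_commute)
    \<comment> \<open>A weight of at least 1 is inserted so that the weighted integral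
      \<open>nn_integral_H_plane\<close> applies.\<close>
    also have "\<dots> \<le> K0 * C * (H (fst z - x) (snd z) \<omega> * weight s (snd z) \<omega>)"
      using weight_ge_1[of s "snd z" \<omega>] K0_nonneg C H_nonneg[of "fst z - x" "snd z" \<omega>]
      by (intro mult_left_mono) (auto intro: mult_left_mono[of 1 "weight s (snd z) \<omega>", simplified])
    finally show "norm (R x \<omega> (fst z) (snd z)) \<le> norm (K0 * C * (H (fst z - x) (snd z) \<omega> * weight s (snd z) \<omega>))"
      by (auto intro: order_trans[OF _ abs_ge_self])
  qed
  show "(\<lambda>z. R x \<omega> (fst z) (snd z)) \<in> borel_measurable (lborel :: (real \<times> real) measure)"
    by (simp add: borel_prod[symmetric])
qed

end

section \<open>Reconstruction of a wavelet from its kernel values\<close>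

lemma ifourier_reflect_translate:
  "ifourier (\<lambda>x. G (t - x)) \<eta> = cis (2 * pi * \<eta> * t) * fourier G \<eta>"
proof -
  have "ifourier (\<lambda>x. G (t - x)) \<eta> = (LINT y|lborel. cis (2 * pi * \<eta> * (t + (-1) * y)) * G (t - (t + (-1) * y)))"
    unfolding ifourier_def by (subst lborel_integral_real_affine[of "-1" _ t]) auto
  also have "\<dots> = (LINT y|lborel. cis (2 * pi * \<eta> * t) * (cis (- (2 * pi * \<eta> * y)) * G y))"
  proof (rule Bochner_Integration.integral_cong[OF refl])
    fix y
    have "cis (2 * pi * \<eta> * (t + (-1) * y)) = cis (2 * pi * \<eta> * t) * cis (- (2 * pi * \<eta> * y))"
      by (simp add: cis_mult algebra_simps)
    then show "cis (2 * pi * \<eta> * (t + (-1) * y)) * G (t - (t + (-1) * y)) = cis (2 * pi * \<eta> * t) * (cis (- (2 * pi * \<eta> * y)) * G y)"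
      by simp
  qed
  finally show ?thesis by (simp add: fourier_def)
qed

context wavelet
begin

lemma gh_translate: "gh x \<omega> \<xi> = cis (- (2 * pi * x * \<xi>)) * gh 0 \<omega> \<xi>"
  by (simp add: gh_def)

lemma pw_translate: "pw x \<omega> t = pw 0 \<omega> (t - x)"
  by (simp add: pw_def pi_sigma_eq)

lemma gh_cnj: "gh 0 \<omega> \<xi> * cnj (gh 0 \<omega> \<xi>) = P 0 (b \<omega> * (\<xi> - \<omega>)) * of_real (b \<omega> ^ Suc 0)"
  using beta_pos[of \<alpha> \<omega>] of_real_mult[of "sqrt (b \<omega>)" "sqrt (b \<omega>)", symmetric, where 'a=complex]
  by (simp add: gh_def P_def del: of_real_mult)

text \<open>For fixed \<omega>' the wavelets differ only by translation, so the x'-integral is a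
  convolution. The multiplication formula moves it to the frequency side, where the two copies of
  the generator at \<omega>' combine to the squared modulus \<open>P 0\<close>.\<close>

lemma convolution_slice:
  "(LINT x'|lborel. R x \<omega> x' \<omega>' * pw x' \<omega>' t) =
   (LINT \<xi>|lborel. cis (2 * pi * t * \<xi>) * (gh x \<omega> \<xi> * N 0 \<xi>) * (P 0 (b \<omega>' * (\<xi> - \<omega>')) * of_real (b \<omega>' ^ Suc 0)))"
proof -
  let ?f = "\<lambda>\<xi>. gh x \<omega> \<xi> * N 0 \<xi> * cnj (gh 0 \<omega>' \<xi>)"
  have f: "integrable lborel ?f" by (rule R_integrand_integrable)
  have R: "R x \<omega> x' \<omega>' = ifourier ?f x'" for x'
    unfolding R_def ifourier_def
    by (intro Bochner_Integration.integral_cong refl) (subst (2) gh_translate, simp add: cis_cnj mult_ac)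
  have h: "integrable lborel (\<lambda>x'. pw 0 \<omega>' (t - x'))"
    using lborel_integrable_real_affine[OF pw_integrable[of 0 \<omega>'], of "-1" t] by simp
  have "(LINT x'|lborel. R x \<omega> x' \<omega>' * pw x' \<omega>' t) = (LINT x'|lborel. ifourier ?f x' * pw 0 \<omega>' (t - x'))"
    by (simp only: R pw_translate[of _ \<omega>' t])
  also have "\<dots> = (LINT \<eta>|lborel. ?f \<eta> * ifourier (\<lambda>x'. pw 0 \<omega>' (t - x')) \<eta>)"
    by (rule ifourier_swap[OF f h])
  also have "\<dots> = (LINT \<eta>|lborel. cis (2 * pi * t * \<eta>) * (gh x \<omega> \<eta> * N 0 \<eta>) * (gh 0 \<omega>' \<eta> * cnj (gh 0 \<omega>' \<eta>)))"
    unfolding ifourier_reflect_translate fourier_pw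
    by (intro Bochner_Integration.integral_cong refl) (simp add: mult_ac)
  finally show ?thesis by (simp only: gh_cnj)
qed

lemma norm_N0_m: "cmod (N 0 \<xi>) * m \<xi> = 1"
proof -
  have "m \<xi> > 0" using m_lower by (meson less_le_trans)
  then have "cmod (N 0 \<xi>) * m \<xi> = cmod (N 0 \<xi> * M 0 \<xi>)" by (simp add: norm_mult M0_eq)
  then show ?thesis by (simp add: N0_M0)
qed

text \<open>Integrating the squared moduli over \<omega>' rebuilds the symbol, which cancels against
  \<open>N 0\<close>. By \<open>norm_N0_m\<close> the absolute integral over \<omega>' is exactly
  the modulus of \<open>gh\<close>, and this justifies Fubini.\<close>

lemma frequency_resolution:
  "(LINT \<omega>'|lborel. LINT \<xi>|lborel. cis (2 * pi * t * \<xi>) * (gh x \<omega> \<xi> * N 0 \<xi>) * (P 0 (b \<omega>' * (\<xi> - \<omega>')) * of_real (b \<omega>' ^ Suc 0))) = pw x \<omega> t"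
proof -
  let ?A = "\<lambda>\<xi>. cis (2 * pi * t * \<xi>) * (gh x \<omega> \<xi> * N 0 \<xi>)"
  let ?Y = "\<lambda>\<xi> \<omega>'. P 0 (b \<omega>' * (\<xi> - \<omega>')) * of_real (b \<omega>' ^ Suc 0)"
  have [measurable]: "P 0 \<in> borel_measurable borel" by (rule P_measurable) simp
  have int: "integrable (lborel \<Otimes>\<^sub>M lborel) (\<lambda>(\<xi>, \<omega>'). ?A \<xi> * ?Y \<xi> \<omega>')"
  proof (rule lborel_pair.Fubini_integrable)
    have "(LINT \<omega>'|lborel. norm (?A \<xi> * ?Y \<xi> \<omega>')) = cmod (gh x \<omega> \<xi>)" for \<xi>
    proof -
      have "(LINT \<omega>'|lborel. norm (?A \<xi> * ?Y \<xi> \<omega>')) = (LINT \<omega>'|lborel. cmod (?A \<xi>) * ((cmod (g 0 (b \<omega>' * (\<xi> - \<omega>'))))\<^sup>2 * b \<omega>'))"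
        using beta_pos[of \<alpha>]
        by (intro Bochner_Integration.integral_cong refl) (simp add: norm_mult P_def abs_of_pos power2_eq_square)
      also have "\<dots> = cmod (?A \<xi>) * m \<xi>" by (simp add: m_def)
      also have "\<dots> = cmod (gh x \<omega> \<xi>) * (cmod (N 0 \<xi>) * m \<xi>)" by (simp add: norm_mult)
      finally show ?thesis by (simp add: norm_N0_m)
    qed
    then show "integrable lborel (\<lambda>\<xi>. LINT \<omega>'|lborel. norm (case (\<xi>, \<omega>') of (\<xi>, \<omega>') \<Rightarrow> ?A \<xi> * ?Y \<xi> \<omega>'))"
      using gh_integrable by simp
    show "AE \<xi> in lborel. integrable lborel (\<lambda>\<omega>'. case (\<xi>, \<omega>') of (\<xi>, \<omega>') \<Rightarrow> ?A \<xi> * ?Y \<xi> \<omega>')"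
      using M_integrable[of 0] by (intro AE_I2) (simp del: power_Suc)
  qed measurable
  have "(LINT \<omega>'|lborel. LINT \<xi>|lborel. ?A \<xi> * ?Y \<xi> \<omega>') = (LINT \<xi>|lborel. LINT \<omega>'|lborel. ?A \<xi> * ?Y \<xi> \<omega>')"
    by (rule lborel_pair.Fubini_integral[OF int])
  also have "\<dots> = (LINT \<xi>|lborel. ?A \<xi> * M 0 \<xi>)"
    unfolding M_def by (simp del: power_Suc)
  also have "\<dots> = ifourier (gh x \<omega>) t"
    unfolding ifourier_def
  proof (rule Bochner_Integration.integral_cong[OF refl])
    fix \<xi>
    have "?A \<xi> * M 0 \<xi> = cis (2 * pi * t * \<xi>) * gh x \<omega> \<xi> * (N 0 \<xi> * M 0 \<xi>)" by (simp only: mult.assoc)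
    then show "?A \<xi> * M 0 \<xi> = cis (2 * pi * t * \<xi>) * gh x \<omega> \<xi>" by (simp add: N0_M0)
  qed
  finally show ?thesis by (simp add: pw_eq_ifourier)
qed

text \<open>Integrability over the plane is assumed at the single point t;
  \<open>reconstruction_weak\<close> supplies it for almost every t at which its test function does
  not vanish.\<close>

lemma reconstruction_pointwise:
  assumes "integrable (lborel \<Otimes>\<^sub>M lborel) (\<lambda>z. R x \<omega> (fst z) (snd z) * pw (fst z) (snd z) t)"
  shows "(LINT z|(lborel \<Otimes>\<^sub>M lborel). R x \<omega> (fst z) (snd z) * pw (fst z) (snd z) t) = pw x \<omega> t"
proof -
  have "(LINT \<omega>'|lborel. LINT x'|lborel. R x \<omega> x' \<omega>' * pw x' \<omega>' t) = (LINT z|(lborel \<Otimes>\<^sub>M lborel). R x \<omega> (fst z) (snd z) * pw (fst z) (snd z) t)"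
    using lborel_pair.integral_snd[of "\<lambda>x' \<omega>'. R x \<omega> x' \<omega>' * pw x' \<omega>' t"] assms by (simp add: case_prod_unfold)
  then show ?thesis by (simp only: convolution_slice frequency_resolution)
qed

lemma pw_inner_bound:
  assumes h: "L2 h"
  shows "(LINT t|lborel. cmod (pw x \<omega> t * cnj (h t))) \<le> (LINT t|lborel. (cmod (\<psi>1 t))\<^sup>2) + (LINT t|lborel. (cmod (h t))\<^sup>2)"
    "integrable lborel (\<lambda>t. pw x \<omega> t * cnj (h t))"
proof -
  have hc: "L2 (\<lambda>t. cnj (h t))" using h by (auto simp: L2_def)
  show i: "integrable lborel (\<lambda>t. pw x \<omega> t * cnj (h t))" by (rule L2_mult_integrable[OF pw_L2 hc])
  have "(LINT t|lborel. cmod (pw x \<omega> t * cnj (h t))) \<le> (LINT t|lborel. (cmod (pw x \<omega> t))\<^sup>2 + (cmod (h t))\<^sup>2)"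
  proof (rule integral_mono)
    show "cmod (pw x \<omega> t * cnj (h t)) \<le> (cmod (pw x \<omega> t))\<^sup>2 + (cmod (h t))\<^sup>2" for t
      using sum_squares_bound[of "cmod (pw x \<omega> t)" "cmod (h t)"] mult_nonneg_nonneg[OF norm_ge_zero norm_ge_zero, of "pw x \<omega> t" "h t"]
      by (simp only: mult.assoc norm_mult complex_mod_cnj)
  qed (use i pw_L2[of x \<omega>] h in \<open>auto simp: L2_def\<close>)
  also have "\<dots> = (LINT t|lborel. (cmod (pw x \<omega> t))\<^sup>2) + (LINT t|lborel. (cmod (h t))\<^sup>2)"
    using pw_L2[of x \<omega>] h by (intro Bochner_Integration.integral_add) (auto simp: L2_def)
  finally show "(LINT t|lborel. cmod (pw x \<omega> t * cnj (h t))) \<le> (LINT t|lborel. (cmod (\<psi>1 t))\<^sup>2) + (LINT t|lborel. (cmod (h t))\<^sup>2)"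
    by (simp only: pw_L2_norm)
qed

text \<open>On plane times line the integrand is \<open>R\<close> times the product of
  \<open>pw\<close> and the conjugate of \<open>h\<close>. The first factor is integrable over the
  plane and the second has uniformly bounded t-integrals, so Fubini reduces the weak identity to the
  pointwise one.\<close>

lemma reconstruction_weak:
  assumes h: "L2 h"
  shows "integrable (lborel \<Otimes>\<^sub>M lborel) (\<lambda>z. R x \<omega> (fst z) (snd z) * L2_inner (pw (fst z) (snd z)) h)"
    "L2_inner (pw x \<omega>) h = (LINT z|(lborel \<Otimes>\<^sub>M lborel). R x \<omega> (fst z) (snd z) * L2_inner (pw (fst z) (snd z)) h)"
proof -
  have hm[measurable]: "h \<in> borel_measurable borel" using h by (simp add: L2_def)
  let ?R = "\<lambda>z. R x \<omega> (fst z) (snd z)"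
  let ?p = "\<lambda>z t. pw (fst z) (snd z) t"
  let ?Q = "(LINT t|lborel. (cmod (\<psi>1 t))\<^sup>2) + (LINT t|lborel. (cmod (h t))\<^sup>2)"
  let ?L = "lborel \<Otimes>\<^sub>M lborel :: (real \<times> real) measure"
  have Ri: "integrable ?L ?R" using R_integrable[of x \<omega>] by (simp add: lborel_prod)
  interpret L: sigma_finite_measure ?L by (simp add: lborel_prod sigma_finite_lborel)
  interpret LP: pair_sigma_finite ?L "lborel :: real measure" ..
  let ?F = "\<lambda>z t. ?R z * (?p z t * cnj (h t))"
  have int: "integrable (?L \<Otimes>\<^sub>M lborel) (case_prod ?F)"
  proof (rule LP.Fubini_integrable)
    show "integrable ?L (\<lambda>z. LINT t|lborel. norm (case_prod ?F (z, t)))"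
    proof (rule Bochner_Integration.integrable_bound)
      show "integrable ?L (\<lambda>z. ?Q * cmod (?R z))" by (intro integrable_mult_right integrable_norm Ri)
      show "AE z in ?L. norm (LINT t|lborel. norm (case_prod ?F (z, t))) \<le> norm (?Q * cmod (?R z))"
      proof (rule AE_I2)
        fix z :: "real \<times> real"
        have "(LINT t|lborel. norm (case_prod ?F (z, t))) = cmod (?R z) * (LINT t|lborel. cmod (?p z t * cnj (h t)))"
          by (simp add: norm_mult)
        also have "\<dots> \<le> cmod (?R z) * ?Q" by (intro mult_left_mono pw_inner_bound[OF h]) simp
        finally have "(LINT t|lborel. norm (case_prod ?F (z, t))) \<le> ?Q * cmod (?R z)" by (simp only: mult.commute)
        moreover have "(LINT t|lborel. norm (case_prod ?F (z, t))) \<ge> 0" by (rule integral_nonneg_AE) simp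
        ultimately show "norm (LINT t|lborel. norm (case_prod ?F (z, t))) \<le> norm (?Q * cmod (?R z))"
          by (simp only: real_norm_def)
      qed
    qed measurable
    show "AE z in ?L. integrable lborel (\<lambda>t. case_prod ?F (z, t))"
      using pw_inner_bound(2)[OF h] by (intro AE_I2) simp
  qed measurable
  have inner: "(LINT t|lborel. ?F z t) = ?R z * L2_inner (?p z) h" for z
    by (simp add: L2_inner_def)
  show "integrable ?L (\<lambda>z. ?R z * L2_inner (?p z) h)"
    using LP.integrable_fst[OF int] by (simp only: inner)
  have ae: "AE t in lborel. integrable ?L (\<lambda>z. ?F z t)"
    by (rule LP.AE_integrable_snd[OF int])
  have sl: "(LINT z|?L. ?F z t) = pw x \<omega> t * cnj (h t)" if "integrable ?L (\<lambda>z. ?F z t)" for t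
  \<comment> \<open>Where \<open>h t\<close> vanishes both sides are 0; elsewhere that factor is
    divided out to reach the assumption of \<open>reconstruction_pointwise\<close>.\<close>
  proof (cases "h t = 0")
    case False
    have "integrable ?L (\<lambda>z. (?R z * ?p z t) * cnj (h t))" using that by (simp only: mult.assoc)
    then have "integrable ?L (\<lambda>z. (?R z * ?p z t) * cnj (h t) * inverse (cnj (h t)))"
      by (rule integrable_mult_left)
    moreover have "a * cnj (h t) * inverse (cnj (h t)) = a" for a using False by simp
    ultimately have "integrable ?L (\<lambda>z. ?R z * ?p z t)" by simp
    from reconstruction_pointwise[OF this] show ?thesis
      by (simp only: mult.assoc[symmetric] integral_mult_left_zero)
  qed simp
  have "(LINT z|?L. ?R z * L2_inner (?p z) h) = (LINT z|?L. LINT t|lborel. ?F z t)" by (simp only: inner)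
  moreover have "(LINT z|?L. LINT t|lborel. ?F z t) = (LINT t|lborel. LINT z|?L. ?F z t)"
    by (rule LP.Fubini_integral[OF int, symmetric])
  moreover have "(LINT t|lborel. LINT z|?L. ?F z t) = (LINT t|lborel. pw x \<omega> t * cnj (h t))"
  proof (rule integral_cong_AE)
    show "AE t in lborel. (LINT z|?L. ?F z t) = pw x \<omega> t * cnj (h t)"
      using ae by eventually_elim (rule sl)
  qed measurable
  ultimately show "L2_inner (pw x \<omega>) h = (LINT z|?L. ?R z * L2_inner (?p z) h)" by (simp only: L2_inner_def)
qed

end

text \<open>The given \<psi> agrees with its continuous representative only almost everywhere. This
  suffices, since the frame operator and the kernel see the transformed wavelets through inner
  products alone.\<close>

locale wavelet_generator = wavelet +
  fixes \<psi> :: "real \<Rightarrow> complex"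
  assumes \<psi>_L2: "L2 \<psi>" and \<psi>_AE: "AE t in lborel. \<psi> t = \<psi>1 t"
begin

lemma pi_AE: "AE t in lborel. pi_sigma \<alpha> x \<omega> \<psi> t = pw x \<omega> t"
proof -
  have "AE t in lborel. \<psi> (- x / b \<omega> + 1 / b \<omega> * t) = \<psi>1 (- x / b \<omega> + 1 / b \<omega> * t)"
    using \<psi>_L2 \<psi>_AE beta_pos[of \<alpha> \<omega>] by (intro AE_lborel_affine) (auto simp: L2_def)
  then show ?thesis
    by eventually_elim (simp add: pi_sigma_eq pw_def diff_divide_distrib)
qed

lemma pi_L2: "L2 (pi_sigma \<alpha> x \<omega> \<psi>)"
proof -
  have [measurable]: "\<psi> \<in> borel_measurable borel" using \<psi>_L2 by (simp add: L2_def)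
  have [measurable]: "pi_sigma \<alpha> x \<omega> \<psi> \<in> borel_measurable borel" unfolding pi_sigma_eq[abs_def] by measurable
  have "integrable lborel (\<lambda>t. (cmod (pi_sigma \<alpha> x \<omega> \<psi> t))\<^sup>2) \<longleftrightarrow> integrable lborel (\<lambda>t. (cmod (pw x \<omega> t))\<^sup>2)"
    by (rule integrable_cong_AE) (use pi_AE[of x \<omega>] in auto)
  with pw_L2[of x \<omega>] show ?thesis by (simp add: L2_def)
qed

lemma L2_inner_pi:
  assumes "L2 f"
  shows "L2_inner f (pi_sigma \<alpha> x \<omega> \<psi>) = L2_inner f (pw x \<omega>)"
    "L2_inner (pi_sigma \<alpha> x \<omega> \<psi>) f = L2_inner (pw x \<omega>) f"
  by (rule L2_inner_cong_AE[OF assms pi_L2 pw_L2 pi_AE])+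

lemma is_A_sigma_dual: "is_A_sigma \<alpha> \<psi> (dual x \<omega>) (pi_sigma \<alpha> x \<omega> \<psi>)"
  unfolding is_A_sigma_def
proof (intro conjI allI impI dual_L2 pi_L2)
  fix h assume h: "L2 h"
  have eq: "(\<lambda>(x', \<omega>'). L2_inner (dual x \<omega>) (pi_sigma \<alpha> x' \<omega>' \<psi>) * L2_inner (pi_sigma \<alpha> x' \<omega>' \<psi>) h) =
    (\<lambda>z. R x \<omega> (fst z) (snd z) * L2_inner (pw (fst z) (snd z)) h)"
    by (simp add: fun_eq_iff L2_inner_pi[OF dual_L2] L2_inner_pi[OF h] L2_inner_dual_pw)
  show "integrable lborel (\<lambda>(x', \<omega>'). L2_inner (dual x \<omega>) (pi_sigma \<alpha> x' \<omega>' \<psi>) * L2_inner (pi_sigma \<alpha> x' \<omega>' \<psi>) h)"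
    unfolding eq using reconstruction_weak(1)[OF h, of x \<omega>] by (simp only: lborel_prod)
  show "L2_inner (pi_sigma \<alpha> x \<omega> \<psi>) h =
    (LINT (x', \<omega>')|lborel. L2_inner (dual x \<omega>) (pi_sigma \<alpha> x' \<omega>' \<psi>) * L2_inner (pi_sigma \<alpha> x' \<omega>' \<psi>) h)"
    unfolding eq using reconstruction_weak(2)[OF h, of x \<omega>] by (simp only: L2_inner_pi[OF h] lborel_prod)
qed

text \<open>The chosen preimage is compared with the explicit one through the symmetry of the weak form, so that
  no uniqueness statement for \<open>A\<^sub>\<sigma>\<close> is needed.\<close>

lemma repr_kernel_eq: "repr_kernel \<alpha> \<psi> x \<omega> x' \<omega>' = R x \<omega> x' \<omega>'"
proof -
  define f where "f = A_sigma_inv \<alpha> \<psi> (pi_sigma \<alpha> x \<omega> \<psi>)"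
  have f: "is_A_sigma \<alpha> \<psi> f (pi_sigma \<alpha> x \<omega> \<psi>)"
    unfolding f_def A_sigma_inv_def
    by (rule someI[where P="\<lambda>f. is_A_sigma \<alpha> \<psi> f (pi_sigma \<alpha> x \<omega> \<psi>)", OF is_A_sigma_dual])
  then have fL: "L2 f" by (simp add: is_A_sigma_def)
  let ?k = "dual x' \<omega>'"
  let ?\<pi> = "\<lambda>z. pi_sigma \<alpha> (fst z) (snd z) \<psi>"
  \<comment> \<open>The equation for the explicit dual at (x', \<omega>') is tested with the chosen
    \<open>f\<close>, the equation for \<open>f\<close> with that dual; conjugation makes the two
    right-hand sides coincide.\<close>
  have 1: "L2_inner (pi_sigma \<alpha> x' \<omega>' \<psi>) f = (LINT z|lborel. L2_inner ?k (?\<pi> z) * L2_inner (?\<pi> z) f)"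
    using is_A_sigma_dual[of x' \<omega>'] fL by (simp add: is_A_sigma_def case_prod_unfold)
  have 2: "L2_inner (pi_sigma \<alpha> x \<omega> \<psi>) ?k = (LINT z|lborel. L2_inner f (?\<pi> z) * L2_inner (?\<pi> z) ?k)"
    using f dual_L2[of x' \<omega>'] by (simp add: is_A_sigma_def case_prod_unfold)
  have "L2_inner f (pi_sigma \<alpha> x' \<omega>' \<psi>) = cnj (LINT z|lborel. L2_inner ?k (?\<pi> z) * L2_inner (?\<pi> z) f)"
    unfolding 1[symmetric] by (rule L2_inner_cnj)
  also have "\<dots> = (LINT z|lborel. L2_inner f (?\<pi> z) * L2_inner (?\<pi> z) ?k)"
    unfolding Bochner_Integration.integral_cnj[symmetric] complex_cnj_mult L2_inner_cnj[symmetric]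
    by (simp only: mult.commute)
  also have "\<dots> = L2_inner (pi_sigma \<alpha> x \<omega> \<psi>) ?k" by (rule 2[symmetric])
  also have "\<dots> = cnj (L2_inner ?k (pw x \<omega>))"
    unfolding L2_inner_pi[OF dual_L2] by (rule L2_inner_cnj)
  also have "\<dots> = R x \<omega> x' \<omega>'" by (simp only: L2_inner_dual_pw R_cnj)
  finally show ?thesis by (simp add: repr_kernel_def f_def)
qed

end

section \<open>Oscillation of the kernel\<close>

lemma cis_minus_one_bound: "cmod (1 - cis \<theta>) \<le> \<bar>\<theta>\<bar>"
proof -
  have "norm (cis \<theta> - cis 0) \<le> 1 * norm (\<theta> - 0)"
  proof (rule differentiable_bound[of UNIV _ "\<lambda>z h. h *\<^sub>R (\<i> * cis z)"])
    show "(cis has_derivative (\<lambda>h. h *\<^sub>R (\<i> * cis z))) (at z within UNIV)" for z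
      using cis_has_vector_derivative[of 1 z UNIV] by (simp add: has_vector_derivative_def)
    show "onorm (\<lambda>h. h *\<^sub>R (\<i> * cis z)) \<le> 1" for z
      by (rule onorm_le) (simp add: norm_mult)
  qed auto
  then show ?thesis by (simp add: norm_minus_commute)
qed

context wavelet
begin

text \<open>Derivatives of order $k \le 2$ of
  $t \mapsto \rho^{1/2} e^{i\kappa t}\, \overline{\hat\psi(\rho(t+\tau))}$.\<close>

definition pert :: "real \<Rightarrow> real \<Rightarrow> real \<Rightarrow> nat \<Rightarrow> real \<Rightarrow> complex" where
  "pert \<rho> \<tau> \<kappa> k t = (let y = \<rho> * (t + \<tau>); e = of_real (sqrt \<rho>) * cis (\<kappa> * t) in
     if k = 0 then e * cnj (g 0 y)
     else if k = 1 then e * (of_real \<rho> * cnj (g 1 y) + \<i> * of_real \<kappa> * cnj (g 0 y))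
     else e * (of_real (\<rho>\<^sup>2) * cnj (g 2 y) + 2 * \<i> * of_real (\<kappa> * \<rho>) * cnj (g 1 y) - of_real (\<kappa>\<^sup>2) * cnj (g 0 y)))"

lemma pert_deriv:
  assumes "k < 2"
  shows "(pert \<rho> \<tau> \<kappa> k has_vector_derivative pert \<rho> \<tau> \<kappa> (Suc k) t) (at t)"
proof -
  have G: "((\<lambda>t. cnj (g n (\<rho> * (t + \<tau>)))) has_vector_derivative of_real \<rho> * cnj (g (Suc n) (\<rho> * (t + \<tau>)))) (at t)" if "n < 3" for n
  proof -
    have "((\<lambda>t. \<rho> * (t + \<tau>)) has_real_derivative \<rho>) (at t)" by (auto intro!: derivative_eq_intros)
    from vector_diff_chain_at[OF this[unfolded has_real_derivative_iff_has_vector_derivative] has_vector_derivative_cnj[OF g_deriv[OF that]]]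
    show ?thesis by (simp add: comp_def scaleR_conv_of_real)
  qed
  have G0: "((\<lambda>t. cnj (g 0 (\<rho> * (t + \<tau>)))) has_vector_derivative of_real \<rho> * cnj (g 1 (\<rho> * (t + \<tau>)))) (at t)"
    and G1: "((\<lambda>t. cnj (g 1 (\<rho> * (t + \<tau>)))) has_vector_derivative of_real \<rho> * cnj (g 2 (\<rho> * (t + \<tau>)))) (at t)"
    using G[of 0] G[of 1] by (auto simp: numeral_2_eq_2)
  have e: "((\<lambda>t. of_real (sqrt \<rho>) * cis (\<kappa> * t)) has_vector_derivative of_real (sqrt \<rho>) * (\<i> * of_real \<kappa> * cis (\<kappa> * t))) (at t)"
    by (intro has_vector_derivative_mult_right cis_has_vector_derivative)
  consider "k = 0" | "k = 1" using assms by linarith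
  then show ?thesis
  proof cases
    case 1
    with has_vector_derivative_mult[OF e G0] show ?thesis
      by (simp add: pert_def[abs_def] Let_def algebra_simps)
  next
    case 2
    have "((\<lambda>t. of_real \<rho> * cnj (g 1 (\<rho> * (t + \<tau>))) + \<i> * of_real \<kappa> * cnj (g 0 (\<rho> * (t + \<tau>)))) has_vector_derivative
       of_real \<rho> * (of_real \<rho> * cnj (g 2 (\<rho> * (t + \<tau>)))) + \<i> * of_real \<kappa> * (of_real \<rho> * cnj (g 1 (\<rho> * (t + \<tau>))))) (at t)"
      by (intro has_vector_derivative_add has_vector_derivative_mult_right G0 G1)
    from has_vector_derivative_mult[OF e this] 2 show ?thesis
      by (simp add: pert_def[abs_def] Let_def algebra_simps power2_eq_square)
  qed
qed

text \<open>The mean value inequality multiplies the derivative of order k + 1, which is O((1 +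
  |t|)^(-r)) on the whole segment, by |y - t|. That distance is small only relative to 1 + |t|,
  which explains the lost power.\<close>

lemma g_difference:
  assumes k: "k \<le> 2" and yt: "\<bar>y - t\<bar> \<le> 2 * \<delta> * (1 + \<bar>t\<bar>)" and \<delta>: "0 \<le> \<delta>" "\<delta> \<le> 1/4"
  shows "cmod (g k t - g k y) \<le> 2 * \<delta> * (2 powr r * C) * (1 + \<bar>t\<bar>) powr - (r - 1)"
    "cmod (g k y) \<le> 2 powr r * C * (1 + \<bar>t\<bar>) powr - r"
proof -
  define w where "w = 1 + \<bar>t\<bar>"
  have w: "w \<ge> 1" by (simp add: w_def)
  have "2 * \<delta> * w \<le> 1/2 * w" using \<delta> w by (intro mult_right_mono) auto
  \<comment> \<open>Points \<open>z\<close> at most w / 2 away from \<open>t\<close> satisfy 1 + |z|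
    \<ge> w / 2; this is the origin of the constant 2^r.\<close>
  with yt have yt2: "\<bar>y - t\<bar> \<le> w / 2" by (simp add: w_def)
  have bd: "cmod (g n z) \<le> 2 powr r * C * w powr - r" if "n \<le> 3" "\<bar>z - t\<bar> \<le> w / 2" for n z
  proof -
    have "\<bar>t\<bar> \<le> \<bar>z\<bar> + \<bar>z - t\<bar>" using abs_triangle_ineq4[of z "z - t"] by simp
    with that(2) have "1 + \<bar>z\<bar> \<ge> w / 2" by (simp add: w_def field_simps)
    then have "(1 + \<bar>z\<bar>) powr - r \<le> (w / 2) powr - r" using w r_ge by (intro powr_mono2') auto
    also have "\<dots> = 2 powr r * w powr - r" using w by (simp add: powr_divide powr_minus field_simps)
    finally have "C * (1 + \<bar>z\<bar>) powr - r \<le> C * (2 powr r * w powr - r)" using C by (intro mult_left_mono) auto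
    with g_bound[OF that(1), of z] show ?thesis by (simp add: mult_ac)
  qed
  show "cmod (g k y) \<le> 2 powr r * C * (1 + \<bar>t\<bar>) powr - r"
    using bd[of k y] k yt2 by (simp add: w_def)
  have "norm (g k t - g k y) \<le> (2 powr r * C * w powr - r) * norm (t - y)"
  proof (rule differentiable_bound[of "closed_segment t y" _ "\<lambda>z h. h *\<^sub>R g (Suc k) z"])
    show "(g k has_derivative (\<lambda>h. h *\<^sub>R g (Suc k) z)) (at z within closed_segment t y)" for z
      using has_vector_derivative_at_within[OF g_deriv[of k z]] k by (simp add: has_vector_derivative_def)
    show "onorm (\<lambda>h. h *\<^sub>R g (Suc k) z) \<le> 2 powr r * C * w powr - r" if "z \<in> closed_segment t y" for z
    proof (rule onorm_le)
      have "\<bar>z - t\<bar> \<le> \<bar>y - t\<bar>"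
        using that by (auto simp: closed_segment_eq_real_ivl split: if_splits)
      then have bdz: "cmod (g (Suc k) z) \<le> 2 powr r * C * w powr - r" using k yt2 by (intro bd) auto
      show "norm (h *\<^sub>R g (Suc k) z) \<le> 2 powr r * C * w powr - r * norm h" for h
        using mult_right_mono[OF bdz abs_ge_zero[of h]] by (simp add: mult.commute)
    qed
  qed auto
  also have "\<dots> \<le> (2 powr r * C * w powr - r) * (2 * \<delta> * w)"
    using yt C by (intro mult_left_mono) (auto simp: w_def abs_minus_commute)
  also have "\<dots> = 2 * \<delta> * (2 powr r * C) * (w powr - r * w powr 1)" using w by simp
  also have "w powr - r * w powr 1 = w powr - (r - 1)" by (simp only: powr_add[symmetric]) simp
  finally show "cmod (g k t - g k y) \<le> 2 * \<delta> * (2 powr r * C) * (1 + \<bar>t\<bar>) powr - (r - 1)"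
    by (simp add: w_def)
qed

text \<open>In the derivative of order k the part \<open>?A k\<close> collects the terms with the
  k-th derivative of \<open>g\<close>; the other terms carry a factor \<kappa> and are small for
  that reason. In \<open>?A k\<close> the change of argument contributes 2 \<delta> and the change
  of the prefactor 6 \<delta>. The terms with \<kappa> contribute at most 4 \<delta>, whence
  12.\<close>

lemma pert_decaying:
  assumes \<rho>: "\<bar>\<rho> - 1\<bar> \<le> \<delta>" and \<tau>: "\<bar>\<tau>\<bar> \<le> \<delta>" and \<kappa>: "\<bar>\<kappa>\<bar> \<le> \<delta>" and \<delta>: "\<delta> \<le> 1/4"
  shows "decaying (\<lambda>k t. cnj (g k t) - pert \<rho> \<tau> \<kappa> k t) (12 * (2 powr r * C) * \<delta>) (r - 1)"
  unfolding decaying_def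
proof (intro conjI allI impI)
  have \<delta>0: "\<delta> \<ge> 0" using \<tau> by linarith
  have \<rho>1: "\<rho> \<ge> 3/4" "\<rho> \<le> 5/4" using \<rho> \<delta> by (auto simp: abs_le_iff)
  let ?C = "2 powr r * C"
  have Cp: "?C \<ge> 0" using C by simp
  show "0 \<le> 12 * ?C * \<delta>" using Cp \<delta>0 by simp
  show "0 \<le> r - 1" using r_ge by simp
  show "((\<lambda>t. cnj (g k t) - pert \<rho> \<tau> \<kappa> k t) has_vector_derivative cnj (g (Suc k) t) - pert \<rho> \<tau> \<kappa> (Suc k) t) (at t)" if "k < 2" for k t
    using that by (intro has_vector_derivative_diff has_vector_derivative_cnj g_deriv pert_deriv) auto
  have gc: "continuous_on UNIV (\<lambda>t. g n (\<rho> * (t + \<tau>)))" if "n \<le> 3" for n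
    by (intro continuous_on_compose2[OF g_cont[OF that]] continuous_intros) auto
  show "continuous_on UNIV (\<lambda>t. cnj (g 2 t) - pert \<rho> \<tau> \<kappa> 2 t)"
    unfolding pert_def Let_def cis_conv_exp using gc[of 0] gc[of 1] gc[of 2] g_cont[of 2] by (auto intro!: continuous_intros)
  fix k :: nat and t :: real
  assume k: "k \<le> 2"
  define w where "w = 1 + \<bar>t\<bar>"
  have w: "w \<ge> 1" "\<bar>t\<bar> \<le> w" by (auto simp: w_def)
  define y where "y = \<rho> * (t + \<tau>)"
  have "y - t = (\<rho> - 1) * t + \<rho> * \<tau>" by (simp add: y_def algebra_simps)
  then have "\<bar>y - t\<bar> \<le> \<bar>\<rho> - 1\<bar> * \<bar>t\<bar> + \<bar>\<rho>\<bar> * \<bar>\<tau>\<bar>"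
    using abs_triangle_ineq[of "(\<rho> - 1) * t" "\<rho> * \<tau>"] by (simp add: abs_mult)
  also have "\<dots> \<le> \<delta> * \<bar>t\<bar> + 2 * \<delta>" using \<rho> \<rho>1 \<tau> \<delta>0 by (intro add_mono mult_mono) auto
  also have "\<dots> \<le> 2 * \<delta> * (1 + \<bar>t\<bar>)" using \<delta>0 by (simp add: algebra_simps)
  finally have yt: "\<bar>y - t\<bar> \<le> 2 * \<delta> * (1 + \<bar>t\<bar>)" .
  note gd = g_difference(1)[OF _ yt \<delta>0 \<delta>, folded w_def] and gy = g_difference(2)[OF _ yt \<delta>0 \<delta>, folded w_def]
  let ?v = "cnj (g k t) - pert \<rho> \<tau> \<kappa> k t" and ?p = "2 * \<i> * of_real (\<kappa> * \<rho>) * cnj (g 1 y)" and ?p' = "of_real (\<kappa>\<^sup>2) * cnj (g 0 y)"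
  let ?W = "?C * w powr - (r - 1)"
  have W0: "?W \<ge> 0" using Cp by simp
  have wr: "w powr - r \<le> w powr - (r - 1)" using w by (intro powr_mono) auto
  have wr1: "w * w powr - r = w powr - (r - 1)"
    using w powr_add[of w 1 "- r"] by simp
  define e where "e = complex_of_real (sqrt \<rho>) * cis (\<kappa> * t)"
  let ?A = "\<lambda>j. (cnj (g j t) - cnj (g j y)) + (1 - of_real (\<rho> ^ j) * e) * cnj (g j y)"
  have sq: "sqrt \<rho> \<le> 5/4" using \<rho>1 by (intro real_le_lsqrt) (auto simp: power2_eq_square)
  have sq1: "\<bar>sqrt \<rho> - 1\<bar> \<le> \<delta>"
  proof -
    have "(sqrt \<rho> - 1) * (sqrt \<rho> + 1) = \<rho> - 1" using \<rho>1 by (simp add: algebra_simps)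
    then have "\<bar>sqrt \<rho> - 1\<bar> * \<bar>sqrt \<rho> + 1\<bar> = \<bar>\<rho> - 1\<bar>" by (metis abs_mult)
    moreover have "\<bar>sqrt \<rho> - 1\<bar> * 1 \<le> \<bar>sqrt \<rho> - 1\<bar> * \<bar>sqrt \<rho> + 1\<bar>"
      using \<rho>1 by (intro mult_left_mono) auto
    ultimately have "\<bar>sqrt \<rho> - 1\<bar> \<le> \<bar>\<rho> - 1\<bar>" by simp
    then show ?thesis using \<rho> by (rule order_trans)
  qed
  have ne: "cmod e \<le> 5/4" using sq \<rho>1 by (simp add: e_def norm_mult)
  \<comment> \<open>The prefactor is compared with 1 in three steps: power of \<rho>, square root of
    \<rho>, phase. The phase is controlled only by |\<kappa> t| \<le> \<delta> w, so this estimate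
    also spends one power of w.\<close>
  have e1: "cmod (1 - of_real (\<rho> ^ j) * e) \<le> 6 * \<delta> * w" if j: "j \<le> 2" for j
  proof -
    have \<rho>j: "\<bar>\<rho> ^ j - 1\<bar> \<le> 9/4 * \<delta>" "0 \<le> \<rho> ^ j" "\<rho> ^ j \<le> 25/16"
    proof -
      have 2: "\<bar>\<rho>\<^sup>2 - 1\<bar> \<le> 9/4 * \<delta>"
      proof -
        have "\<rho>\<^sup>2 - 1 = (\<rho> - 1) * (\<rho> + 1)" by (simp add: power2_eq_square algebra_simps)
        then have "\<bar>\<rho>\<^sup>2 - 1\<bar> = \<bar>\<rho> - 1\<bar> * \<bar>\<rho> + 1\<bar>" by (simp add: abs_mult)
        also have "\<dots> \<le> \<delta> * (9/4)" using \<rho> \<rho>1 by (intro mult_mono) auto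
        finally show ?thesis by simp
      qed
      have 3: "\<rho>\<^sup>2 \<le> 25/16" using power_mono[of \<rho> "5/4" 2] \<rho>1 by (simp add: power2_eq_square)
      consider "j = 0" | "j = 1" | "j = 2" using j by linarith
      then show "\<bar>\<rho> ^ j - 1\<bar> \<le> 9/4 * \<delta>" "0 \<le> \<rho> ^ j" "\<rho> ^ j \<le> 25/16"
        using 2 3 \<rho> \<rho>1 \<delta>0 by (cases; simp)+
    qed
    have "1 - of_real (\<rho> ^ j) * e = of_real (1 - \<rho> ^ j) + of_real (\<rho> ^ j * (1 - sqrt \<rho>)) + of_real (\<rho> ^ j * sqrt \<rho>) * (1 - cis (\<kappa> * t))"
      by (simp add: e_def algebra_simps)
    also have "cmod \<dots> \<le> \<bar>1 - \<rho> ^ j\<bar> + \<bar>\<rho> ^ j * (1 - sqrt \<rho>)\<bar> + \<bar>\<rho> ^ j * sqrt \<rho>\<bar> * cmod (1 - cis (\<kappa> * t))"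
      by (intro norm_triangle_mono) (auto simp: norm_mult simp del: of_real_mult of_real_diff of_real_power)
    also have "\<dots> \<le> 9/4 * \<delta> + 25/16 * \<delta> + (25/16 * (5/4)) * (\<delta> * w)"
    proof (intro add_mono)
      show "\<bar>1 - \<rho> ^ j\<bar> \<le> 9/4 * \<delta>" using \<rho>j by (simp add: abs_minus_commute)
      show "\<bar>\<rho> ^ j * (1 - sqrt \<rho>)\<bar> \<le> 25/16 * \<delta>"
        unfolding abs_mult using \<rho>j sq1 by (intro mult_mono) (auto simp: abs_minus_commute)
      have "\<bar>\<kappa> * t\<bar> \<le> \<delta> * w" unfolding abs_mult using \<kappa> w \<delta>0 by (intro mult_mono) auto
      then have "cmod (1 - cis (\<kappa> * t)) \<le> \<delta> * w" using cis_minus_one_bound[of "\<kappa> * t"] by linarith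
      moreover have "\<bar>\<rho> ^ j * sqrt \<rho>\<bar> \<le> 25/16 * (5/4)"
        unfolding abs_mult using \<rho>j sq \<rho>1 by (intro mult_mono) auto
      ultimately show "\<bar>\<rho> ^ j * sqrt \<rho>\<bar> * cmod (1 - cis (\<kappa> * t)) \<le> (25/16 * (5/4)) * (\<delta> * w)"
        by (intro mult_mono) auto
    qed
    \<comment> \<open>The sum 9/4 + 25/16 + 125/64 is less than 6, and w \<ge> 1.\<close>
    also have "\<dots> \<le> 6 * (\<delta> * w)" using mult_left_mono[OF w(1) \<delta>0] \<delta>0 by simp
    finally show ?thesis by simp
  qed
  have main: "cmod (?A j) \<le> 8 * \<delta> * ?W" if "j \<le> 2" for j
  proof -
    have "cmod (cnj (g j t) - cnj (g j y)) \<le> 2 * \<delta> * ?W"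
      using gd[OF that] by (simp add: complex_cnj_diff[symmetric] mult_ac del: complex_cnj_diff)
    moreover have "cmod ((1 - of_real (\<rho> ^ j) * e) * cnj (g j y)) \<le> 6 * \<delta> * ?W"
    proof -
      have "cmod (1 - of_real (\<rho> ^ j) * e) * cmod (cnj (g j y)) \<le> (6 * \<delta> * w) * (?C * w powr - r)"
        using gy[OF that] e1[OF that] \<delta>0 w by (intro mult_mono) auto
      also have "\<dots> = 6 * \<delta> * (?C * (w * w powr - r))" by (simp only: mult_ac)
      finally show ?thesis by (simp only: wr1 norm_mult)
    qed
    ultimately show ?thesis
      using norm_triangle_ineq[of "cnj (g j t) - cnj (g j y)" "(1 - of_real (\<rho> ^ j) * e) * cnj (g j y)"] by simp
  qed
  have gyW: "cmod (cnj (g j y)) \<le> ?W" if "j \<le> 2" for j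
    using order_trans[OF gy[OF that] mult_left_mono[OF wr Cp]] by (simp only: complex_mod_cnj)
  have \<kappa>2: "\<kappa>\<^sup>2 \<le> \<delta> / 4"
  proof -
    have "\<bar>\<kappa>\<bar> * \<bar>\<kappa>\<bar> \<le> \<delta> * (1/4)" using \<kappa> \<delta> by (intro mult_mono) auto
    then show ?thesis by (simp add: power2_eq_square)
  qed
  have "cmod (?v) \<le> 12 * \<delta> * ?W"
  proof -
    consider "k = 0" | "k = 1" | "k = 2" using k by linarith
    then show ?thesis
    proof cases
      case 1
      then have "?v = ?A 0"
        by (simp add: pert_def Let_def e_def y_def algebra_simps)
      then have "cmod (?v) \<le> 8 * \<delta> * ?W" using main[of 0] by simp
      also have "\<dots> \<le> 12 * \<delta> * ?W" using \<delta>0 W0 by (intro mult_right_mono) auto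
      finally show ?thesis .
    next
      case 2
      have eq: "?v = (?A 1) - e * (\<i> * of_real \<kappa>) * cnj (g 0 y)"
        using 2 by (simp add: pert_def Let_def e_def y_def algebra_simps)
      have "cmod (e * (\<i> * of_real \<kappa>) * cnj (g 0 y)) \<le> 5/4 * \<delta> * ?W"
        unfolding norm_mult[of "e * (\<i> * of_real \<kappa>)"] norm_mult[of e] using ne \<kappa> \<delta>0 gyW[of 0]
        by (intro mult_mono) (auto simp: norm_mult)
      also have "\<dots> \<le> 4 * \<delta> * ?W" using \<delta>0 W0 by (intro mult_right_mono) auto
      finally show ?thesis unfolding eq
        using main[of 1] norm_triangle_ineq4[of "?A 1" "e * (\<i> * of_real \<kappa>) * cnj (g 0 y)"]
        by simp
    next
      case 3
      have eq: "?v = (?A 2) - e * (?p - ?p')"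
        using 3 by (simp add: pert_def Let_def e_def y_def algebra_simps)
      have a: "cmod (?p) \<le> 5/2 * \<delta> * ?W"
      proof -
        have "cmod (2 * \<i> * of_real (\<kappa> * \<rho>)) \<le> 5/2 * \<delta>"
          using mult_mono[OF \<kappa> \<rho>1(2)] \<rho>1 \<delta>0 by (simp add: norm_mult abs_mult)
        then show ?thesis unfolding norm_mult[of "2 * \<i> * of_real (\<kappa> * \<rho>)"] using gyW[of 1] \<delta>0 by (intro mult_mono) auto
      qed
      have b': "cmod (?p') \<le> \<delta> / 4 * ?W"
        unfolding norm_mult using \<kappa>2 gyW[of 0] \<delta>0 by (intro mult_mono) (auto simp: norm_power)
      have "cmod (?p - ?p') \<le> 5/2 * \<delta> * ?W + \<delta> / 4 * ?W"
        by (rule order_trans[OF norm_triangle_ineq4 add_mono[OF a b']])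
      then have "cmod (e * (?p - ?p')) \<le> 5/4 * (5/2 * \<delta> * ?W + \<delta> / 4 * ?W)"
        unfolding norm_mult[of e] using ne by (intro mult_mono) auto
      also have "\<dots> = 55/16 * \<delta> * ?W" by (simp add: algebra_simps)
      also have "\<dots> \<le> 4 * \<delta> * ?W" using \<delta>0 W0 by (intro mult_right_mono) auto
      finally show ?thesis unfolding eq
        using main[of 2] norm_triangle_ineq4[of "?A 2" "e * (?p - ?p')"]
        by simp
    qed
  qed
  then show "cmod (?v) \<le> 12 * ?C * \<delta> * (1 + \<bar>t\<bar>) powr - (r - 1)"
    by (simp add: w_def mult_ac)
qed


section \<open>Comparison of the kernel at neighbouring points\<close>

definition \<Gamma>0 :: "(real \<times> real) \<times> (real \<times> real) \<Rightarrow> complex" where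
  "\<Gamma>0 z = cis (2 * pi * (fst (fst z) - fst (snd z)) * snd (fst z))"

lemma \<Gamma>0_measurable: "\<Gamma>0 \<in> borel_measurable borel"
  unfolding \<Gamma>0_def[abs_def] cis_conv_exp by (intro borel_measurable_continuous_onI continuous_intros)

text \<open>In the variable t = \<beta>(\<omega>') (\<xi> - \<omega>') the wavelet at (y, \<eta>) is
  the one at (x', \<omega>') with dilation \<rho>, shift \<tau> and modulation \<kappa>, once
  \<open>\<Gamma>0\<close> has cancelled the constant phase 2 pi (y - x') \<omega>'. So
  \<open>kernel_bound\<close> applies with the same scale S as for the kernel itself.\<close>

lemma R_difference_eq:
  fixes x \<omega> x' \<omega>' y \<eta>
  defines "\<rho> \<equiv> b \<eta> / b \<omega>'" and "\<tau> \<equiv> b \<omega>' * (\<omega>' - \<eta>)" and "\<kappa> \<equiv> 2 * pi * (y - x') / b \<omega>'"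
  shows "R x \<omega> x' \<omega>' - \<Gamma>0 ((x', \<omega>'), (y, \<eta>)) * R x \<omega> y \<eta> =
    of_real (S \<omega> \<omega>') * ifourier (integrand \<omega> \<omega>' (\<lambda>k t. cnj (g k t) - pert \<rho> \<tau> \<kappa> k t) 0) (x' - x)"
proof -
  have b: "b \<omega>' > 0" "b \<eta> > 0" by (auto simp: beta_pos)
  let ?I = "\<lambda>x' \<omega>' \<xi>. gh x \<omega> \<xi> * N 0 \<xi> * cnj (gh x' \<omega>' \<xi>)"
  have "R x \<omega> x' \<omega>' - \<Gamma>0 ((x', \<omega>'), (y, \<eta>)) * R x \<omega> y \<eta> = (LINT \<xi>|lborel. ?I x' \<omega>' \<xi> - \<Gamma>0 ((x', \<omega>'), (y, \<eta>)) * ?I y \<eta> \<xi>)"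
    unfolding R_def using R_integrand_integrable by simp
  also have "\<dots> = of_real (S \<omega> \<omega>') * ifourier (integrand \<omega> \<omega>' (\<lambda>k t. cnj (g k t) - pert \<rho> \<tau> \<kappa> k t) 0) (x' - x)"
    unfolding ifourier_def integral_mult_right_zero[symmetric]
  proof (rule Bochner_Integration.integral_cong[OF refl])
    fix \<xi>
    define t where "t = b \<omega>' * (\<xi> - \<omega>')"
    have arg: "\<rho> * (t + \<tau>) = b \<eta> * (\<xi> - \<eta>)" using b by (simp add: \<rho>_def \<tau>_def t_def field_simps)
    have \<kappa>t: "\<kappa> * t = 2 * pi * (y - x') * (\<xi> - \<omega>')" using b by (simp add: \<kappa>_def t_def)
    have sq: "sqrt (b \<omega>') * sqrt \<rho> = sqrt (b \<eta>)" using b by (simp add: \<rho>_def real_sqrt_divide)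
    have pert0: "pert \<rho> \<tau> \<kappa> 0 t = of_real (sqrt \<rho>) * cis (2 * pi * (y - x') * (\<xi> - \<omega>')) * cnj (g 0 (b \<eta> * (\<xi> - \<eta>)))"
      by (simp add: pert_def Let_def arg \<kappa>t)
    let ?e = "cis (2 * pi * (x' - x) * \<xi>)"
    have c1: "cis (- (2 * pi * x * \<xi>)) * cis (2 * pi * x' * \<xi>) = ?e"
      by (simp add: cis_mult algebra_simps)
    have "2 * pi * (x' - y) * \<omega>' + (- (2 * pi * x * \<xi>) + 2 * pi * y * \<xi>) = 2 * pi * (x' - x) * \<xi> + 2 * pi * (y - x') * (\<xi> - \<omega>')"
      by (simp add: algebra_simps)
    then have c2: "\<Gamma>0 ((x', \<omega>'), (y, \<eta>)) * (cis (- (2 * pi * x * \<xi>)) * cis (2 * pi * y * \<xi>)) = ?e * cis (2 * pi * (y - x') * (\<xi> - \<omega>'))"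
      by (simp only: \<Gamma>0_def cis_mult fst_conv snd_conv)
    let ?a = "of_real (sqrt (b \<omega>)) * g 0 (b \<omega> * (\<xi> - \<omega>)) * N 0 \<xi>"
    have I: "?I x' \<omega>' \<xi> = (cis (- (2 * pi * x * \<xi>)) * cis (2 * pi * x' * \<xi>)) * (?a * of_real (sqrt (b \<omega>')) * cnj (g 0 (b \<omega>' * (\<xi> - \<omega>'))))" for x' \<omega>'
      by (simp add: gh_def cis_cnj mult_ac)
    have "\<Gamma>0 ((x', \<omega>'), (y, \<eta>)) * ?I y \<eta> \<xi> = ?e * (?a * of_real (sqrt (b \<omega>')) * pert \<rho> \<tau> \<kappa> 0 t)"
    proof -
      have "\<Gamma>0 ((x', \<omega>'), (y, \<eta>)) * ?I y \<eta> \<xi> = (\<Gamma>0 ((x', \<omega>'), (y, \<eta>)) * (cis (- (2 * pi * x * \<xi>)) * cis (2 * pi * y * \<xi>))) * (?a * of_real (sqrt (b \<eta>)) * cnj (g 0 (b \<eta> * (\<xi> - \<eta>))))"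
        unfolding I by (simp only: mult.assoc)
      then show ?thesis unfolding c2 pert0 sq[symmetric] by (simp add: mult_ac)
    qed
    then have "?I x' \<omega>' \<xi> - \<Gamma>0 ((x', \<omega>'), (y, \<eta>)) * ?I y \<eta> \<xi> = ?e * (?a * of_real (sqrt (b \<omega>')) * (cnj (g 0 t) - pert \<rho> \<tau> \<kappa> 0 t))"
      unfolding I[of x' \<omega>'] c1 by (simp add: t_def right_diff_distrib)
    then show "?I x' \<omega>' \<xi> - \<Gamma>0 ((x', \<omega>'), (y, \<eta>)) * ?I y \<eta> \<xi> =
      of_real (S \<omega> \<omega>') * (?e * integrand \<omega> \<omega>' (\<lambda>k t. cnj (g k t) - pert \<rho> \<tau> \<kappa> k t) 0 \<xi>)"
      by (simp add: integrand_def prod3_def scaled_def S_def t_def[symmetric] mult_ac)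
  qed
  finally show ?thesis .
qed

lemma R_difference_bound:
  assumes "\<bar>b \<eta> / b \<omega>' - 1\<bar> \<le> \<delta>" "\<bar>b \<omega>' * (\<omega>' - \<eta>)\<bar> \<le> \<delta>" "\<bar>2 * pi * (y - x') / b \<omega>'\<bar> \<le> \<delta>" "\<delta> \<le> 1/4"
  shows "cmod (R x \<omega> x' \<omega>' - \<Gamma>0 ((x', \<omega>'), (y, \<eta>)) * R x \<omega> y \<eta>) \<le> K0 * (12 * (2 powr r * C) * \<delta>) * H (x' - x) \<omega> \<omega>'"
  using kernel_bound[OF pert_decaying[OF assms], of \<omega> \<omega>' "x' - x"] S_pos[of \<omega> \<omega>']
  unfolding R_difference_eq by (simp add: norm_mult abs_of_pos)

text \<open>A covering set takes its scale from its centre, while \<rho>, \<tau> and \<kappa> refer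
  to \<omega>'. Smallness of 2 \<epsilon> c makes the two scales comparable up to the factor 2. Then
  8 pi stems from \<kappa>: 2 pi times the side length 2 \<epsilon> \<beta>, doubled by the change
  of scale. The term 12 c stems from \<rho>: \<open>beta_local\<close> with 6 \<epsilon> c.\<close>

lemma Q_set_close:
  assumes c: "c > 0" and \<epsilon>: "\<epsilon> > 0" "2 * \<epsilon> * c \<le> 1/12" and Q: "(y, \<eta>) \<in> Q_set \<alpha> c \<epsilon> x' \<omega>'"
  shows "\<bar>b \<eta> / b \<omega>' - 1\<bar> \<le> (8 * pi + 12 * c) * \<epsilon>" "\<bar>b \<omega>' * (\<omega>' - \<eta>)\<bar> \<le> (8 * pi + 12 * c) * \<epsilon>"
    "\<bar>2 * pi * (y - x') / b \<omega>'\<bar> \<le> (8 * pi + 12 * c) * \<epsilon>"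
proof -
  obtain j k where jk: "(x', \<omega>') \<in> cover_set \<alpha> c \<epsilon> (j, k)" "(y, \<eta>) \<in> cover_set \<alpha> c \<epsilon> (j, k)"
    using Q by (auto simp: Q_set_def)
  define wj where "wj = omega_j \<alpha> \<epsilon> j"
  define B where "B = b wj"
  have B: "B > 0" by (simp add: B_def beta_pos)
  have b': "b \<omega>' > 0" by (rule beta_pos)
  have x: "\<epsilon> * B * (of_int k - 1) < x'" "x' < \<epsilon> * B * (of_int k + 1)" "\<epsilon> * B * (of_int k - 1) < y" "y < \<epsilon> * B * (of_int k + 1)"
    and w: "wj - 2 * \<epsilon> * c * inverse B < \<omega>'" "\<omega>' < wj + 2 * \<epsilon> * c * inverse B" "wj - 2 * \<epsilon> * c * inverse B < \<eta>" "\<eta> < wj + 2 * \<epsilon> * c * inverse B"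
    using jk by (auto simp: cover_set_def Let_def wj_def B_def)
  have "\<bar>y - x'\<bar> \<le> \<epsilon> * B * (of_int k + 1) - \<epsilon> * B * (of_int k - 1)" using x by (auto simp: abs_le_iff)
  also have "\<dots> = 2 * \<epsilon> * B" by (simp add: algebra_simps)
  finally have yx: "\<bar>y - x'\<bar> \<le> 2 * \<epsilon> * B" .
  have "\<bar>\<omega>' - wj\<bar> \<le> 2 * \<epsilon> * c * inverse B" using w by (auto simp: abs_le_iff)
  then have "\<bar>\<omega>' - wj\<bar> * B \<le> 2 * \<epsilon> * c * inverse B * B" using B by (intro mult_right_mono) auto
  also have "2 * \<epsilon> * c * inverse B * B = 2 * \<epsilon> * c" using B by (simp add: field_simps)
  finally have wB: "\<bar>\<omega>' - wj\<bar> * b wj \<le> 2 * \<epsilon> * c" by (simp only: B_def)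
  have r1: "\<bar>b \<omega>' / B - 1\<bar> \<le> 2 * (2 * \<epsilon> * c)" unfolding B_def
    using beta_local[OF \<alpha> wB] \<epsilon> by simp
  then have "b \<omega>' / B \<ge> 1/2" "b \<omega>' / B \<le> 3/2" using \<epsilon> by (auto simp: abs_le_iff)
  then have bB: "B \<le> 2 * b \<omega>'" "b \<omega>' \<le> 3/2 * B" using B by (auto simp: field_simps)
  have "\<bar>\<omega>' - \<eta>\<bar> \<le> 4 * \<epsilon> * c * inverse B" using w by (auto simp: abs_le_iff)
  then have "b \<omega>' * \<bar>\<omega>' - \<eta>\<bar> \<le> (3/2 * B) * (4 * \<epsilon> * c * inverse B)" using bB b' B by (intro mult_mono) auto
  also have "\<dots> = 6 * \<epsilon> * c" using B by simp
  finally have \<tau>: "b \<omega>' * \<bar>\<omega>' - \<eta>\<bar> \<le> 6 * \<epsilon> * c" .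
  have pos: "0 \<le> pi * \<epsilon>" "0 \<le> c * \<epsilon>" using \<epsilon> c by auto
  have "\<bar>b \<omega>' * (\<omega>' - \<eta>)\<bar> = b \<omega>' * \<bar>\<omega>' - \<eta>\<bar>" using b' by (simp add: abs_mult)
  also have "\<dots> \<le> (8 * pi + 12 * c) * \<epsilon>" using \<tau> pos by (simp add: algebra_simps)
  finally show "\<bar>b \<omega>' * (\<omega>' - \<eta>)\<bar> \<le> (8 * pi + 12 * c) * \<epsilon>" .
  have "\<bar>\<eta> - \<omega>'\<bar> * b \<omega>' \<le> 6 * \<epsilon> * c" using \<tau> by (simp add: mult.commute abs_minus_commute)
  from beta_local[OF \<alpha> this] have "\<bar>b \<eta> / b \<omega>' - 1\<bar> \<le> 2 * (6 * \<epsilon> * c)" using \<epsilon> by simp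
  also have "\<dots> \<le> (8 * pi + 12 * c) * \<epsilon>" using pos by (simp add: algebra_simps)
  finally show "\<bar>b \<eta> / b \<omega>' - 1\<bar> \<le> (8 * pi + 12 * c) * \<epsilon>" .
  have "\<bar>y - x'\<bar> \<le> 2 * \<epsilon> * (2 * b \<omega>')" by (rule order_trans[OF yx mult_left_mono[OF bB(1)]]) (use \<epsilon> in simp)
  then have "2 * pi * \<bar>y - x'\<bar> \<le> 2 * pi * (2 * \<epsilon> * (2 * b \<omega>'))" by (intro mult_left_mono) auto
  then have "2 * pi * \<bar>y - x'\<bar> / b \<omega>' \<le> 8 * pi * \<epsilon>" using b' by (simp add: pos_divide_le_eq mult_ac)
  also have "\<dots> \<le> (8 * pi + 12 * c) * \<epsilon>" using pos by (simp add: algebra_simps)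
  finally show "\<bar>2 * pi * (y - x') / b \<omega>'\<bar> \<le> (8 * pi + 12 * c) * \<epsilon>" using b' by (simp add: abs_mult)
qed

end

section \<open>Bounds for \<open>gamma1\<close> and \<open>gamma2\<close> and their limit\<close>

context wavelet_generator
begin

lemma osc_bound:
  assumes c: "c > 0" and \<epsilon>: "\<epsilon> > 0" "2 * \<epsilon> * c \<le> 1/12" "(8 * pi + 12 * c) * \<epsilon> \<le> 1/4"
  shows "osc \<alpha> \<psi> c \<epsilon> \<Gamma>0 x \<omega> x' \<omega>' \<le> ennreal (K0 * (12 * (2 powr r * C) * ((8 * pi + 12 * c) * \<epsilon>))) * ennreal (H (x' - x) \<omega> \<omega>')"
proof -
  let ?K = "K0 * (12 * (2 powr r * C) * ((8 * pi + 12 * c) * \<epsilon>))"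
  have K: "?K \<ge> 0" using K0_nonneg C c \<epsilon> pi_gt_zero by simp
  have "ennreal (cmod (R x \<omega> x' \<omega>' - \<Gamma>0 ((x', \<omega>'), (y, \<eta>)) * R x \<omega> y \<eta>)) \<le> ennreal ?K * ennreal (H (x' - x) \<omega> \<omega>')"
    if "(y, \<eta>) \<in> Q_set \<alpha> c \<epsilon> x' \<omega>'" for y \<eta>
    unfolding ennreal_mult[OF K H_nonneg, symmetric]
    by (intro ennreal_leI R_difference_bound Q_set_close[OF c \<epsilon>(1,2) that] \<epsilon>(3))
  then show ?thesis
    unfolding osc_def repr_kernel_eq by (intro SUP_least) auto
qed

lemma gamma_bounds:
  assumes c: "c > 0" and \<epsilon>: "\<epsilon> > 0" "2 * \<epsilon> * c \<le> 1/12" "(8 * pi + 12 * c) * \<epsilon> \<le> 1/4"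
  defines "K \<equiv> K0 * (12 * (2 powr r * C) * ((8 * pi + 12 * c) * \<epsilon>))"
  shows "gamma1 \<alpha> s \<psi> c \<Gamma>0 \<epsilon> \<le> ennreal K * ennreal Wc" "gamma2 \<alpha> s \<psi> c \<Gamma>0 \<epsilon> \<le> ennreal K * ennreal Wc"
proof -
  note ob = osc_bound[OF c \<epsilon>, folded K_def]
  \<comment> \<open>\<open>F\<close> is arbitrary, because the nonnegative integral is monotone for
    all functions; measurability is used for the majorant alone. Thus nothing has to be proved about
    the supremum in \<open>osc\<close>.\<close>
  have plane: "(\<integral>\<^sup>+ z. F z \<partial>lborel) \<le> ennreal K * ennreal Wc"
    if "\<And>z. F z \<le> ennreal K * (ennreal (H (fst z - a) (snd z) \<omega>0) * ennreal (weight s (snd z) \<omega>0))" for F :: "real \<times> real \<Rightarrow> ennreal" and a \<omega>0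
  proof -
    have m: "(\<lambda>z. ennreal (H (fst z - a) (snd z) \<omega>0) * ennreal (weight s (snd z) \<omega>0)) \<in> borel_measurable (lborel :: (real \<times> real) measure)"
      by (simp add: borel_prod[symmetric])
    have "(\<integral>\<^sup>+ z. F z \<partial>lborel) \<le> (\<integral>\<^sup>+ z. ennreal K * (ennreal (H (fst z - a) (snd z) \<omega>0) * ennreal (weight s (snd z) \<omega>0)) \<partial>lborel)"
      by (intro nn_integral_mono that)
    moreover have "\<dots> = ennreal K * (\<integral>\<^sup>+ z. ennreal (H (fst z - a) (snd z) \<omega>0) * ennreal (weight s (snd z) \<omega>0) \<partial>lborel)"
      by (rule nn_integral_cmult[OF m])
    moreover have "\<dots> \<le> ennreal K * ennreal Wc"
      by (intro mult_left_mono nn_integral_H_plane) simp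
    ultimately show ?thesis by (simp only: order_trans)
  qed
  show "gamma1 \<alpha> s \<psi> c \<Gamma>0 \<epsilon> \<le> ennreal K * ennreal Wc"
    unfolding gamma1_def
  proof (intro SUP_least, clarsimp)
    fix x' \<omega>'
    show "(\<integral>\<^sup>+ (x, \<omega>). osc \<alpha> \<psi> c \<epsilon> \<Gamma>0 x \<omega> x' \<omega>' * ennreal (weight s \<omega> \<omega>') \<partial>lborel) \<le> ennreal K * ennreal Wc"
    proof (rule plane[of _ x' \<omega>'])
      fix z :: "real \<times> real"
      \<comment> \<open>The first point is the integration variable here, so evenness of
        \<open>H\<close> in x is used; the estimate for \<open>gamma2\<close> uses the symmetry in
        the frequencies instead.\<close>
      have "H (x' - fst z) (snd z) \<omega>' = H (fst z - x') (snd z) \<omega>'" using H_even[of "fst z - x'"] by simp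
      then show "(case z of (x, \<omega>) \<Rightarrow> osc \<alpha> \<psi> c \<epsilon> \<Gamma>0 x \<omega> x' \<omega>' * ennreal (weight s \<omega> \<omega>')) \<le>
        ennreal K * (ennreal (H (fst z - x') (snd z) \<omega>') * ennreal (weight s (snd z) \<omega>'))"
        using mult_right_mono[OF ob[of "fst z" "snd z" x' \<omega>'], of "ennreal (weight s (snd z) \<omega>')"]
        by (simp add: case_prod_unfold mult.assoc)
    qed
  qed
  show "gamma2 \<alpha> s \<psi> c \<Gamma>0 \<epsilon> \<le> ennreal K * ennreal Wc"
    unfolding gamma2_def
  proof (intro SUP_least, clarsimp)
    fix x \<omega>
    show "(\<integral>\<^sup>+ (x', \<omega>'). osc \<alpha> \<psi> c \<epsilon> \<Gamma>0 x \<omega> x' \<omega>' * ennreal (weight s \<omega> \<omega>') \<partial>lborel) \<le> ennreal K * ennreal Wc"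
    proof (rule plane[of _ x \<omega>])
      fix z :: "real \<times> real"
      show "(case z of (x', \<omega>') \<Rightarrow> osc \<alpha> \<psi> c \<epsilon> \<Gamma>0 x \<omega> x' \<omega>' * ennreal (weight s \<omega> \<omega>')) \<le>
        ennreal K * (ennreal (H (fst z - x) (snd z) \<omega>) * ennreal (weight s (snd z) \<omega>))"
        using mult_right_mono[OF ob[of x \<omega> "fst z" "snd z"], of "ennreal (weight s (snd z) \<omega>)"]
        by (simp add: case_prod_unfold mult.assoc H_commute[of _ \<omega>] weight_sym[of s \<omega>])
    qed
  qed
qed

theorem gamma_tendsto_zero:
  assumes c: "c > 0"
  shows "((\<lambda>\<epsilon>. max (gamma1 \<alpha> s \<psi> c \<Gamma>0 \<epsilon>) (gamma2 \<alpha> s \<psi> c \<Gamma>0 \<epsilon>)) \<longlongrightarrow> 0) (at_right 0)"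
proof -
  let ?K = "\<lambda>\<epsilon>. K0 * (12 * (2 powr r * C) * ((8 * pi + 12 * c) * \<epsilon>))"
  have "((\<lambda>\<epsilon>. ?K \<epsilon> * Wc) \<longlongrightarrow> ?K 0 * Wc) (at_right 0)" by (intro tendsto_intros)
  then have "((\<lambda>\<epsilon>. ennreal (?K \<epsilon> * Wc)) \<longlongrightarrow> ennreal (?K 0 * Wc)) (at_right 0)" by (rule tendsto_ennrealI)
  then have lim: "((\<lambda>\<epsilon>. ennreal (?K \<epsilon> * Wc)) \<longlongrightarrow> 0) (at_right 0)" by simp
  have p: "8 * pi + 12 * c > 0" using pi_gt_zero c by (intro add_pos_pos) auto
  \<comment> \<open>The two smallness conditions of \<open>gamma_bounds\<close>, solved for
    \<epsilon>.\<close>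
  define \<epsilon>1 where "\<epsilon>1 = min (1 / (24 * c)) (1 / (4 * (8 * pi + 12 * c)))"
  have \<epsilon>1: "\<epsilon>1 > 0" using p c by (simp add: \<epsilon>1_def)
  have "eventually (\<lambda>\<epsilon>. max (gamma1 \<alpha> s \<psi> c \<Gamma>0 \<epsilon>) (gamma2 \<alpha> s \<psi> c \<Gamma>0 \<epsilon>) \<le> ennreal (?K \<epsilon> * Wc)) (at_right 0)"
    unfolding eventually_at_right_field
  proof (intro exI[of _ \<epsilon>1] conjI \<epsilon>1 allI impI)
    fix \<epsilon> :: real assume e: "0 < \<epsilon>" "\<epsilon> < \<epsilon>1"
    have "\<epsilon> \<le> 1 / (24 * c)" "\<epsilon> \<le> 1 / (4 * (8 * pi + 12 * c))" using e by (auto simp: \<epsilon>1_def)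
    moreover have "24 * c > 0" "4 * (8 * pi + 12 * c) > 0" using c p by auto
    ultimately have "\<epsilon> * (24 * c) \<le> 1" "\<epsilon> * (4 * (8 * pi + 12 * c)) \<le> 1"
      by (simp_all only: pos_le_divide_eq)
    then have "2 * \<epsilon> * c \<le> 1/12" "(8 * pi + 12 * c) * \<epsilon> \<le> 1/4" by (auto simp: algebra_simps)
    note gb = gamma_bounds[OF c e(1) this]
    have "ennreal (?K \<epsilon> * Wc) = ennreal (?K \<epsilon>) * ennreal Wc"
      using K0_nonneg C p e Wc_nonneg by (intro ennreal_mult) auto
    with gb show "max (gamma1 \<alpha> s \<psi> c \<Gamma>0 \<epsilon>) (gamma2 \<alpha> s \<psi> c \<Gamma>0 \<epsilon>) \<le> ennreal (?K \<epsilon> * Wc)" by simp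
  qed
  then show ?thesis
    by (rule tendsto_sandwich[OF always_eventually[OF allI[OF zero_le]] _ tendsto_const lim])
qed

end

theorem theorem5p9:
  fixes \<alpha> s r C c \<epsilon>0 :: real and \<psi> \<psi>hat :: "real \<Rightarrow> complex"
  assumes "0 \<le> \<alpha>" and "\<alpha> < 1" and "s \<ge> 0"
    and "L2 \<psi>" and "\<not> (AE t in lborel. \<psi> t = 0)"
    and "is_fourier_transform \<psi> \<psi>hat" and "C_k 3 \<psi>hat"
    and "C > 0"
    and "\<And>n \<xi>. n \<le> 3 \<Longrightarrow> cmod (nth_deriv n \<psi>hat \<xi>) \<le> C * (1 + \<bar>\<xi>\<bar>) powr (- r)"
    and "r > (2 + 2 * s + 7 * \<alpha> - 4 * \<alpha>\<^sup>2) / (2 * (1 - \<alpha>)\<^sup>2) + 1"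
    and "c > 0" and "\<epsilon>0 > 0"
    and "\<And>\<epsilon>. 0 < \<epsilon> \<Longrightarrow> \<epsilon> < \<epsilon>0 \<Longrightarrow> admissible_covering (cover_set \<alpha> c \<epsilon>)"
  shows "\<exists>\<Gamma> :: (real \<times> real) \<times> (real \<times> real) \<Rightarrow> complex.
      \<Gamma> \<in> borel_measurable borel \<and> (\<forall>z. cmod (\<Gamma> z) = 1) \<and>
      ((\<lambda>\<epsilon>. max (gamma1 \<alpha> s \<psi> c \<Gamma> \<epsilon>) (gamma2 \<alpha> s \<psi> c \<Gamma> \<epsilon>)) \<longlongrightarrow> 0) (at_right 0)"
proof -
  define g where "g n = nth_deriv n \<psi>hat" for n
  have g0: "g 0 = \<psi>hat" by (simp add: g_def nth_deriv_def)
  have deriv: "(g n has_vector_derivative g (Suc n) t) (at t)" if "n < 3" for n t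
  proof -
    have "g n differentiable (at t)" using assms(7) that by (simp add: C_k_def g_def)
    then have "(g n has_vector_derivative vector_derivative (g n) (at t)) (at t)"
      by (simp add: vector_derivative_works)
    then show ?thesis by (simp add: g_def nth_deriv_def)
  qed
  \<comment> \<open>If the transform vanished identically, inversion would force \<psi> = 0 almost
    everywhere.\<close>
  have nonzero: "\<exists>t. g 0 t \<noteq> 0"
  proof (rule ccontr)
    assume "\<not> ?thesis"
    then have z: "\<psi>hat = (\<lambda>_. 0)" by (auto simp: g0 fun_eq_iff)
    have i: "ifourier \<psi>hat = (\<lambda>_. 0)" by (simp add: z ifourier_def fun_eq_iff)
    have "AE t in lborel. \<psi> t = ifourier \<psi>hat t"
      by (rule fourier_transform_inversion_AE[OF assms(4,6)]) (simp_all add: i, simp_all add: z L2_def)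
    with assms(5) show False by (simp add: i)
  qed
  have w: "wavelet \<alpha> s r C g"
  proof
    show "continuous_on UNIV (g 3)" using assms(7) by (simp add: C_k_def g_def)
    show "cmod (g n t) \<le> C * (1 + \<bar>t\<bar>) powr - r" if "n \<le> 3" for n t
      using assms(9)[OF that] by (simp add: g_def)
  qed (use assms deriv nonzero in auto)
  \<comment> \<open>The decay of the transform, available through the locale, makes
    \<open>\<psi>1\<close> square integrable, so inversion applies and identifies \<psi> with
    it.\<close>
  have ae: "AE t in lborel. \<psi> t = wavelet.\<psi>1 g t"
    using fourier_transform_inversion_AE[OF assms(4,6)] wavelet.g_integrable[OF w, of 0] wavelet.\<psi>1_L2[OF w]
    by (simp add: wavelet.\<psi>1_def[OF w] g0)
  interpret wavelet_generator \<alpha> s r C g \<psi>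
    by (rule wavelet_generator.intro[OF w]) (unfold_locales, rule assms(4), rule ae)
  show ?thesis
    using \<Gamma>0_measurable gamma_tendsto_zero[OF assms(11)] by (intro exI[of _ \<Gamma>0]) (auto simp: \<Gamma>0_def)
qed

end
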